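(* Let $\Omega$ and $k$ be as in the context. Let $\alpha\in[0,1)$ be such that for all sufficiently small $\delta>0$ there are constants $c,C>0$ such that every spectral cluster $p$ of width $\delta$ satisfies $$c\|p\|_{L^2(\Omega)}^2\le\int_{\partial\Omega}|\Gamma p|^2\,dS\le C\,(1+\lambda(p))^{\alpha}\|p\|_{L^2(\Omega)}^2 .$$ Assume that $$|\hat k(is)|\,\frac{|\hat k(is)|^2}{(\operatorname{Re}\hat k(is))^2}=o\!\left(\frac1{L(s)}\right)\ \text{ as } s\to\infty,\qquad\text{where } L(s)=s^\alpha(1+\log s)\ \text{ for } s\ge1 .$$ Then there is a constant $C>0$ such that $$\|R(is)\|_{L^2(\Omega)\to L^2(\Omega)}\le\frac{C}{s\operatorname{Re}\hat k(is)}\qquad\text{for all } s\ge1 .$$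
   Context: $\Omega\subset\mathbb R^d$ is a bounded domain with Lipschitz boundary; $dS$ is surface measure on $\partial\Omega$ (counting measure if $d=1$); $\Gamma:H^1(\Omega)\to L^2(\partial\Omega)$ is the trace operator. All function spaces are complex. $k:(0,\infty)\to[0,\infty)$ is an integrable, completely monotonic function, not identically zero, i.e. $k(t)=\int_{[0,\infty)}e^{-\tau t}\,d\nu(\tau)$ with a positive Radon measure $\nu$ on $[0,\infty)$; integrability means $\nu(\{0\})=0$ and $\int_0^\infty\tau^{-1}d\nu(\tau)<\infty$. For $z\in\mathbb C\setminus(-\infty,0)$ put $\hat k(z)=\int_0^\infty\frac{d\nu(\tau)}{z+\tau}$ (the Laplace transform of $k$ and its analytic continuation). For $z\in\mathbb C\setminus(-\infty,0)$ let $a_z(p,u)=z^2\int_\Omega p\overline u+\int_\Omega\nabla p\cdot\nabla\overline u+z\hat k(z)\int_{\partial\Omega}\Gamma p\,\overline{\Gamma u}\,dS$ on $H^1(\Omega)\times H^1(\Omega)$. If for every $F\in H^1(\Omega)^*$ (bounded antilinear functionals) there is a unique $u\in H^1(\Omega)$ with $a_z(u,\eta)=\langle F,\eta\rangle$ for all $\eta\in H^1(\Omega)$, then $R(z):H^1(\Omega)^*\to H^1(\Omega)$, $F\mapsto u$; $f\in L^2(\Omega)$ is identified with $\eta\mapsto\int_\Omega f\overline\eta$. It is known that $R(is)$ exists for all real $s\ne0$. Let $(u_j)_{j\ge1}$ be an orthonormal basis of $L^2(\Omega)$ of eigenfunctions of the Neumann Laplacian, $-\Delta u_j=\lambda_j^2u_j$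 in $\Omega$, $\partial_nu_j=0$ on $\partial\Omega$, with frequencies $0\le\lambda_1\le\lambda_2\le\dots$ counted with multiplicity. A nonzero $p=\sum_ja_ju_j\in L^2(\Omega)$ is a spectral cluster of width $\delta>0$ if $\sup\{|\lambda_j-\lambda_i|:a_j\ne0,\ a_i\neq0\}\le\delta$. Its mean frequency $\lambda(p)\ge0$ is defined by $\lambda(p)^2=\sum_j|a_j|^2\lambda_j^2/\|p\|_{L^2(\Omega)}^2$. *)

theory Defs
  imports "HOL-Analysis.Analysis" "HOL-Library.Landau_Symbols"
begin

section \<open>Hausdorff measure and surface measure\<close>

definition hausdorff_weight :: "nat \<Rightarrow> 'a::metric_space set \<Rightarrow> ennreal" where
  "hausdorff_weight m U =
     (if U = {} then 0 else ennreal (unit_ball_vol (real m) * (diameter U / 2) ^ m))"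

definition hausdorff_pre :: "nat \<Rightarrow> real \<Rightarrow> 'a::metric_space set \<Rightarrow> ennreal" where
  "hausdorff_pre m \<delta> A =
     (INF U\<in>{U :: nat \<Rightarrow> 'a set. A \<subseteq> (\<Union>i. U i) \<and> (\<forall>i. bounded (U i) \<and> diameter (U i) \<le> \<delta>)}.
        \<Sum>i. hausdorff_weight m (U i))"

text \<open>Normalised so that it agrees with Lebesgue measure on m-dimensional subspaces;
  for m = 0 it is counting measure (note that \<open>0 ^ 0 = 1\<close>).\<close>

definition hausdorff_outer :: "nat \<Rightarrow> 'a::metric_space set \<Rightarrow> ennreal" where
  "hausdorff_outer m A = (SUP \<delta>\<in>{0<..}. hausdorff_pre m \<delta> A)"

definition surface_measure :: "'a::euclidean_space set \<Rightarrow> 'a measure" where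
  "surface_measure \<Omega> =
     measure_of UNIV (sets borel) (\<lambda>A. hausdorff_outer (DIM('a) - 1) (A \<inter> frontier \<Omega>))"

text \<open>\<open>measure_of\<close> would silently give the zero measure if the set function were not countably
  additive; \<open>emeasure_surface_measure\<close> below shows that it is.\<close>

lemma hausdorff_pre_antimono:
  assumes "\<delta> \<le> \<delta>'" shows "hausdorff_pre m \<delta>' A \<le> hausdorff_pre m \<delta> A"
  unfolding hausdorff_pre_def using assms by (intro INF_superset_mono) (auto intro: order_trans)

lemma hausdorff_pre_mono:
  assumes "A \<subseteq> B" shows "hausdorff_pre m \<delta> A \<le> hausdorff_pre m \<delta> B"
  unfolding hausdorff_pre_def using assms by (intro INF_superset_mono) auto

lemma hausdorff_pre_le_outer: "\<delta> > 0 \<Longrightarrow> hausdorff_pre m \<delta> A \<le> hausdorff_outer m A"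
  unfolding hausdorff_outer_def by (intro SUP_upper) auto

lemma hausdorff_outer_mono: "A \<subseteq> B \<Longrightarrow> hausdorff_outer m A \<le> hausdorff_outer m B"
  unfolding hausdorff_outer_def by (intro SUP_mono) (auto intro: hausdorff_pre_mono)

lemma hausdorff_outer_empty: "hausdorff_outer m ({} :: 'a::metric_space set) = 0"
proof -
  have "hausdorff_pre m \<delta> ({} :: 'a set) \<le> 0" if "\<delta> > 0" for \<delta>
  proof -
    have "hausdorff_pre m \<delta> ({} :: 'a set) \<le> (\<Sum>i. hausdorff_weight m ((\<lambda>_::nat. {} :: 'a set) i))"
      unfolding hausdorff_pre_def using that by (intro INF_lower) auto
    then show ?thesis by (simp add: hausdorff_weight_def)
  qed
  then have "hausdorff_outer m ({} :: 'a set) \<le> 0"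
    unfolding hausdorff_outer_def by (intro SUP_least) auto
  then show ?thesis by simp
qed

lemma hausdorff_outer_UN_le:
  fixes A :: "nat \<Rightarrow> 'a::metric_space set"
  shows "hausdorff_outer m (\<Union>i. A i) \<le> (\<Sum>i. hausdorff_outer m (A i))"
proof -
  have "hausdorff_pre m \<delta> (\<Union>i. A i) \<le> (\<Sum>i. hausdorff_outer m (A i))" if d: "\<delta> > 0" for \<delta>
  proof (rule ennreal_le_epsilon)
    fix e :: real assume top: "(\<Sum>i. hausdorff_outer m (A i)) < top" and e: "0 < e"
    let ?Q = "\<lambda>B. {U :: nat \<Rightarrow> 'a set. B \<subseteq> (\<Union>i. U i) \<and> (\<forall>i. bounded (U i) \<and> diameter (U i) \<le> \<delta>)}"
    have "\<forall>i. \<exists>U. U \<in> ?Q (A i) \<and>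
        (\<Sum>j. hausdorff_weight m (U j)) \<le> hausdorff_outer m (A i) + ennreal (e * (1/2) ^ Suc i)"
    proof
      fix i
      have fin: "hausdorff_outer m (A i) < top"
        using top by (meson ennreal_suminf_lessD)
      have "hausdorff_outer m (A i) < hausdorff_outer m (A i) + ennreal (e * (1/2) ^ Suc i)"
        using fin e by (simp add: ennreal_zero_less_mult_iff)
      then have "hausdorff_pre m \<delta> (A i) < hausdorff_outer m (A i) + ennreal (e * (1/2) ^ Suc i)"
        using hausdorff_pre_le_outer[OF d] by (rule le_less_trans[rotated])
      then obtain U where "U \<in> ?Q (A i)"
        "(\<Sum>j. hausdorff_weight m (U j)) < hausdorff_outer m (A i) + ennreal (e * (1/2) ^ Suc i)"
        unfolding hausdorff_pre_def INF_less_iff by blast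
      then show "\<exists>U. U \<in> ?Q (A i) \<and>
          (\<Sum>j. hausdorff_weight m (U j)) \<le> hausdorff_outer m (A i) + ennreal (e * (1/2) ^ Suc i)"
        using less_imp_le by blast
    qed
    from choice[OF this]
    obtain U where U: "\<And>i. U i \<in> ?Q (A i)"
      "\<And>i. (\<Sum>j. hausdorff_weight m (U i j)) \<le> hausdorff_outer m (A i) + ennreal (e * (1/2) ^ Suc i)"
      by blast
    define V where "V k = (case prod_decode k of (i, j) \<Rightarrow> U i j)" for k
    have inQ: "V \<in> ?Q (\<Union>i. A i)"
    proof -
      have "(\<Union>i. A i) \<subseteq> (\<Union>k. V k)"
      proof
        fix x assume "x \<in> (\<Union>i. A i)"
        then obtain i j where "x \<in> U i j" using U(1) by blast
        then have "x \<in> V (prod_encode (i, j))" by (simp add: V_def)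
        then show "x \<in> (\<Union>k. V k)" by blast
      qed
      then show ?thesis using U(1) by (auto simp: V_def split: prod.split)
    qed
    have "hausdorff_pre m \<delta> (\<Union>i. A i) \<le> (\<Sum>k. hausdorff_weight m (V k))"
      unfolding hausdorff_pre_def using inQ by (rule INF_lower)
    also have "\<dots> = (\<Sum>k. case_prod (\<lambda>i j. hausdorff_weight m (U i j)) (prod_decode k))"
      by (intro suminf_cong) (simp add: V_def split: prod.split)
    also have "\<dots> = (\<Sum>i. \<Sum>j. hausdorff_weight m (U i j))"
      using suminf_ennreal_2dimen[of "\<lambda>i. \<Sum>j. hausdorff_weight m (U i j)"
          "case_prod (\<lambda>i j. hausdorff_weight m (U i j))"] by (simp add: o_def)
    also have "\<dots> \<le> (\<Sum>i. hausdorff_outer m (A i) + ennreal (e * (1/2) ^ Suc i))"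
      by (intro suminf_le U(2)) auto
    also have "\<dots> = (\<Sum>i. hausdorff_outer m (A i)) + (\<Sum>i. ennreal (e * (1/2) ^ Suc i))"
      by (intro suminf_add[symmetric]) auto
    also have "(\<Sum>i. ennreal (e * (1/2) ^ Suc i)) = ennreal e"
    proof -
      have "(\<lambda>i. e * (1/2) ^ Suc i) sums (e * 1)"
        by (intro sums_mult power_half_series)
      then show ?thesis using e by (intro suminf_ennreal_eq) auto
    qed
    finally show "hausdorff_pre m \<delta> (\<Union>i. A i) \<le> (\<Sum>i. hausdorff_outer m (A i)) + ennreal e" .
  qed
  then show ?thesis
    unfolding hausdorff_outer_def[of m "\<Union>i. A i"] by (intro SUP_least) auto
qed

lemma hausdorff_outer_Un_le:
  "hausdorff_outer m (A \<union> B) \<le> hausdorff_outer m A + hausdorff_outer m B"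
proof -
  have "hausdorff_outer m (\<Union>i. binaryset A B i) \<le> (\<Sum>i. hausdorff_outer m (binaryset A B i))"
    by (rule hausdorff_outer_UN_le)
  then show ?thesis
    using suminf_binaryset_eq[where f = "hausdorff_outer m" and A = A and B = B, OF hausdorff_outer_empty]
    by (simp add: UN_binaryset_eq)
qed

lemma hausdorff_outer_separated:
  fixes A B :: "'a::metric_space set"
  assumes r: "r > 0" "\<And>x y. x \<in> A \<Longrightarrow> y \<in> B \<Longrightarrow> r \<le> dist x y"
  shows "hausdorff_outer m A + hausdorff_outer m B \<le> hausdorff_outer m (A \<union> B)"
proof -
  have *: "hausdorff_pre m \<delta> A + hausdorff_pre m \<delta> B \<le> hausdorff_pre m \<delta> (A \<union> B)"
    if "\<delta> < r" for \<delta>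
    unfolding hausdorff_pre_def[of m \<delta> "A \<union> B"]
  proof (rule INF_greatest)
    fix U :: "nat \<Rightarrow> 'a set"
    assume U: "U \<in> {U. A \<union> B \<subseteq> (\<Union>i. U i) \<and> (\<forall>i. bounded (U i) \<and> diameter (U i) \<le> \<delta>)}"
    define V where "V D i = (if U i \<inter> D = {} then {} else U i)" for D i
    have d: "0 \<le> \<delta>"
      using U diameter_ge_0 by (metis (no_types, lifting) mem_Collect_eq order_trans)
    have le: "hausdorff_pre m \<delta> D \<le> (\<Sum>i. hausdorff_weight m (V D i))" if "D \<subseteq> A \<union> B" for D
    proof -
      have "D \<subseteq> (\<Union>i. V D i)"
      proof
        fix x assume x: "x \<in> D"
        then have "x \<in> (\<Union>i. U i)" using U that by blast
        then obtain i where "x \<in> U i" by blast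
        with x have "x \<in> V D i" by (auto simp: V_def)
        then show "x \<in> (\<Union>i. V D i)" by blast
      qed
      then show ?thesis
        unfolding hausdorff_pre_def using U d by (intro INF_lower) (auto simp: V_def)
    qed
    have disj: "V A i = {} \<or> V B i = {}" for i
    proof (rule ccontr)
      assume "\<not> (V A i = {} \<or> V B i = {})"
      then obtain x y where xy: "x \<in> U i" "x \<in> A" "y \<in> U i" "y \<in> B"
        by (auto simp: V_def split: if_splits)
      have "bounded (U i)" "diameter (U i) \<le> \<delta>" using U by auto
      then have "dist x y \<le> \<delta>"
        using diameter_bounded_bound[OF _ xy(1,3)] by linarith
      with r(2)[OF xy(2,4)] that show False by linarith
    qed
    have "hausdorff_pre m \<delta> A + hausdorff_pre m \<delta> B
        \<le> (\<Sum>i. hausdorff_weight m (V A i)) + (\<Sum>i. hausdorff_weight m (V B i))"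
      by (intro add_mono le) auto
    also have "\<dots> = (\<Sum>i. hausdorff_weight m (V A i) + hausdorff_weight m (V B i))"
      by (intro suminf_add) auto
    also have "\<dots> \<le> (\<Sum>i. hausdorff_weight m (U i))"
    proof (intro suminf_le)
      fix i show "hausdorff_weight m (V A i) + hausdorff_weight m (V B i) \<le> hausdorff_weight m (U i)"
        using disj[of i] by (cases "V A i = {}") (auto simp: V_def hausdorff_weight_def)
    qed auto
    finally show "hausdorff_pre m \<delta> A + hausdorff_pre m \<delta> B \<le> (\<Sum>i. hausdorff_weight m (U i))" .
  qed
  have **: "hausdorff_pre m d1 A + hausdorff_pre m d2 B \<le> hausdorff_outer m (A \<union> B)"
    if "d1 > 0" "d2 > 0" for d1 d2
  proof -
    define d where "d = min (r/2) (min d1 d2)"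
    have d: "0 < d" "d < r" "d \<le> d1" "d \<le> d2" using that r by (auto simp: d_def)
    have "hausdorff_pre m d1 A + hausdorff_pre m d2 B \<le> hausdorff_pre m d A + hausdorff_pre m d B"
      using d by (intro add_mono hausdorff_pre_antimono)
    also have "\<dots> \<le> hausdorff_pre m d (A \<union> B)" using d by (intro *)
    also have "\<dots> \<le> hausdorff_outer m (A \<union> B)" using d by (intro hausdorff_pre_le_outer)
    finally show ?thesis .
  qed
  have ne: "{0<..} \<noteq> ({} :: real set)" by auto
  have ***: "hausdorff_pre m d1 A + hausdorff_outer m B \<le> hausdorff_outer m (A \<union> B)" if "d1 > 0" for d1
    unfolding hausdorff_outer_def[of m B]
    using ** that by (subst ennreal_SUP_add_right[OF ne]) (intro SUP_least, auto)
  show ?thesis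
    unfolding hausdorff_outer_def[of m A]
    using *** by (subst ennreal_SUP_add_left[OF ne, symmetric]) (intro SUP_least, auto)
qed

lemma hausdorff_outer_closed_split:
  fixes A C :: "'a::metric_space set"
  assumes C: "closed C"
  shows "hausdorff_outer m (A \<inter> C) + hausdorff_outer m (A - C) = hausdorff_outer m A"
proof (cases "C = {} \<or> hausdorff_outer m A = top")
  case True
  have "hausdorff_outer m A \<le> hausdorff_outer m (A \<inter> C) + hausdorff_outer m (A - C)"
    using hausdorff_outer_Un_le[of m "A \<inter> C" "A - C"] by (simp add: Int_Diff_Un)
  with True show ?thesis by (auto simp: hausdorff_outer_empty top_unique)
next
  case False
  then have ne: "C \<noteq> {}" and fin: "hausdorff_outer m A < top" by (auto simp: less_top)
  define D where "D n = {x\<in>A. 1 / real (Suc n) \<le> infdist x C}" for n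
  define R where "R n = D (Suc n) - D n" for n
  let ?H = "hausdorff_outer m"
  have DA: "D n \<subseteq> A" for n by (auto simp: D_def)
  have Dmono: "D n \<subseteq> D k" if "n \<le> k" for n k
  proof
    fix x assume "x \<in> D n"
    moreover have "1 / real (Suc k) \<le> 1 / real (Suc n)" using that by (intro divide_left_mono) auto
    ultimately show "x \<in> D k" unfolding D_def by auto
  qed
  have sep1: "?H (A \<inter> C) + ?H (D n) \<le> ?H A" for n
  proof -
    have "?H (A \<inter> C) + ?H (D n) \<le> ?H ((A \<inter> C) \<union> D n)"
    proof (rule hausdorff_outer_separated)
      show "0 < 1 / real (Suc n)" by simp
      fix x y assume "x \<in> A \<inter> C" "y \<in> D n"
      then show "1 / real (Suc n) \<le> dist x y"
        using infdist_le[of x C y] by (auto simp: D_def dist_commute)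
    qed
    also have "\<dots> \<le> ?H A" using DA by (intro hausdorff_outer_mono) auto
    finally show ?thesis .
  qed
  have sep2: "?H (D n) + ?H (R (Suc n)) \<le> ?H (D (Suc (Suc n)))" for n
  proof -
    have "?H (D n) + ?H (R (Suc n)) \<le> ?H (D n \<union> R (Suc n))"
    proof (rule hausdorff_outer_separated)
      show "0 < 1 / real (Suc n) - 1 / real (Suc (Suc n))" by (simp add: frac_less2)
      fix x y assume "x \<in> D n" "y \<in> R (Suc n)"
      then have "1 / real (Suc n) \<le> infdist x C" "infdist y C \<le> 1 / real (Suc (Suc n))"
        by (auto simp: D_def R_def)
      moreover have "infdist x C \<le> infdist y C + dist x y" by (rule infdist_triangle)
      ultimately show "1 / real (Suc n) - 1 / real (Suc (Suc n)) \<le> dist x y" by linarith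
    qed
    also have "\<dots> \<le> ?H (D (Suc (Suc n)))"
      using Dmono[of n "Suc (Suc n)"] by (intro hausdorff_outer_mono) (auto simp: R_def)
    finally show ?thesis .
  qed
  have tele: "(\<Sum>k<N. ?H (R (Suc k))) \<le> ?H (D N) + ?H (D (Suc N))" for N
  proof (induction N)
    case (Suc N)
    have "(\<Sum>k<Suc N. ?H (R (Suc k))) \<le> (?H (D N) + ?H (D (Suc N))) + ?H (R (Suc N))"
      using Suc by (simp add: add_right_mono)
    also have "\<dots> = ?H (D (Suc N)) + (?H (D N) + ?H (R (Suc N)))" by (simp add: ac_simps)
    also have "\<dots> \<le> ?H (D (Suc N)) + ?H (D (Suc (Suc N)))" using sep2 by (intro add_left_mono)
    finally show ?case .
  qed simp
  have "(\<Sum>k. ?H (R (Suc k))) \<le> ?H A + ?H A"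
    by (intro suminf_le_const summableI order_trans[OF tele] add_mono hausdorff_outer_mono DA)
  also have "\<dots> < top" using fin by simp
  finally have sfin: "(\<Sum>k. ?H (R (Suc k))) \<noteq> top" by simp
  have Rfin: "?H (R k) < top" for k
    using hausdorff_outer_mono[of "R k" A m] fin DA by (auto simp: R_def intro: le_less_trans)
  define g where "g k = enn2real (?H (R (Suc k)))" for k
  have g: "?H (R (Suc k)) = ennreal (g k)" "0 \<le> g k" for k using Rfin by (auto simp: g_def)
  have sg: "summable g" using sfin g by (auto intro: summable_suminf_not_top)
  have tail: "?H (A - C) \<le> ?H (D (Suc n)) + ennreal (\<Sum>k. g (k + n))" for n
  proof -
    have "A - C \<subseteq> D (Suc n) \<union> (\<Union>k. R (Suc (k + n)))"
    proof
      fix x assume x: "x \<in> A - C"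
      then have "0 < infdist x C" using C ne by (simp add: infdist_pos_not_in_closed)
      then obtain N where "1 / real (Suc N) < infdist x C" using nat_approx_posE by metis
      then have xN: "x \<in> D N" using x by (auto simp: D_def)
      define K where "K = (LEAST K. x \<in> D K)"
      have K: "x \<in> D K" unfolding K_def using xN by (rule LeastI)
      show "x \<in> D (Suc n) \<union> (\<Union>k. R (Suc (k + n)))"
      proof (cases "K \<le> Suc n")
        case True then show ?thesis using K Dmono by blast
      next
        case False
        then obtain j where j: "K = Suc (Suc (j + n))"
          by (metis add.commute less_imp_Suc_add not_le add_Suc)
        have "x \<notin> D (Suc (j + n))" using not_less_Least[of "Suc (j + n)" "\<lambda>K. x \<in> D K"] j
          by (auto simp: K_def)
        then have "x \<in> R (Suc (j + n))" using K j by (auto simp: R_def)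
        then show ?thesis by blast
      qed
    qed
    then have "?H (A - C) \<le> ?H (D (Suc n)) + ?H (\<Union>k. R (Suc (k + n)))"
      using hausdorff_outer_mono hausdorff_outer_Un_le order_trans by blast
    also have "?H (\<Union>k. R (Suc (k + n))) \<le> (\<Sum>k. ?H (R (Suc (k + n))))"
      by (rule hausdorff_outer_UN_le)
    also have "\<dots> = ennreal (\<Sum>k. g (k + n))"
      unfolding g using sg g(2) by (intro suminf_ennreal2) (auto simp: summable_iff_shift)
    finally show ?thesis by (simp add: add_left_mono)
  qed
  have "?H (A \<inter> C) + ?H (A - C) \<le> ?H A"
  proof (rule ennreal_le_epsilon)
    fix e :: real assume "0 < e"
    then obtain n where "norm (\<Sum>k. g (k + n)) < e"
      using suminf_exist_split[OF _ sg] by blast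
    then have n: "(\<Sum>k. g (k + n)) \<le> e" by auto
    have "?H (A \<inter> C) + ?H (A - C) \<le> ?H (A \<inter> C) + (?H (D (Suc n)) + ennreal (\<Sum>k. g (k + n)))"
      using tail by (intro add_left_mono)
    also have "\<dots> = (?H (A \<inter> C) + ?H (D (Suc n))) + ennreal (\<Sum>k. g (k + n))"
      by (simp add: ac_simps)
    also have "\<dots> \<le> ?H A + ennreal e" using sep1 n by (intro add_mono ennreal_leI)
    finally show "?H (A \<inter> C) + ?H (A - C) \<le> ?H A + ennreal e" .
  qed
  moreover have "?H A \<le> ?H (A \<inter> C) + ?H (A - C)"
    using hausdorff_outer_Un_le[of m "A \<inter> C" "A - C"] by (simp add: Int_Diff_Un)
  ultimately show ?thesis by (rule antisym)
qed

lemma measure_space_hausdorff: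
  "measure_space UNIV (sets (borel :: 'a::metric_space measure)) (hausdorff_outer m)"
proof -
  let ?L = "lambda_system UNIV UNIV (hausdorff_outer m :: 'a set \<Rightarrow> ennreal)"
  interpret sigma_algebra "UNIV :: 'a set" UNIV
    using sigma_algebra_Pow[of "UNIV :: 'a set"] by simp
  have "outer_measure_space UNIV (hausdorff_outer m :: 'a set \<Rightarrow> ennreal)"
    unfolding outer_measure_space_def
    by (auto simp: positive_def increasing_def countably_subadditive_def hausdorff_outer_empty
        intro: hausdorff_outer_mono hausdorff_outer_UN_le)
  then have L: "measure_space UNIV ?L (hausdorff_outer m)" by (rule caratheodory_lemma)
  then interpret L: sigma_algebra UNIV ?L by (simp add: measure_space_def)
  have "C \<in> ?L" if "closed C" for C
    unfolding lambda_system_def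
    using hausdorff_outer_closed_split[OF that, of m]
    by (auto simp: Int_commute Diff_eq)
  then have "sigma_sets UNIV (Collect closed) \<subseteq> ?L" by (intro L.sigma_sets_subset) auto
  then have sub: "sets (borel :: 'a measure) \<subseteq> ?L" by (simp add: borel_eq_closed)
  have "sigma_algebra UNIV (sets (borel :: 'a measure))"
    using sets.sigma_algebra_axioms[of "borel :: 'a measure"] by simp
  moreover have "countably_additive ?L (hausdorff_outer m)" "positive ?L (hausdorff_outer m)"
    using L by (auto simp: measure_space_def)
  then have "countably_additive (sets (borel :: 'a measure)) (hausdorff_outer m)"
      "positive (sets (borel :: 'a measure)) (hausdorff_outer m)"
    using sub unfolding countably_additive_def positive_def by (blast intro: subset_trans)+
  ultimately show ?thesis unfolding measure_space_def by blast
qed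

lemma sets_surface_measure [measurable_cong, simp]: "sets (surface_measure \<Omega>) = sets borel"
  and space_surface_measure [simp]: "space (surface_measure \<Omega>) = UNIV"
  using sets.sigma_sets_eq[of borel]
  by (auto simp: surface_measure_def sets_measure_of_conv space_measure_of_conv)

lemma emeasure_surface_measure:
  fixes \<Omega> :: "'a::euclidean_space set"
  assumes "A \<in> sets borel"
  shows "emeasure (surface_measure \<Omega>) A = hausdorff_outer (DIM('a) - 1) (A \<inter> frontier \<Omega>)"
proof -
  let ?H = "hausdorff_outer (DIM('a) - 1) :: 'a set \<Rightarrow> ennreal"
  have F: "frontier \<Omega> \<in> sets borel" by (intro borel_closed frontier_closed)
  have ca: "countably_additive (sets borel) ?H"
    using measure_space_hausdorff by (auto simp: measure_space_def)
  have "countably_additive (sets borel) (\<lambda>A. ?H (A \<inter> frontier \<Omega>))"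
    unfolding countably_additive_def
  proof (intro allI impI)
    fix A :: "nat \<Rightarrow> 'a set"
    assume A: "range A \<subseteq> sets borel" "disjoint_family A" "(\<Union>i. A i) \<in> sets borel"
    have "(\<Sum>i. ?H (A i \<inter> frontier \<Omega>)) = ?H (\<Union>i. A i \<inter> frontier \<Omega>)"
      using A F
      by (intro ca[unfolded countably_additive_def, rule_format])
        (auto simp: disjoint_family_on_def intro!: sets.Int sets.countable_UN')
    then show "(\<Sum>i. ?H (A i \<inter> frontier \<Omega>)) = ?H ((\<Union>i. A i) \<inter> frontier \<Omega>)" by simp
  qed
  then have "emeasure (surface_measure \<Omega>) A = (\<lambda>A. ?H (A \<inter> frontier \<Omega>)) A"
    using assms
    by (intro emeasure_measure_of[OF surface_measure_def])
      (auto simp: positive_def hausdorff_outer_empty)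
  then show ?thesis by simp
qed


section \<open>Function spaces\<close>

text \<open>Elements of function spaces are represented by functions; equality of elements is equality
  almost everywhere.\<close>

definition L2 :: "'a measure \<Rightarrow> ('a \<Rightarrow> complex) set" where
  "L2 M = {f \<in> borel_measurable M. integrable M (\<lambda>x. (cmod (f x))\<^sup>2)}"

definition L2_inner :: "'a measure \<Rightarrow> ('a \<Rightarrow> complex) \<Rightarrow> ('a \<Rightarrow> complex) \<Rightarrow> complex" where
  "L2_inner M f g = (\<integral>x. f x * cnj (g x) \<partial>M)"

definition L2_norm :: "'a measure \<Rightarrow> ('a \<Rightarrow> complex) \<Rightarrow> real" where
  "L2_norm M f = sqrt (\<integral>x. (cmod (f x))\<^sup>2 \<partial>M)"

text \<open>The boundary is locally the graph, over a hyperplane orthogonal to a unit vector \<open>e\<close>, of a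
  Lipschitz function \<open>\<phi>\<close>, with \<open>\<Omega>\<close> on one side. In dimension 1 this is an open interval.\<close>

definition bounded_lipschitz_domain :: "'a::euclidean_space set \<Rightarrow> bool" where
  "bounded_lipschitz_domain \<Omega> \<longleftrightarrow>
     \<Omega> \<noteq> {} \<and> open \<Omega> \<and> connected \<Omega> \<and> bounded \<Omega> \<and>
     (\<forall>x\<in>frontier \<Omega>. \<exists>r>0. \<exists>e \<phi> L. norm e = 1 \<and> L-lipschitz_on {y. y \<bullet> e = 0} \<phi> \<and>
        \<Omega> \<inter> ball x r = {y \<in> ball x r. \<phi> (y - (y \<bullet> e) *\<^sub>R e) < y \<bullet> e})"

coinductive smooth :: "('a::real_normed_vector \<Rightarrow> real) \<Rightarrow> bool" where
  "(\<forall>x. (f has_derivative f' x) (at x)) \<Longrightarrow> (\<forall>h. smooth (\<lambda>x. f' x h)) \<Longrightarrow> smooth f"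

definition test_function :: "'a::euclidean_space set \<Rightarrow> ('a \<Rightarrow> real) \<Rightarrow> bool" where
  "test_function \<Omega> \<phi> \<longleftrightarrow>
     smooth \<phi> \<and> compact (closure {x. \<phi> x \<noteq> 0}) \<and> closure {x. \<phi> x \<noteq> 0} \<subseteq> \<Omega>"

definition weak_partial ::
    "'a::euclidean_space set \<Rightarrow> 'a \<Rightarrow> ('a \<Rightarrow> complex) \<Rightarrow> ('a \<Rightarrow> complex) \<Rightarrow> bool" where
  "weak_partial \<Omega> b u g \<longleftrightarrow>
     (\<forall>\<phi>. test_function \<Omega> \<phi> \<longrightarrow>
        (\<integral>x. frechet_derivative \<phi> (at x) b *\<^sub>R u x \<partial>lebesgue_on \<Omega>) =
        - (\<integral>x. \<phi> x *\<^sub>R g x \<partial>lebesgue_on \<Omega>))"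

definition H1 :: "'a::euclidean_space set \<Rightarrow> ('a \<Rightarrow> complex) set" where
  "H1 \<Omega> = {u \<in> L2 (lebesgue_on \<Omega>). \<forall>b\<in>Basis. \<exists>g\<in>L2 (lebesgue_on \<Omega>). weak_partial \<Omega> b u g}"

definition wpartial :: "'a::euclidean_space set \<Rightarrow> 'a \<Rightarrow> ('a \<Rightarrow> complex) \<Rightarrow> 'a \<Rightarrow> complex" where
  "wpartial \<Omega> b u = (SOME g. g \<in> L2 (lebesgue_on \<Omega>) \<and> weak_partial \<Omega> b u g)"

definition grad_inner ::
    "'a::euclidean_space set \<Rightarrow> ('a \<Rightarrow> complex) \<Rightarrow> ('a \<Rightarrow> complex) \<Rightarrow> complex" where
  "grad_inner \<Omega> u v = (\<Sum>b\<in>Basis. L2_inner (lebesgue_on \<Omega>) (wpartial \<Omega> b u) (wpartial \<Omega> b v))"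

definition H1_norm :: "'a::euclidean_space set \<Rightarrow> ('a \<Rightarrow> complex) \<Rightarrow> real" where
  "H1_norm \<Omega> u = sqrt ((L2_norm (lebesgue_on \<Omega>) u)\<^sup>2
     + (\<Sum>b\<in>Basis. (L2_norm (lebesgue_on \<Omega>) (wpartial \<Omega> b u))\<^sup>2))"

text \<open>The trace operator is the unique bounded linear map from \<open>H1\<close> to \<open>L2\<close> of the boundary that
  restricts functions continuous up to the boundary.\<close>

definition trace_operator ::
    "'a::euclidean_space set \<Rightarrow> (('a \<Rightarrow> complex) \<Rightarrow> 'a \<Rightarrow> complex) \<Rightarrow> bool" where
  "trace_operator \<Omega> \<Gamma> \<longleftrightarrow>
     (\<forall>u\<in>H1 \<Omega>. \<Gamma> u \<in> L2 (surface_measure \<Omega>)) \<and>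
     (\<forall>u\<in>H1 \<Omega>. \<forall>v\<in>H1 \<Omega>.
        AE x in surface_measure \<Omega>. \<Gamma> (\<lambda>y. u y + v y) x = \<Gamma> u x + \<Gamma> v x) \<and>
     (\<forall>u\<in>H1 \<Omega>. \<forall>c. AE x in surface_measure \<Omega>. \<Gamma> (\<lambda>y. c * u y) x = c * \<Gamma> u x) \<and>
     (\<exists>C. \<forall>u\<in>H1 \<Omega>. L2_norm (surface_measure \<Omega>) (\<Gamma> u) \<le> C * H1_norm \<Omega> u) \<and>
     (\<forall>u\<in>H1 \<Omega>. continuous_on (closure \<Omega>) u \<longrightarrow> (AE x in surface_measure \<Omega>. \<Gamma> u x = u x))"


section \<open>The kernel\<close>

definition radon_measure_halfline :: "real measure \<Rightarrow> bool" where
  "radon_measure_halfline \<nu> \<longleftrightarrow>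
     sets \<nu> = sets borel \<and> emeasure \<nu> {..<0} = 0 \<and> (\<forall>K. compact K \<longrightarrow> emeasure \<nu> K < \<infinity>)"

definition integrable_cm_kernel :: "(real \<Rightarrow> real) \<Rightarrow> real measure \<Rightarrow> bool" where
  "integrable_cm_kernel k \<nu> \<longleftrightarrow>
     radon_measure_halfline \<nu> \<and>
     (\<forall>t>0. has_bochner_integral \<nu> (\<lambda>\<tau>. exp (- \<tau> * t)) (k t)) \<and>
     set_integrable lborel {0<..} k \<and> (\<exists>t>0. k t \<noteq> 0)"

text \<open>The Laplace transform of the kernel represented by \<open>\<nu>\<close>, continued analytically.\<close>

definition khat :: "real measure \<Rightarrow> complex \<Rightarrow> complex" where
  "khat \<nu> z = (\<integral>\<tau>. 1 / (z + complex_of_real \<tau>) \<partial>\<nu>)"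


section \<open>The form and its solution operator\<close>

definition wave_form ::
    "'a::euclidean_space set \<Rightarrow> (('a \<Rightarrow> complex) \<Rightarrow> 'a \<Rightarrow> complex) \<Rightarrow> real measure \<Rightarrow> complex \<Rightarrow>
     ('a \<Rightarrow> complex) \<Rightarrow> ('a \<Rightarrow> complex) \<Rightarrow> complex" where
  "wave_form \<Omega> \<Gamma> \<nu> z p u =
     z\<^sup>2 * L2_inner (lebesgue_on \<Omega>) p u + grad_inner \<Omega> p u
     + z * khat \<nu> z * L2_inner (surface_measure \<Omega>) (\<Gamma> p) (\<Gamma> u)"

definition H1_antidual :: "'a::euclidean_space set \<Rightarrow> (('a \<Rightarrow> complex) \<Rightarrow> complex) set" where
  "H1_antidual \<Omega> = {F.
     (\<forall>u\<in>H1 \<Omega>. \<forall>v\<in>H1 \<Omega>. F (\<lambda>x. u x + v x) = F u + F v) \<and>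
     (\<forall>u\<in>H1 \<Omega>. \<forall>c. F (\<lambda>x. c * u x) = cnj c * F u) \<and>
     (\<exists>C. \<forall>u\<in>H1 \<Omega>. cmod (F u) \<le> C * H1_norm \<Omega> u)}"

definition L2_functional ::
    "'a::euclidean_space set \<Rightarrow> ('a \<Rightarrow> complex) \<Rightarrow> ('a \<Rightarrow> complex) \<Rightarrow> complex" where
  "L2_functional \<Omega> f = (\<lambda>\<eta>. L2_inner (lebesgue_on \<Omega>) f \<eta>)"

definition form_solution ::
    "'a::euclidean_space set \<Rightarrow> (('a \<Rightarrow> complex) \<Rightarrow> 'a \<Rightarrow> complex) \<Rightarrow> real measure \<Rightarrow> complex \<Rightarrow>
     (('a \<Rightarrow> complex) \<Rightarrow> complex) \<Rightarrow> ('a \<Rightarrow> complex) \<Rightarrow> bool" where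
  "form_solution \<Omega> \<Gamma> \<nu> z F u \<longleftrightarrow> u \<in> H1 \<Omega> \<and> (\<forall>\<eta>\<in>H1 \<Omega>. wave_form \<Omega> \<Gamma> \<nu> z u \<eta> = F \<eta>)"

definition resolvent_exists ::
    "'a::euclidean_space set \<Rightarrow> (('a \<Rightarrow> complex) \<Rightarrow> 'a \<Rightarrow> complex) \<Rightarrow> real measure \<Rightarrow> complex \<Rightarrow> bool"
  where
  "resolvent_exists \<Omega> \<Gamma> \<nu> z \<longleftrightarrow>
     (\<forall>F\<in>H1_antidual \<Omega>. \<exists>u. form_solution \<Omega> \<Gamma> \<nu> z F u \<and>
        (\<forall>v. form_solution \<Omega> \<Gamma> \<nu> z F v \<longrightarrow> (AE x in lebesgue_on \<Omega>. v x = u x)))"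

text \<open>Meaningful only when \<open>resolvent_exists \<Omega> \<Gamma> \<nu> z\<close>.\<close>

definition resolvent ::
    "'a::euclidean_space set \<Rightarrow> (('a \<Rightarrow> complex) \<Rightarrow> 'a \<Rightarrow> complex) \<Rightarrow> real measure \<Rightarrow> complex \<Rightarrow>
     (('a \<Rightarrow> complex) \<Rightarrow> complex) \<Rightarrow> 'a \<Rightarrow> complex" where
  "resolvent \<Omega> \<Gamma> \<nu> z F = (SOME u. form_solution \<Omega> \<Gamma> \<nu> z F u)"

definition L2_opnorm :: "'a measure \<Rightarrow> (('a \<Rightarrow> complex) \<Rightarrow> 'a \<Rightarrow> complex) \<Rightarrow> ennreal" where
  "L2_opnorm M T = (SUP f\<in>{f \<in> L2 M. L2_norm M f \<le> 1}. ennreal (L2_norm M (T f)))"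


section \<open>Neumann eigenfunctions and spectral clusters\<close>

definition L2_orthonormal_basis :: "'a measure \<Rightarrow> (nat \<Rightarrow> 'a \<Rightarrow> complex) \<Rightarrow> bool" where
  "L2_orthonormal_basis M w \<longleftrightarrow>
     (\<forall>j. w j \<in> L2 M) \<and>
     (\<forall>i j. L2_inner M (w i) (w j) = (if i = j then 1 else 0)) \<and>
     (\<forall>f\<in>L2 M. (\<lambda>n. L2_norm M (\<lambda>x. f x - (\<Sum>j<n. L2_inner M f (w j) * w j x)))
        \<longlonglongrightarrow> 0)"

text \<open>The boundary value problem \<open>- \<Delta> w = \<mu> w\<close> in \<open>\<Omega>\<close> with vanishing normal derivative is
  understood in the weak sense, as the Neumann Laplacian on a Lipschitz domain is defined by
  its form.\<close>

definition neumann_eigenbasis ::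
    "'a::euclidean_space set \<Rightarrow> (nat \<Rightarrow> 'a \<Rightarrow> complex) \<Rightarrow> (nat \<Rightarrow> real) \<Rightarrow> bool" where
  "neumann_eigenbasis \<Omega> w freq \<longleftrightarrow>
     L2_orthonormal_basis (lebesgue_on \<Omega>) w \<and>
     (\<forall>j. 0 \<le> freq j) \<and> mono freq \<and>
     (\<forall>j. w j \<in> H1 \<Omega> \<and>
        (\<forall>\<eta>\<in>H1 \<Omega>. grad_inner \<Omega> (w j) \<eta> =
           complex_of_real ((freq j)\<^sup>2) * L2_inner (lebesgue_on \<Omega>) (w j) \<eta>))"

definition spectral_cluster ::
    "'a::euclidean_space set \<Rightarrow> (nat \<Rightarrow> 'a \<Rightarrow> complex) \<Rightarrow> (nat \<Rightarrow> real) \<Rightarrow> real \<Rightarrow>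
     ('a \<Rightarrow> complex) \<Rightarrow> bool" where
  "spectral_cluster \<Omega> w freq \<delta> p \<longleftrightarrow>
     p \<in> L2 (lebesgue_on \<Omega>) \<and> \<not> (AE x in lebesgue_on \<Omega>. p x = 0) \<and>
     (\<forall>i j. L2_inner (lebesgue_on \<Omega>) p (w i) \<noteq> 0 \<longrightarrow> L2_inner (lebesgue_on \<Omega>) p (w j) \<noteq> 0 \<longrightarrow>
        \<bar>freq j - freq i\<bar> \<le> \<delta>)"

definition mean_frequency ::
    "'a::euclidean_space set \<Rightarrow> (nat \<Rightarrow> 'a \<Rightarrow> complex) \<Rightarrow> (nat \<Rightarrow> real) \<Rightarrow> ('a \<Rightarrow> complex) \<Rightarrow> real"
  where
  "mean_frequency \<Omega> w freq p =
     sqrt ((\<Sum>j. (cmod (L2_inner (lebesgue_on \<Omega>) p (w j)))\<^sup>2 * (freq j)\<^sup>2)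
       / (L2_norm (lebesgue_on \<Omega>) p)\<^sup>2)"

end

theory Submission
  imports Defs "HOL-Computational_Algebra.Polynomial"
begin

text \<open>
  Write \<open>\<kappa> = khat \<nu> (\<i>s)\<close>, \<open>a = Re \<kappa> > 0\<close> and \<open>\<parallel>\<Gamma>u\<parallel>\<close> for the norm of the trace on the boundary. At
  \<open>z = \<i>s\<close> the form is \<open>a\<^sub>z(u,v) = (\<nabla>u,\<nabla>v) - s\<^sup>2 (u,v) + \<i>s\<kappa> (\<Gamma>u,\<Gamma>v)\<close>. On the diagonal its imaginary
  part is \<open>s a \<parallel>\<Gamma>u\<parallel>\<^sup>2\<close>, so the damping sees traces only, and its real part is indefinite. The proof tests
  with \<open>Tu\<close> instead of \<open>u\<close>, where \<open>T\<close> acts diagonally on the Neumann modes: the multiplier is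
  \<open>sgn (\<lambda>\<^sub>j\<^sup>2 - s\<^sup>2) + \<i>N\<close> on the far modes, \<open>\<bar>\<lambda>\<^sub>j - s\<bar> > \<delta>/2\<close>, and \<open>\<i>N\<close> on the near ones. With the far energy
  \<open>E = \<Sum> \<bar>\<lambda>\<^sub>j\<^sup>2 - s\<^sup>2\<bar> \<bar>u\<^sub>j\<bar>\<^sup>2\<close> (sum over the far modes) and \<open>u'\<close> the far part of \<open>u\<close> with the signs inserted,
  \<open>Re a\<^sub>z(u,Tu) = E + Re (\<i>s\<kappa> (\<Gamma>u,\<Gamma>u')) + N s a \<parallel>\<Gamma>u\<parallel>\<^sup>2\<close>.

  Put \<open>l = s\<^bsup>\<alpha>-1\<^esup> (1 + log s) = L(s)/s\<close>. The hypothesis on clusters of one fixed width \<open>\<delta>\<close> enters twice.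
  First, \<open>\<parallel>\<Gamma>u'\<parallel>\<^sup>2 \<le> K l E\<close>: cut the far modes into clusters, use the upper bound on each, and add up by the
  Cauchy--Schwarz inequality with the gaps \<open>\<bar>\<lambda>\<^sub>j\<^sup>2 - s\<^sup>2\<bar>\<close> as weights; the arising sum over clusters is
  \<open>O(l)\<close> (\<open>bin_sum\<close>, \<open>far_seminorm_bound\<close>). Second, \<open>\<parallel>u\<parallel>\<^sup>2 \<le> K (\<parallel>\<Gamma>u\<parallel>\<^sup>2 + l E)\<close>: the near modes form a single
  cluster, to which the lower bound applies (\<open>mass_bound\<close>).

  By the first estimate, \<open>N = 1 + K s l \<bar>\<kappa>\<bar>\<^sup>2 / a\<close> is large enough to absorb the cross term. If
  \<open>s l \<bar>\<kappa>\<bar> = L(s) \<bar>\<kappa>\<bar>\<close> is bounded, then \<open>N a s l\<close> is bounded too, and the second estimate gives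
  \<open>N s a \<parallel>u\<parallel>\<^sup>2 \<le> K' Re a\<^sub>z(u,Tu)\<close> with \<open>K'\<close> uniform in \<open>s \<ge> 1\<close> (\<open>form_test_L2\<close>). Boundedness of \<open>L(s) \<bar>\<kappa>\<bar>\<close> for
  large \<open>s\<close> follows from the assumed decay, because \<open>\<bar>\<kappa>\<bar> \<le> \<bar>\<kappa>\<bar>\<^sup>3 / a\<^sup>2\<close>; for the remaining \<open>s\<close> it follows from
  \<open>\<bar>\<kappa>\<bar> \<le> \<integral>\<tau>\<^sup>-\<^sup>1 d\<nu>\<close>. If \<open>a\<^sub>z(u,\<eta>) = (f,\<eta>)\<close> for all \<open>\<eta>\<close>, then \<open>\<bar>T\<bar> \<le> 1 + N \<le> 2N\<close> yields
  \<open>N s a \<parallel>u\<parallel>\<^sup>2 \<le> 2 N K' \<parallel>f\<parallel> \<parallel>u\<parallel>\<close>, which is the asserted bound (\<open>resolvent_bound\<close>).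

  The same coercivity, now in the \<open>H1\<close> norm and for fixed \<open>s\<close>, gives existence of \<open>R(\<i>s)\<close>: in suitably
  weighted mode coordinates the equation \<open>a\<^sub>z(u,Tw\<^sub>j) = F(Tw\<^sub>j)\<close> for all \<open>j\<close> is an equation for a strongly
  monotone Lipschitz operator on square-summable sequences (\<open>form_solvable\<close>). All estimates are proved for
  finite sums of modes; these are dense in \<open>H1\<close>, which rests on completeness of \<open>H1\<close>, hence on completeness
  of \<open>L2\<close> and on uniqueness of weak derivatives.
\<close>

section \<open>Square-integrable functions\<close>

lemma L2_I: "f \<in> borel_measurable M \<Longrightarrow> integrable M (\<lambda>x. (cmod (f x))\<^sup>2) \<Longrightarrow> f \<in> L2 M"
  by (simp add: L2_def)

lemma L2_measurable [measurable_dest]: "f \<in> L2 M \<Longrightarrow> f \<in> borel_measurable M"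
  by (simp add: L2_def)

lemma L2_integrable_sq: "f \<in> L2 M \<Longrightarrow> integrable M (\<lambda>x. (cmod (f x))\<^sup>2)"
  by (simp add: L2_def)

lemma L2_zero [simp]: "(\<lambda>_. 0) \<in> L2 M"
  by (simp add: L2_def)

lemma L2_add:
  assumes "f \<in> L2 M" "g \<in> L2 M" shows "(\<lambda>x. f x + g x) \<in> L2 M"
proof (rule L2_I)
  have [measurable]: "f \<in> borel_measurable M" "g \<in> borel_measurable M"
    using assms by (auto dest: L2_measurable)
  show "(\<lambda>x. f x + g x) \<in> borel_measurable M" by measurable
  have le: "(cmod (f x + g x))\<^sup>2 \<le> 2 * (cmod (f x))\<^sup>2 + 2 * (cmod (g x))\<^sup>2" for x
  proof -
    have "(cmod (f x + g x))\<^sup>2 \<le> (cmod (f x) + cmod (g x))\<^sup>2"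
      by (intro power_mono norm_triangle_ineq) auto
    also have "\<dots> \<le> 2 * (cmod (f x))\<^sup>2 + 2 * (cmod (g x))\<^sup>2"
      using sum_squares_bound[of "cmod (f x)" "cmod (g x)"] by (simp add: power2_sum)
    finally show ?thesis .
  qed
  show "integrable M (\<lambda>x. (cmod (f x + g x))\<^sup>2)"
    by (rule Bochner_Integration.integrable_bound[where f = "\<lambda>x. 2 * (cmod (f x))\<^sup>2 + 2 * (cmod (g x))\<^sup>2"])
      (use assms le in \<open>auto intro!: L2_integrable_sq\<close>)
qed

lemma L2_scale:
  assumes "f \<in> L2 M" shows "(\<lambda>x. c * f x) \<in> L2 M"
  using assms by (auto simp: L2_def norm_mult power_mult_distrib)

lemma L2_diff:
  assumes "f \<in> L2 M" "g \<in> L2 M" shows "(\<lambda>x. f x - g x) \<in> L2 M"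
  using L2_add[OF assms(1) L2_scale[OF assms(2), of "-1"]] by simp

lemma L2_sum:
  assumes "\<And>i. i \<in> I \<Longrightarrow> f i \<in> L2 M" shows "(\<lambda>x. \<Sum>i\<in>I. f i x) \<in> L2 M"
  using assms by (induction I rule: infinite_finite_induct) (auto intro: L2_add)

lemma L2_integrable_mult:
  assumes "f \<in> L2 M" "g \<in> L2 M" shows "integrable M (\<lambda>x. f x * g x)"
proof -
  have [measurable]: "f \<in> borel_measurable M" "g \<in> borel_measurable M"
    using assms by (auto dest: L2_measurable)
  have "norm (f x * g x) \<le> norm ((cmod (f x))\<^sup>2 + (cmod (g x))\<^sup>2)" for x
  proof -
    have "2 * cmod (f x) * cmod (g x) \<le> (cmod (f x))\<^sup>2 + (cmod (g x))\<^sup>2" by (rule sum_squares_bound)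
    moreover have "0 \<le> cmod (f x) * cmod (g x)" by simp
    ultimately show ?thesis unfolding norm_mult by (simp del: mult_nonneg_nonneg)
  qed
  then show ?thesis
    by (intro Bochner_Integration.integrable_bound[where g = "\<lambda>x. f x * g x" and f = "\<lambda>x. (cmod (f x))\<^sup>2 + (cmod (g x))\<^sup>2"])
      (use assms in \<open>auto intro!: L2_integrable_sq\<close>)
qed

lemma borel_measurable_cnj [measurable]: "cnj \<in> borel_measurable borel"
  by (intro borel_measurable_continuous_onI continuous_intros)

lemma L2_cnj: "f \<in> L2 M \<Longrightarrow> (\<lambda>x. cnj (f x)) \<in> L2 M"
  by (auto simp: L2_def)

lemma L2_inner_integrable: "f \<in> L2 M \<Longrightarrow> g \<in> L2 M \<Longrightarrow> integrable M (\<lambda>x. f x * cnj (g x))"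
  by (intro L2_integrable_mult L2_cnj)

lemma L2_inner_add_left:
  "f \<in> L2 M \<Longrightarrow> g \<in> L2 M \<Longrightarrow> h \<in> L2 M \<Longrightarrow>
   L2_inner M (\<lambda>x. f x + g x) h = L2_inner M f h + L2_inner M g h"
  unfolding L2_inner_def by (simp add: distrib_right L2_inner_integrable)

lemma L2_inner_scale_left: "L2_inner M (\<lambda>x. c * f x) h = c * L2_inner M f h"
  unfolding L2_inner_def by (simp add: mult.assoc)

lemma L2_inner_commute: "L2_inner M g f = cnj (L2_inner M f g)"
proof -
  have "L2_inner M g f = (\<integral>x. cnj (f x * cnj (g x)) \<partial>M)"
    unfolding L2_inner_def by (intro Bochner_Integration.integral_cong) (auto simp: mult.commute)
  also have "\<dots> = cnj (L2_inner M f g)" unfolding L2_inner_def by (rule Bochner_Integration.integral_cnj)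
  finally show ?thesis .
qed

lemma L2_inner_add_right:
  "f \<in> L2 M \<Longrightarrow> g \<in> L2 M \<Longrightarrow> h \<in> L2 M \<Longrightarrow>
   L2_inner M h (\<lambda>x. f x + g x) = L2_inner M h f + L2_inner M h g"
  by (subst (1 2 3) L2_inner_commute) (simp add: L2_inner_add_left)

lemma L2_inner_scale_right: "L2_inner M h (\<lambda>x. c * f x) = cnj c * L2_inner M h f"
  by (subst (1 2) L2_inner_commute) (simp add: L2_inner_scale_left)

lemma L2_inner_diff_left:
  "f \<in> L2 M \<Longrightarrow> g \<in> L2 M \<Longrightarrow> h \<in> L2 M \<Longrightarrow>
   L2_inner M (\<lambda>x. f x - g x) h = L2_inner M f h - L2_inner M g h"
  using L2_inner_add_left[of f M "\<lambda>x. (-1) * g x" h] L2_inner_scale_left[of M "-1" g h]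
  by (simp add: L2_scale[of g M "-1", simplified])

lemma L2_inner_sum_left:
  assumes "\<And>i. i \<in> I \<Longrightarrow> f i \<in> L2 M" "h \<in> L2 M"
  shows "L2_inner M (\<lambda>x. \<Sum>i\<in>I. f i x) h = (\<Sum>i\<in>I. L2_inner M (f i) h)"
  using assms
  by (induction I rule: infinite_finite_induct) (simp_all add: L2_inner_add_left L2_sum L2_inner_def[of _ "\<lambda>_. 0"])

lemma L2_inner_cong_AE:
  assumes "f \<in> borel_measurable M" "f' \<in> borel_measurable M" "g \<in> borel_measurable M" "g' \<in> borel_measurable M"
    and "AE x in M. f x = f' x" "AE x in M. g x = g' x"
  shows "L2_inner M f g = L2_inner M f' g'"
  unfolding L2_inner_def
proof (rule integral_cong_AE)
  show "AE x in M. f x * cnj (g x) = f' x * cnj (g' x)"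
    using assms(5,6) by eventually_elim simp
  note assms(1-4)[measurable]
  show "(\<lambda>x. f x * cnj (g x)) \<in> borel_measurable M" "(\<lambda>x. f' x * cnj (g' x)) \<in> borel_measurable M"
    by measurable
qed

lemma L2_norm_nonneg [simp]: "0 \<le> L2_norm M f"
  unfolding L2_norm_def by simp

lemma L2_norm_sq: "(L2_norm M f)\<^sup>2 = (\<integral>x. (cmod (f x))\<^sup>2 \<partial>M)"
  unfolding L2_norm_def by simp

lemma L2_inner_self: "L2_inner M f f = complex_of_real ((L2_norm M f)\<^sup>2)"
  unfolding L2_inner_def L2_norm_sq by (subst integral_complex_of_real[symmetric]) (simp only: complex_norm_square)

lemma L2_norm_scale: "L2_norm M (\<lambda>x. c * f x) = cmod c * L2_norm M f"
  unfolding L2_norm_def by (simp add: norm_mult power_mult_distrib real_sqrt_mult)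

lemma L2_norm_minus: "L2_norm M (\<lambda>x. g x - f x) = L2_norm M (\<lambda>x. f x - g x)"
  unfolding L2_norm_def by (simp add: norm_minus_commute)

lemma L2_norm_cong_AE:
  assumes "f \<in> borel_measurable M" "g \<in> borel_measurable M" "AE x in M. f x = g x"
  shows "L2_norm M f = L2_norm M g"
proof -
  have "(\<integral>x. (cmod (f x))\<^sup>2 \<partial>M) = (\<integral>x. (cmod (g x))\<^sup>2 \<partial>M)"
  proof (rule integral_cong_AE)
    show "AE x in M. (cmod (f x))\<^sup>2 = (cmod (g x))\<^sup>2" using assms(3) by eventually_elim simp
  qed (use assms in auto)
  then show ?thesis by (simp add: L2_norm_def)
qed

lemma L2_norm_eq_0_iff:
  assumes "f \<in> L2 M" shows "L2_norm M f = 0 \<longleftrightarrow> (AE x in M. f x = 0)"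
  using integral_nonneg_eq_0_iff_AE[OF L2_integrable_sq[OF assms]] by (simp add: L2_norm_def)

lemma L2_norm_add_sq:
  assumes "f \<in> L2 M" "g \<in> L2 M"
  shows "(L2_norm M (\<lambda>x. f x + g x))\<^sup>2 = (L2_norm M f)\<^sup>2 + 2 * Re (L2_inner M f g) + (L2_norm M g)\<^sup>2"
proof -
  have "complex_of_real ((L2_norm M (\<lambda>x. f x + g x))\<^sup>2)
      = L2_inner M f f + (L2_inner M f g + L2_inner M g f) + L2_inner M g g"
    unfolding L2_inner_self[symmetric] using assms
    by (simp add: L2_inner_add_left L2_inner_add_right L2_add)
  also have "L2_inner M f g + L2_inner M g f = complex_of_real (2 * Re (L2_inner M f g))"
    by (subst (2) L2_inner_commute) (simp add: complex_add_cnj)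
  finally have "complex_of_real ((L2_norm M (\<lambda>x. f x + g x))\<^sup>2)
     = complex_of_real ((L2_norm M f)\<^sup>2 + 2 * Re (L2_inner M f g) + (L2_norm M g)\<^sup>2)"
    by (simp add: L2_inner_self)
  then show ?thesis by (simp only: of_real_eq_iff)
qed

text \<open>The polynomial \<open>t \<mapsto> \<parallel>f - t (f,g) g\<parallel>\<^sup>2\<close> is nonnegative; where the norm of \<open>g\<close> vanishes, its linear term has to
  vanish as well.\<close>

lemma L2_Cauchy_Schwarz:
  assumes "f \<in> L2 M" "g \<in> L2 M"
  shows "cmod (L2_inner M f g) \<le> L2_norm M f * L2_norm M g"
proof -
  define z where "z = L2_inner M f g"
  have *: "2 * t * (cmod z)\<^sup>2 \<le> (L2_norm M f)\<^sup>2 + t\<^sup>2 * (cmod z)\<^sup>2 * (L2_norm M g)\<^sup>2" for t :: real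
  proof -
    have "0 \<le> (L2_norm M (\<lambda>x. f x + (- complex_of_real t * z) * g x))\<^sup>2" by simp
    also have "\<dots> = (L2_norm M f)\<^sup>2 + 2 * Re (cnj (- complex_of_real t * z) * z) + (t * cmod z * L2_norm M g)\<^sup>2"
      unfolding L2_norm_add_sq[OF assms(1) L2_scale[OF assms(2)]] L2_norm_scale L2_inner_scale_right z_def
      by (simp add: norm_mult power_mult_distrib)
    also have "Re (cnj (- complex_of_real t * z) * z) = - t * (cmod z)\<^sup>2"
      by (simp only: cmod_power2) (simp add: algebra_simps power2_eq_square)
    finally show ?thesis by (simp add: power_mult_distrib)
  qed
  have "(cmod z)\<^sup>2 \<le> (L2_norm M f * L2_norm M g)\<^sup>2"
  proof (cases "L2_norm M g = 0 \<or> z = 0")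
    case True
    have "z = 0"
    proof (rule ccontr)
      assume "z \<noteq> 0"
      define t where "t = ((L2_norm M f)\<^sup>2 + 1) / (cmod z)\<^sup>2"
      have t: "t * (cmod z)\<^sup>2 = (L2_norm M f)\<^sup>2 + 1" using \<open>z \<noteq> 0\<close> by (simp add: t_def)
      have "L2_norm M g = 0" using True \<open>z \<noteq> 0\<close> by simp
      then have "2 * (t * (cmod z)\<^sup>2) \<le> (L2_norm M f)\<^sup>2"
        using *[of t] by (simp add: mult.assoc)
      then have "(L2_norm M f)\<^sup>2 + 2 \<le> 0" unfolding t by simp
      then show False using zero_le_power2[of "L2_norm M f"] by linarith
    qed
    then show ?thesis by simp
  next
    case False
    define G where "G = (L2_norm M g)\<^sup>2"
    have G: "G > 0" using False by (simp add: G_def)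
    have "2 * (1/G) * (cmod z)\<^sup>2 \<le> (L2_norm M f)\<^sup>2 + (1/G)\<^sup>2 * (cmod z)\<^sup>2 * G"
      unfolding G_def by (rule *)
    then have "(cmod z)\<^sup>2 \<le> (L2_norm M f)\<^sup>2 * G"
      using G by (simp add: field_simps power2_eq_square)
    then show ?thesis by (simp add: G_def power_mult_distrib)
  qed
  then show ?thesis unfolding z_def by (rule power2_le_imp_le) simp
qed

lemma L2_norm_triangle:
  assumes "f \<in> L2 M" "g \<in> L2 M"
  shows "L2_norm M (\<lambda>x. f x + g x) \<le> L2_norm M f + L2_norm M g"
proof (rule power2_le_imp_le)
  have "Re (L2_inner M f g) \<le> L2_norm M f * L2_norm M g"
    using L2_Cauchy_Schwarz[OF assms] complex_Re_le_cmod order_trans by blast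
  then show "(L2_norm M (\<lambda>x. f x + g x))\<^sup>2 \<le> (L2_norm M f + L2_norm M g)\<^sup>2"
    by (simp add: L2_norm_add_sq[OF assms] power2_sum)
qed simp

lemma L2_norm_triangle_diff:
  assumes "f \<in> L2 M" "g \<in> L2 M" "h \<in> L2 M"
  shows "L2_norm M (\<lambda>x. f x - h x) \<le> L2_norm M (\<lambda>x. f x - g x) + L2_norm M (\<lambda>x. g x - h x)"
  using L2_norm_triangle[of "\<lambda>x. f x - g x" M "\<lambda>x. g x - h x"] assms by (simp add: L2_diff)

lemma L2_norm_diff_le:
  assumes "f \<in> L2 M" "g \<in> L2 M"
  shows "\<bar>L2_norm M f - L2_norm M g\<bar> \<le> L2_norm M (\<lambda>x. f x - g x)"
  using L2_norm_triangle[of "\<lambda>x. f x - g x" M g] L2_norm_triangle[of "\<lambda>x. g x - f x" M f] assms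
  by (simp add: L2_diff L2_norm_minus[of M f g])

lemma L2_norm_sum_le:
  assumes "\<And>i. i \<in> I \<Longrightarrow> f i \<in> L2 M"
  shows "L2_norm M (\<lambda>x. \<Sum>i\<in>I. f i x) \<le> (\<Sum>i\<in>I. L2_norm M (f i))"
  using assms
proof (induction I rule: infinite_finite_induct)
  case (insert i I)
  have "L2_norm M (\<lambda>x. f i x + (\<Sum>i\<in>I. f i x)) \<le> L2_norm M (f i) + L2_norm M (\<lambda>x. \<Sum>i\<in>I. f i x)"
    using insert.prems by (intro L2_norm_triangle L2_sum) auto
  also have "\<dots> \<le> L2_norm M (f i) + (\<Sum>i\<in>I. L2_norm M (f i))" using insert by auto
  finally show ?case using insert by simp
qed (simp_all add: L2_norm_def)

lemma L2_nn_integral: "f \<in> L2 M \<Longrightarrow> (\<integral>\<^sup>+ x. ennreal ((cmod (f x))\<^sup>2) \<partial>M) = ennreal ((L2_norm M f)\<^sup>2)"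
  unfolding L2_norm_sq by (intro nn_integral_eq_integral L2_integrable_sq) auto

lemma L2_of_nn_integral_bound:
  assumes "f \<in> borel_measurable M" "(\<integral>\<^sup>+ x. ennreal ((cmod (f x))\<^sup>2) \<partial>M) \<le> ennreal (b\<^sup>2)" "0 \<le> b"
  shows "f \<in> L2 M" "L2_norm M f \<le> b"
proof -
  have "(\<integral>\<^sup>+ x. ennreal (norm ((cmod (f x))\<^sup>2)) \<partial>M) < \<infinity>"
    using assms(2) by (simp add: order_le_less_trans)
  then have "integrable M (\<lambda>x. (cmod (f x))\<^sup>2)"
    using assms(1) by (subst integrable_iff_bounded) auto
  then show f: "f \<in> L2 M" using assms(1) by (simp add: L2_def)
  have "ennreal ((L2_norm M f)\<^sup>2) \<le> ennreal (b\<^sup>2)" using L2_nn_integral[OF f] assms(2) by simp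
  then have "(L2_norm M f)\<^sup>2 \<le> b\<^sup>2" by simp
  then show "L2_norm M f \<le> b" using assms(3) by (rule power2_le_imp_le)
qed

text \<open>By monotone convergence the sum of all increments \<open>\<bar>f (Suc n) - f n\<bar>\<close> has \<open>L2\<close> norm at most 2. Hence it is
  finite almost everywhere, and there the telescoping series converges.\<close>

lemma L2_fast_Cauchy_limit:
  assumes f: "\<And>n. f n \<in> L2 M"
    and fast: "\<And>n. L2_norm M (\<lambda>x. f (Suc n) x - f n x) \<le> (1/2)^n"
  obtains g where "g \<in> borel_measurable M" "AE x in M. (\<lambda>n. f n x) \<longlonglongrightarrow> g x"
proof -
  have [measurable]: "f n \<in> borel_measurable M" for n using f by (auto dest: L2_measurable)
  define d where "d n x = cmod (f (Suc n) x - f n x)" for n x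
  have [measurable]: "d n \<in> borel_measurable M" for n unfolding d_def by measurable
  define G where "G N x = (\<Sum>n<N. d n x)" for N x
  have [measurable]: "G n \<in> borel_measurable M" for n unfolding G_def by measurable
  have d0: "0 \<le> d n x" for n x by (simp add: d_def)
  have G0: "0 \<le> G n x" for n x unfolding G_def by (intro sum_nonneg d0)
  have bound: "(\<integral>\<^sup>+ x. ennreal ((G N x)\<^sup>2) \<partial>M) \<le> ennreal 4" for N
  proof -
    have dL: "(\<lambda>x. complex_of_real (d n x)) \<in> L2 M" for n
      using L2_diff[OF f[of "Suc n"] f[of n]] by (simp add: L2_def d_def)
    have "L2_norm M (\<lambda>x. \<Sum>n<N. complex_of_real (d n x)) \<le> (\<Sum>n<N. L2_norm M (\<lambda>x. complex_of_real (d n x)))"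
      by (intro L2_norm_sum_le dL)
    also have "\<dots> \<le> (\<Sum>n<N. (1/2)^n)"
      using fast by (intro sum_mono) (simp add: L2_norm_def d_def)
    also have "\<dots> \<le> 2" by (simp add: sum_gp_strict)
    finally have "(L2_norm M (\<lambda>x. \<Sum>n<N. complex_of_real (d n x)))\<^sup>2 \<le> 2\<^sup>2"
      by (intro power_mono) auto
    then have le: "(L2_norm M (\<lambda>x. \<Sum>n<N. complex_of_real (d n x)))\<^sup>2 \<le> 4" by simp
    have eq: "(\<integral>\<^sup>+ x. ennreal ((G N x)\<^sup>2) \<partial>M) = ennreal ((L2_norm M (\<lambda>x. \<Sum>n<N. complex_of_real (d n x)))\<^sup>2)"
      using L2_nn_integral[OF L2_sum[where I = "{..<N}", OF dL]] G0
      by (simp add: G_def flip: of_real_sum)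
    show ?thesis unfolding eq by (rule ennreal_leI[OF le])
  qed
  have incG: "incseq (\<lambda>N x. ennreal ((G N x)\<^sup>2))"
  proof (intro incseq_SucI le_funI ennreal_leI power_mono G0)
    show "G n x \<le> G (Suc n) x" for n x using d0 by (simp add: G_def)
  qed
  have "(\<integral>\<^sup>+ x. (SUP N. ennreal ((G N x)\<^sup>2)) \<partial>M) = (SUP N. \<integral>\<^sup>+ x. ennreal ((G N x)\<^sup>2) \<partial>M)"
    using incG by (intro nn_integral_monotone_convergence_SUP) auto
  also have "\<dots> \<le> ennreal 4" using bound by (intro SUP_least)
  finally have "(\<integral>\<^sup>+ x. (SUP N. ennreal ((G N x)\<^sup>2)) \<partial>M) \<noteq> \<infinity>" by (auto simp: top_unique)
  then have fin: "AE x in M. (SUP N. ennreal ((G N x)\<^sup>2)) \<noteq> \<infinity>"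
    by (intro nn_integral_PInf_AE) auto
  have conv: "AE x in M. convergent (\<lambda>n. f n x)"
    using fin
  proof eventually_elim
    case (elim x)
    then obtain b where b: "(SUP N. ennreal ((G N x)\<^sup>2)) = ennreal b" "0 \<le> b"
      by (cases "SUP N. ennreal ((G N x)\<^sup>2)") auto
    have "G N x \<le> sqrt b" for N
    proof -
      have "ennreal ((G N x)\<^sup>2) \<le> ennreal b" unfolding b(1)[symmetric] by (intro SUP_upper) auto
      then have "(G N x)\<^sup>2 \<le> b" using b(2) by simp
      then show ?thesis using real_le_rsqrt by blast
    qed
    then have "summable (\<lambda>n. d n x)"
      using d0 by (intro summableI_nonneg_bounded[where x = "sqrt b"]) (auto simp: G_def)
    then have "summable (\<lambda>n. f (Suc n) x - f n x)"
      unfolding d_def by (rule summable_norm_cancel)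
    then have "convergent (\<lambda>n. (\<Sum>k<n. f (Suc k) x - f k x) + f 0 x)"
      unfolding summable_iff_convergent by (intro convergent_add convergent_const)
    moreover have "(\<lambda>n. (\<Sum>k<n. f (Suc k) x - f k x) + f 0 x) = (\<lambda>n. f n x)"
      by (rule ext) (subst sum_lessThan_telescope[of "\<lambda>k. f k x"], simp)
    ultimately show ?case by simp
  qed
  show ?thesis
  proof
    show "(\<lambda>x. lim (\<lambda>n. f n x)) \<in> borel_measurable M" by measurable
    show "AE x in M. (\<lambda>n. f n x) \<longlonglongrightarrow> lim (\<lambda>n. f n x)"
      using conv by eventually_elim (simp add: convergent_LIMSEQ_iff)
  qed
qed

text \<open>The Riesz--Fischer theorem. The limit is taken pointwise along a subsequence with rapidly decreasing
  increments; Fatou's lemma then carries the Cauchy estimate over to the distance from the limit.\<close>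

lemma L2_complete:
  assumes f: "\<And>n. f n \<in> L2 M"
    and cauchy: "\<And>e. e > 0 \<Longrightarrow> \<exists>N. \<forall>m\<ge>N. \<forall>n\<ge>N. L2_norm M (\<lambda>x. f m x - f n x) \<le> e"
  obtains g where "g \<in> L2 M" "(\<lambda>n. L2_norm M (\<lambda>x. f n x - g x)) \<longlonglongrightarrow> 0"
proof -
  have fm [measurable]: "f n \<in> borel_measurable M" for n using f by (auto dest: L2_measurable)
  obtain N where N: "\<And>k m n. m \<ge> N k \<Longrightarrow> n \<ge> N k \<Longrightarrow> L2_norm M (\<lambda>x. f m x - f n x) \<le> (1/2)^k" for k :: nat
  proof -
    have "\<forall>k::nat. \<exists>N. \<forall>m\<ge>N. \<forall>n\<ge>N. L2_norm M (\<lambda>x. f m x - f n x) \<le> (1/2)^k"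
      using cauchy by simp
    from choice[OF this] show ?thesis using that by blast
  qed
  \<comment> \<open>Partial sums of the thresholds make the subsequence increasing and keep it above every threshold.\<close>
  define r where "r k = (\<Sum>i\<le>k. N i) + k" for k
  have rN: "N k \<le> r k" for k
    unfolding r_def by (rule trans_le_add1) (simp add: member_le_sum)
  have rS: "r k \<le> r (Suc k)" for k by (simp add: r_def)
  obtain g where [measurable]: "g \<in> borel_measurable M" and lim: "AE x in M. (\<lambda>k. f (r k) x) \<longlonglongrightarrow> g x"
  proof (rule L2_fast_Cauchy_limit[of "\<lambda>k. f (r k)" M])
    show "f (r k) \<in> L2 M" for k by (rule f)
    show "L2_norm M (\<lambda>x. f (r (Suc k)) x - f (r k) x) \<le> (1/2)^k" for k
      by (intro N rN order_trans[OF rN rS])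
  qed (use that in blast)
  have close: "(\<integral>\<^sup>+ x. ennreal ((cmod (f n x - g x))\<^sup>2) \<partial>M) \<le> ennreal (((1/2)^k)\<^sup>2)" if n: "n \<ge> N k" for n k
  proof -
    have "(\<integral>\<^sup>+ x. ennreal ((cmod (f n x - g x))\<^sup>2) \<partial>M)
        = (\<integral>\<^sup>+ x. liminf (\<lambda>i. ennreal ((cmod (f n x - f (r i) x))\<^sup>2)) \<partial>M)"
    proof (rule nn_integral_cong_AE)
      show "AE x in M. ennreal ((cmod (f n x - g x))\<^sup>2) = liminf (\<lambda>i. ennreal ((cmod (f n x - f (r i) x))\<^sup>2))"
        using lim
      proof eventually_elim
        case (elim x)
        then have "(\<lambda>i. ennreal ((cmod (f n x - f (r i) x))\<^sup>2)) \<longlonglongrightarrow> ennreal ((cmod (f n x - g x))\<^sup>2)"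
          by (intro tendsto_intros)
        then show ?case by (intro lim_imp_Liminf[symmetric] trivial_limit_sequentially)
      qed
    qed
    also have "\<dots> \<le> liminf (\<lambda>i. \<integral>\<^sup>+ x. ennreal ((cmod (f n x - f (r i) x))\<^sup>2) \<partial>M)"
      by (intro nn_integral_liminf) auto
    also have "\<dots> \<le> liminf (\<lambda>i. ennreal (((1/2)^k)\<^sup>2))"
    proof (rule Liminf_mono)
      show "\<forall>\<^sub>F i in sequentially. (\<integral>\<^sup>+ x. ennreal ((cmod (f n x - f (r i) x))\<^sup>2) \<partial>M) \<le> ennreal (((1/2)^k)\<^sup>2)"
        using eventually_ge_at_top[of k]
      proof eventually_elim
        case (elim i)
        have "N k \<le> r i" using rN[of k] lift_Suc_mono_le[of r, OF rS elim] by linarith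
        then have "(L2_norm M (\<lambda>x. f n x - f (r i) x))\<^sup>2 \<le> ((1/2)^k)\<^sup>2"
          using N[OF n] by (intro power_mono) auto
        then show ?case using L2_nn_integral[OF L2_diff[OF f f], of n "r i"] by (simp add: ennreal_leI)
      qed
    qed
    finally show ?thesis by (simp add: Liminf_const)
  qed
  have norm: "(\<lambda>x. f n x - g x) \<in> L2 M" "L2_norm M (\<lambda>x. f n x - g x) \<le> (1/2)^k" if "n \<ge> N k" for n k
    using L2_of_nn_integral_bound[OF _ close[OF that]] by auto
  have "(\<lambda>x. f (N 0) x - (f (N 0) x - g x)) \<in> L2 M" by (intro L2_diff f norm(1)[OF order_refl])
  then have "g \<in> L2 M" by simp
  moreover have "(\<lambda>n. L2_norm M (\<lambda>x. f n x - g x)) \<longlonglongrightarrow> 0"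
  proof (rule LIMSEQ_I)
    fix e :: real assume "0 < e"
    then obtain k where "(1/2)^k < e" using real_arch_pow_inv[of e "1/2"] by auto
    then show "\<exists>no. \<forall>n\<ge>no. norm (L2_norm M (\<lambda>x. f n x - g x) - 0) < e"
      using norm(2) by (intro exI[of _ "N k"]) (auto intro: order_le_less_trans)
  qed
  ultimately show ?thesis by (rule that)
qed

section \<open>Test functions\<close>

text \<open>The functions \<open>p(1/t) exp(-1/t)\<close>, extended by zero to \<open>t \<le> 0\<close>. Differentiation only changes the polynomial
  \<open>p\<close>, since at \<open>t = 0\<close> the exponential beats every power of \<open>1/t\<close>.\<close>

definition flat :: "real poly \<Rightarrow> real \<Rightarrow> real" where
  "flat p t = (if t > 0 then poly p (1 / t) * exp (- (1 / t)) else 0)"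

lemma flat_tendsto_0: "(flat p \<longlongrightarrow> 0) (at 0)"
proof -
  have "((\<lambda>x. poly p x * exp (- x)) \<longlongrightarrow> 0) at_top"
  proof -
    have "((\<lambda>x. \<Sum>i\<le>degree p. coeff p i * (x ^ i / exp x)) \<longlongrightarrow> (\<Sum>i\<le>degree p. coeff p i * 0)) at_top"
      by (intro tendsto_intros tendsto_power_div_exp_0)
    moreover have "(\<lambda>x. \<Sum>i\<le>degree p. coeff p i * (x ^ i / exp x)) = (\<lambda>x. poly p x * exp (- x))"
      by (rule ext) (simp add: poly_altdef exp_minus sum_distrib_right divide_inverse mult.assoc)
    ultimately show ?thesis by simp
  qed
  then have "((\<lambda>t. poly p (inverse t) * exp (- inverse t)) \<longlongrightarrow> 0) (at_right 0)"
    by (rule filterlim_compose[OF _ filterlim_inverse_at_top_right])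
  then have "(flat p \<longlongrightarrow> 0) (at_right 0)"
  proof (rule Lim_transform_eventually)
    show "\<forall>\<^sub>F x in at_right 0. poly p (inverse x) * exp (- inverse x) = flat p x"
      by (auto simp: eventually_at_filter flat_def inverse_eq_divide)
  qed
  moreover have "(flat p \<longlongrightarrow> 0) (at_left 0)"
    by (rule tendsto_eventually) (auto simp: eventually_at_filter flat_def)
  ultimately show ?thesis by (simp add: filterlim_split_at_real)
qed

lemma flat_has_derivative: "(flat p has_field_derivative flat ([:0, 0, 1:] * (p - pderiv p)) t) (at t)"
proof -
  consider "t > 0" | "t < 0" | "t = 0" by linarith
  then show ?thesis
  proof cases
    case 1
    have "((\<lambda>t. poly p (1 / t) * exp (- (1 / t))) has_field_derivative flat ([:0, 0, 1:] * (p - pderiv p)) t) (at t)"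
      using 1 by (auto intro!: derivative_eq_intros simp: flat_def field_simps power2_eq_square)
    then show ?thesis
      by (rule DERIV_cong_ev[THEN iffD1, rotated -1]) 
        (use 1 in \<open>auto simp: flat_def intro!: eventually_mono[OF eventually_nhds_in_open[of "{0<..}"]]\<close>)
  next
    case 2
    have "((\<lambda>_. 0) has_field_derivative flat ([:0, 0, 1:] * (p - pderiv p)) t) (at t)"
      using 2 by (auto simp: flat_def)
    then show ?thesis
      by (rule DERIV_cong_ev[THEN iffD1, rotated -1])
        (use 2 in \<open>auto simp: flat_def intro!: eventually_mono[OF eventually_nhds_in_open[of "{..<0}"]]\<close>)
  next
    case 3
    have "((\<lambda>h. (flat p (0 + h) - flat p 0) / h) \<longlongrightarrow> 0) (at 0)"
    proof (rule Lim_transform_eventually[OF flat_tendsto_0[of "[:0, 1:] * p"]])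
      show "\<forall>\<^sub>F x in at 0. flat ([:0, 1:] * p) x = (flat p (0 + x) - flat p 0) / x"
        by (auto simp: flat_def intro!: always_eventually)
    qed
    then show ?thesis using 3 by (simp add: DERIV_def flat_def)
  qed
qed

text \<open>A class of functions that is closed under directional derivatives, so that its members are smooth by
  coinduction, and under the algebraic operations from which cut-offs are built.\<close>

inductive flat_algebra :: "('a::euclidean_space \<Rightarrow> real) \<Rightarrow> bool" where
  const: "flat_algebra (\<lambda>_. c)"
| flat: "flat_algebra (\<lambda>x. flat p (x \<bullet> b + c))"
| add: "flat_algebra f \<Longrightarrow> flat_algebra g \<Longrightarrow> flat_algebra (\<lambda>x. f x + g x)"
| mult: "flat_algebra f \<Longrightarrow> flat_algebra g \<Longrightarrow> flat_algebra (\<lambda>x. f x * g x)"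

lemma flat_algebra_derivative:
  assumes "flat_algebra f"
  shows "\<exists>f'. (\<forall>x. (f has_derivative f' x) (at x)) \<and> (\<forall>h. flat_algebra (\<lambda>x. f' x h))"
  using assms
proof induction
  case (const c)
  show ?case by (intro exI[of _ "\<lambda>_ _. 0"]) (auto intro: flat_algebra.const)
next
  case (flat p b c)
  let ?q = "[:0, 0, 1:] * (p - pderiv p)"
  have "((\<lambda>x. flat p (x \<bullet> b + c)) has_derivative (\<lambda>h. flat ?q (x \<bullet> b + c) * (h \<bullet> b))) (at x)" for x
  proof -
    have "((\<lambda>x. x \<bullet> b + c) has_derivative (\<lambda>h. h \<bullet> b)) (at x)"
      by (auto intro!: derivative_eq_intros)
    from has_derivative_compose[OF this flat_has_derivative[of p "x \<bullet> b + c", unfolded has_field_derivative_def]]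
    show ?thesis .
  qed
  moreover have "flat_algebra (\<lambda>x. flat ?q (x \<bullet> b + c) * (h \<bullet> b))" for h
    by (intro flat_algebra.mult flat_algebra.flat flat_algebra.const)
  ultimately show ?case
    by (intro exI[of _ "\<lambda>x h. flat ?q (x \<bullet> b + c) * (h \<bullet> b)"] conjI allI)
next
  case (add f g)
  then obtain f' g' where fg: "\<And>x. (f has_derivative f' x) (at x)" "\<And>h. flat_algebra (\<lambda>x. f' x h)"
    "\<And>x. (g has_derivative g' x) (at x)" "\<And>h. flat_algebra (\<lambda>x. g' x h)" by blast
  show ?case
    by (intro exI[of _ "\<lambda>x h. f' x h + g' x h"] conjI allI has_derivative_add flat_algebra.add fg)
next
  case (mult f g)
  then obtain f' g' where fg: "\<And>x. (f has_derivative f' x) (at x)" "\<And>h. flat_algebra (\<lambda>x. f' x h)"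
    "\<And>x. (g has_derivative g' x) (at x)" "\<And>h. flat_algebra (\<lambda>x. g' x h)" by blast
  show ?case
    by (intro exI[of _ "\<lambda>x h. f x * g' x h + f' x h * g x"] conjI allI has_derivative_mult
        flat_algebra.add flat_algebra.mult fg mult.hyps)
qed

lemma flat_algebra_smooth: "flat_algebra f \<Longrightarrow> smooth f"
proof (coinduction arbitrary: f)
  case smooth
  then show ?case using flat_algebra_derivative[OF smooth] by blast
qed

lemma flat_algebra_power: "flat_algebra f \<Longrightarrow> flat_algebra (\<lambda>x. f x ^ n)"
  by (induction n) (auto intro: flat_algebra.intros)

lemma flat_algebra_prod: "(\<And>i. i \<in> I \<Longrightarrow> flat_algebra (f i)) \<Longrightarrow> flat_algebra (\<lambda>x. \<Prod>i\<in>I. f i x)"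
  by (induction I rule: infinite_finite_induct) (auto intro: flat_algebra.intros)

definition box_bump :: "'a::euclidean_space \<Rightarrow> 'a \<Rightarrow> 'a \<Rightarrow> real" where
  "box_bump a c x = (\<Prod>b\<in>Basis. flat 1 (x \<bullet> b + - (a \<bullet> b)) * flat 1 (x \<bullet> (- b) + c \<bullet> b))"

lemma flat_1: "flat 1 t = (if t > 0 then exp (- (1 / t)) else 0)"
  by (simp add: flat_def)

lemma box_bump_bounds: "0 \<le> box_bump a c x" "box_bump a c x \<le> 1"
  unfolding box_bump_def flat_1
  by (auto intro!: prod_nonneg prod_le_1 mult_le_one)

lemma box_bump_pos_iff: "box_bump a c x \<noteq> 0 \<longleftrightarrow> x \<in> box a c"
  by (auto simp: box_bump_def flat_1 mem_box)

lemma flat_algebra_box_bump: "flat_algebra (box_bump a c)"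
  unfolding box_bump_def[abs_def] by (intro flat_algebra_prod flat_algebra.intros)

text \<open>The bump is positive exactly on the open box, so these functions converge to the indicator of the box; as
  polynomials in the bump they stay in the algebra. Subtraction is spelled out to match its rules.\<close>

definition box_cutoff :: "nat \<Rightarrow> 'a::euclidean_space \<Rightarrow> 'a \<Rightarrow> 'a \<Rightarrow> real" where
  "box_cutoff n a c x = 1 + (-1) * (1 + (-1) * box_bump a c x) ^ n"

lemma box_cutoff_bounds: "0 \<le> box_cutoff n a c x" "box_cutoff n a c x \<le> 1"
  using box_bump_bounds[of a c x] by (auto simp: box_cutoff_def power_le_one)

lemma box_cutoff_outside: "x \<notin> box a c \<Longrightarrow> box_cutoff n a c x = 0"
  using box_bump_pos_iff[of a c x] by (auto simp: box_cutoff_def)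

lemma box_cutoff_tendsto: "(\<lambda>n. box_cutoff n a c x) \<longlonglongrightarrow> indicator (box a c) x"
proof (cases "x \<in> box a c")
  case True
  then have "box_bump a c x \<noteq> 0" by (simp add: box_bump_pos_iff)
  then have "\<bar>1 + (-1) * box_bump a c x\<bar> < 1" using box_bump_bounds[of a c x] by auto
  then have "(\<lambda>n. 1 + (-1) * (1 + (-1) * box_bump a c x) ^ n) \<longlonglongrightarrow> 1 + (-1) * 0"
    by (intro tendsto_intros LIMSEQ_abs_realpow_zero2)
  then show ?thesis using True by (simp add: box_cutoff_def)
qed (simp add: box_cutoff_outside)

lemma test_function_box_cutoff:
  assumes "cbox a c \<subseteq> \<Omega>" shows "test_function \<Omega> (box_cutoff n a c)"
proof -
  have "flat_algebra (box_cutoff n a c)"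
    unfolding box_cutoff_def[abs_def]
    by (intro flat_algebra.add flat_algebra.mult flat_algebra.const flat_algebra_power flat_algebra_box_bump)
  moreover have "{x. box_cutoff n a c x \<noteq> 0} \<subseteq> cbox a c"
    using box_cutoff_outside box_subset_cbox by blast
  then have "closure {x. box_cutoff n a c x \<noteq> 0} \<subseteq> cbox a c"
    by (intro closure_minimal) auto
  ultimately show ?thesis
    using assms flat_algebra_smooth
    by (auto simp: test_function_def intro: compact_closure[THEN iffD2] bounded_subset[OF bounded_cbox closure_subset[THEN subset_trans]])
qed

lemma smooth_has_derivative:
  assumes "smooth f"
  shows "(f has_derivative frechet_derivative f (at x)) (at x)"
    and "smooth (\<lambda>x. frechet_derivative f (at x) h)"
proof -
  have "(\<forall>x. (f has_derivative frechet_derivative f (at x)) (at x)) \<and> (\<forall>h. smooth (\<lambda>x. frechet_derivative f (at x) h))"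
    using assms
  proof cases
    case (1 f')
    have eq: "frechet_derivative f (at x) = f' x" for x
      using frechet_derivative_at[of f "f' x" x] 1 by simp
    show ?thesis using 1 by (simp add: eq)
  qed
  then show "(f has_derivative frechet_derivative f (at x)) (at x)"
    and "smooth (\<lambda>x. frechet_derivative f (at x) h)" by auto
qed

lemma smooth_continuous: "smooth f \<Longrightarrow> continuous_on A f"
  by (rule has_derivative_continuous_on, rule has_derivative_at_withinI, rule smooth_has_derivative(1))

lemma test_function_bounded:
  assumes "test_function \<Omega> \<phi>"
  obtains B where "\<And>x. \<bar>\<phi> x\<bar> \<le> B" "0 \<le> B"
proof -
  let ?K = "closure {x. \<phi> x \<noteq> 0}"
  have "compact (\<phi> ` ?K)"
    using assms by (intro compact_continuous_image smooth_continuous) (auto simp: test_function_def)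
  then have "bounded (\<phi> ` ?K)" by (rule compact_imp_bounded)
  then obtain B where B: "\<And>y. y \<in> \<phi> ` ?K \<Longrightarrow> \<bar>y\<bar> \<le> B"
    unfolding bounded_real by blast
  have "\<bar>\<phi> x\<bar> \<le> \<bar>B\<bar>" for x
  proof (cases "\<phi> x = 0")
    case False
    then have "x \<in> ?K" using closure_subset[of "{x. \<phi> x \<noteq> 0}"] by auto
    then show ?thesis using B[of "\<phi> x"] by auto
  qed simp
  then show ?thesis by (intro that[of "\<bar>B\<bar>"]) auto
qed

lemma test_function_derivative:
  assumes "test_function \<Omega> \<phi>"
  shows "test_function \<Omega> (\<lambda>x. frechet_derivative \<phi> (at x) b)"
proof -
  let ?K = "closure {x. \<phi> x \<noteq> 0}"
  have K: "compact ?K" "?K \<subseteq> \<Omega>" and s: "smooth \<phi>" using assms by (auto simp: test_function_def)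
  define \<phi>' where "\<phi>' x = frechet_derivative \<phi> (at x)" for x
  note d = smooth_has_derivative[OF s, folded \<phi>'_def]
  have "\<phi>' x b = 0" if "x \<notin> ?K" for x
  proof -
    have "((\<lambda>_. 0) has_derivative (\<lambda>_. 0)) (at x)" by simp
    then have "(\<phi> has_derivative (\<lambda>_. 0)) (at x)"
    proof (rule has_derivative_transform_within_open[where s = "- ?K"])
      show "\<And>y. y \<in> - ?K \<Longrightarrow> 0 = \<phi> y" using closure_subset[of "{x. \<phi> x \<noteq> 0}"] by auto
    qed (use that in auto)
    then show ?thesis using d(1)[of x] has_derivative_unique by metis
  qed
  then have "{x. \<phi>' x b \<noteq> 0} \<subseteq> ?K" by auto
  then have sub: "closure {x. \<phi>' x b \<noteq> 0} \<subseteq> ?K" by (intro closure_minimal) auto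
  with K have "compact (closure {x. \<phi>' x b \<noteq> 0})"
    using compact_Int_closed[OF K(1) closed_closure] by (metis Int_absorb1)
  then show ?thesis using sub K d(2) by (auto simp: test_function_def \<phi>'_def)
qed

section \<open>The fundamental lemma of the calculus of variations\<close>

locale bounded_open =
  fixes \<Omega> :: "'a::euclidean_space set"
  assumes open_domain: "open \<Omega>" and bounded_domain: "bounded \<Omega>"
begin

abbreviation M where "M \<equiv> lebesgue_on \<Omega>"

lemma domain_lebesgue [measurable]: "\<Omega> \<in> sets lebesgue"
  using open_domain by auto

lemma finite_measure_domain: "finite_measure M"
  by (intro finite_measure_lebesgue_on lmeasurable_open open_domain bounded_domain)

lemma borel_measurable_on_domain: "f \<in> borel_measurable borel \<Longrightarrow> f \<in> borel_measurable M"
  by (intro measurable_restrict_space1 measurable_completion) simp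

lemma AE_domain: "(AE x in lebesgue. P x) \<Longrightarrow> (AE x in M. P x)"
  by (subst AE_restrict_space_iff) (auto elim: eventually_mono)

lemma bounded_in_L2:
  assumes "f \<in> borel_measurable M" "\<And>x. cmod (f x) \<le> B"
  shows "f \<in> L2 M"
proof (rule L2_I[OF assms(1)])
  note assms(1)[measurable]
  have "(cmod (f x))\<^sup>2 \<le> B\<^sup>2" for x by (intro power_mono assms(2)) auto
  then show "integrable M (\<lambda>x. (cmod (f x))\<^sup>2)"
    by (intro finite_measure.integrable_const_bound[OF finite_measure_domain, where B = "B\<^sup>2"]) auto
qed

lemma test_function_L2:
  assumes "test_function \<Omega> \<phi>" shows "(\<lambda>x. complex_of_real (\<phi> x)) \<in> L2 M"
proof -
  obtain B where "\<And>x. \<bar>\<phi> x\<bar> \<le> B" "0 \<le> B" using test_function_bounded[OF assms] by blast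
  moreover have "continuous_on UNIV \<phi>"
    using assms by (intro smooth_continuous) (simp add: test_function_def)
  then have "\<phi> \<in> borel_measurable borel" by (rule borel_measurable_continuous_onI)
  then have "\<phi> \<in> borel_measurable M" by (rule borel_measurable_on_domain)
  ultimately show ?thesis by (intro bounded_in_L2[where B = B]) auto
qed

lemma L2_integrable: assumes "h \<in> L2 M" shows "integrable M h"
proof -
  have "(\<lambda>_. 1) \<in> L2 M" by (rule bounded_in_L2[where B = 1]) auto
  from L2_integrable_mult[OF assms this] show ?thesis by simp
qed

lemma box_integral_zero:
  assumes h: "h \<in> L2 M"
    and zero: "\<And>\<phi>. test_function \<Omega> \<phi> \<Longrightarrow> (\<integral>x. \<phi> x *\<^sub>R h x \<partial>M) = 0"
    and "cbox a c \<subseteq> \<Omega>"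
  shows "(\<integral>x. indicator (box a c) x *\<^sub>R h x \<partial>M) = 0"
proof -
  have [measurable]: "h \<in> borel_measurable M" using h by (rule L2_measurable)
  have [measurable]: "box a c \<in> sets borel" by auto
  have [measurable]: "box_cutoff n a c \<in> borel_measurable M" for n
    using test_function_box_cutoff[OF assms(3), of n]
    by (intro borel_measurable_on_domain borel_measurable_continuous_onI smooth_continuous)
      (simp add: test_function_def)
  have "(\<lambda>n. \<integral>x. box_cutoff n a c x *\<^sub>R h x \<partial>M) \<longlonglongrightarrow> (\<integral>x. indicator (box a c) x *\<^sub>R h x \<partial>M)"
  proof (rule integral_dominated_convergence[where w = "\<lambda>x. norm (h x)"])
    have "indicator (box a c) \<in> borel_measurable M"
      by (intro borel_measurable_on_domain) measurable
    then show "(\<lambda>x. indicator (box a c) x *\<^sub>R h x) \<in> borel_measurable M" by measurable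
    show "(\<lambda>x. box_cutoff n a c x *\<^sub>R h x) \<in> borel_measurable M" for n by measurable
    show "integrable M (\<lambda>x. norm (h x))" using L2_integrable[OF h] by simp
    show "AE x in M. (\<lambda>n. box_cutoff n a c x *\<^sub>R h x) \<longlonglongrightarrow> indicator (box a c) x *\<^sub>R h x"
      by (intro AE_I2 tendsto_intros box_cutoff_tendsto)
    show "AE x in M. norm (box_cutoff n a c x *\<^sub>R h x) \<le> norm (h x)" for n
      using box_cutoff_bounds[of n a c] by (intro AE_I2) (simp add: mult_left_le_one_le)
  qed
  moreover have "(\<integral>x. box_cutoff n a c x *\<^sub>R h x \<partial>M) = 0" for n
    by (intro zero test_function_box_cutoff assms)
  ultimately show ?thesis by (simp add: LIMSEQ_const_iff)
qed

text \<open>The sub-boxes of the given box generate its Borel sets and are stable under intersection, so the integral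
  of \<open>h\<close> vanishes over all its Borel sets. Lebesgue measurable sets differ from these by null sets.\<close>

lemma box_AE_zero:
  assumes h: "h \<in> L2 M"
    and zero: "\<And>\<phi>. test_function \<Omega> \<phi> \<Longrightarrow> (\<integral>x. \<phi> x *\<^sub>R h x \<partial>M) = 0"
    and sub: "cbox a c \<subseteq> \<Omega>"
  shows "AE x in M. indicator (box a c) x *\<^sub>R h x = 0"
proof -
  let ?B = "box a c"
  let ?h = "\<lambda>x. indicator ?B x *\<^sub>R h x"
  have [measurable]: "h \<in> borel_measurable M" using h by (rule L2_measurable)
  have borelM: "A \<in> sets borel \<Longrightarrow> A \<inter> \<Omega> \<in> sets M" for A
    using open_domain by (auto simp: sets_restrict_space)
  have ind [measurable]: "A \<in> sets borel \<Longrightarrow> (indicator A :: 'a \<Rightarrow> real) \<in> borel_measurable M" for A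
    by (intro borel_measurable_on_domain borel_measurable_indicator)
  have int: "integrable M (\<lambda>x. indicator A x *\<^sub>R h x)" if "A \<in> sets borel" for A
  proof (rule Bochner_Integration.integrable_bound[OF L2_integrable[OF h]])
    show "(\<lambda>x. indicator A x *\<^sub>R h x) \<in> borel_measurable M"
      using ind[OF that] by measurable
    show "AE x in M. norm (indicator A x *\<^sub>R h x) \<le> norm (h x)" by (auto simp: indicator_def)
  qed
  have Bb: "?B \<in> sets borel" by auto
  have borel: "(\<integral>x. indicator (A \<inter> ?B) x *\<^sub>R h x \<partial>M) = 0" if "A \<in> sets borel" for A
  proof -
    have "Int_stable (range (\<lambda>(a, b). box a b :: 'a set))"
      by (auto simp: Int_stable_def box_Int_box)
    moreover have "range (\<lambda>(a, b). box a b :: 'a set) \<subseteq> Pow UNIV" by simp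
    moreover have "A \<in> sigma_sets UNIV (range (\<lambda>(a, b). box a b :: 'a set))"
      using that unfolding borel_eq_box by simp
    ultimately show ?thesis
    proof (induction rule: sigma_sets_induct_disjoint)
      case (basic A)
      then obtain a' c' where A: "A = box a' c'" by auto
      obtain a'' c'' where eq: "A \<inter> ?B = box a'' c''" unfolding A box_Int_box by blast
      show ?case
      proof (cases "box a'' c'' = {}")
        case False
        then have "cbox a'' c'' = closure (box a'' c'')" by simp
        also have "\<dots> \<subseteq> cbox a c" unfolding eq[symmetric]
          by (intro closure_minimal) (use box_subset_cbox[of a c] in auto)
        finally have "cbox a'' c'' \<subseteq> \<Omega>" using sub by simp
        then show ?thesis unfolding eq by (intro box_integral_zero[OF h zero])
      qed (simp add: eq)
    next
      case (compl A)
      have A: "A \<in> sets borel" using compl.hyps unfolding borel_eq_box by simp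
      have "(\<integral>x. indicator ((UNIV - A) \<inter> ?B) x *\<^sub>R h x \<partial>M)
          = (\<integral>x. indicator ?B x *\<^sub>R h x - indicator (A \<inter> ?B) x *\<^sub>R h x \<partial>M)"
        by (intro Bochner_Integration.integral_cong) (auto simp: indicator_def)
      also have "\<dots> = (\<integral>x. indicator ?B x *\<^sub>R h x \<partial>M) - (\<integral>x. indicator (A \<inter> ?B) x *\<^sub>R h x \<partial>M)"
        using A Bb by (intro Bochner_Integration.integral_diff int sets.Int)
      also have "\<dots> = 0" using compl.IH box_integral_zero[OF h zero sub] by simp
      finally show ?case .
    next
      case (union A)
      have A: "A i \<in> sets borel" for i using union.hyps unfolding borel_eq_box by auto
      define A' where "A' i = (A i \<inter> ?B) \<inter> \<Omega>" for i
      have A': "A' i \<in> sets M" for i unfolding A'_def using A Bb by (intro borelM) auto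
      have eqi: "set_lebesgue_integral M (A' i) h = 0" for i
      proof -
        have "set_lebesgue_integral M (A' i) h = (\<integral>x. indicator (A i \<inter> ?B) x *\<^sub>R h x \<partial>M)"
          unfolding set_lebesgue_integral_def A'_def
          by (intro Bochner_Integration.integral_cong) (auto simp: indicator_def)
        then show ?thesis using union.IH by simp
      qed
      have U: "(\<Union>i. A i) \<inter> ?B \<in> sets borel" using A Bb by auto
      have "set_integrable M (\<Union>i. A' i) h"
      proof -
        have "integrable M (\<lambda>x. indicator ((\<Union>i. A i) \<inter> ?B) x *\<^sub>R h x)" by (rule int[OF U])
        moreover have "integrable M (\<lambda>x. indicator ((\<Union>i. A i) \<inter> ?B) x *\<^sub>R h x)
            \<longleftrightarrow> integrable M (\<lambda>x. indicator (\<Union>i. A' i) x *\<^sub>R h x)"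
          by (intro Bochner_Integration.integrable_cong) (auto simp: A'_def indicator_def)
        ultimately show ?thesis by (simp add: set_integrable_def)
      qed
      moreover have "A' i \<inter> A' j = {}" if "i \<noteq> j" for i j
        using union.hyps(1) that by (auto simp: A'_def disjoint_family_on_def)
      ultimately have "set_lebesgue_integral M (\<Union>i. A' i) h = (\<Sum>i. set_lebesgue_integral M (A' i) h)"
        using A' by (intro lebesgue_integral_countable_add) auto
      also have "\<dots> = 0" by (simp add: eqi)
      also have "set_lebesgue_integral M (\<Union>i. A' i) h = (\<integral>x. indicator ((\<Union>i. A i) \<inter> ?B) x *\<^sub>R h x \<partial>M)"
        unfolding set_lebesgue_integral_def A'_def
        by (intro Bochner_Integration.integral_cong) (auto simp: indicator_def)
      finally show ?case .
    qed auto
  qed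
  interpret finite_measure M by (rule finite_measure_domain)
  show ?thesis
  proof (rule density_zero)
    show "integrable M ?h" by (rule int[OF Bb])
    fix A assume "A \<in> sets M"
    then have "A \<in> sets lebesgue" by (auto simp: sets_restrict_space)
    then obtain S N N' where A: "A = S \<union> N" "N \<subseteq> N'" "N' \<in> null_sets lborel" "S \<in> sets lborel"
      by (rule sets_completionE)
    have "AE x in lebesgue. x \<notin> N'" using A(3) by (intro AE_not_in null_sets_completionI)
    then have "AE x in M. x \<notin> N'" by (rule AE_domain)
    then have ae: "AE x in M. indicator A x *\<^sub>R ?h x = indicator (S \<inter> ?B) x *\<^sub>R h x"
      by eventually_elim (use A in \<open>auto simp: indicator_def\<close>)
    have [measurable]: "A \<in> sets M" by fact
    have "set_lebesgue_integral M A ?h = (\<integral>x. indicator (S \<inter> ?B) x *\<^sub>R h x \<partial>M)"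
      unfolding set_lebesgue_integral_def
    proof (rule integral_cong_AE[OF _ _ ae])
      show "(\<lambda>x. indicator A x *\<^sub>R ?h x) \<in> borel_measurable M"
        using ind[OF Bb] by measurable
      show "(\<lambda>x. indicator (S \<inter> ?B) x *\<^sub>R h x) \<in> borel_measurable M"
        using int[of "S \<inter> ?B"] A(4) Bb by auto
    qed
    also have "\<dots> = 0" using A(4) by (intro borel) simp
    finally show "set_lebesgue_integral M A ?h = 0" .
  qed
qed

text \<open>Countably many closed boxes cover the domain, and their frontiers are negligible.\<close>

lemma fundamental_lemma:
  assumes h: "h \<in> L2 M"
    and zero: "\<And>\<phi>. test_function \<Omega> \<phi> \<Longrightarrow> (\<integral>x. \<phi> x *\<^sub>R h x \<partial>M) = 0"
  shows "AE x in M. h x = 0"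
proof -
  obtain D where D: "countable D" "D \<subseteq> Pow \<Omega>" "\<And>X. X \<in> D \<Longrightarrow> \<exists>a b. X = cbox a b" "\<Union>D = \<Omega>"
    by (rule open_countable_Union_open_cbox[OF open_domain]) blast
  have "AE x in M. x \<in> X \<longrightarrow> h x = 0" if X: "X \<in> D" for X
  proof -
    obtain a c where ac: "X = cbox a c" using D(3)[OF X] by blast
    have sub: "cbox a c \<subseteq> \<Omega>" using D(2) X ac by auto
    have "cbox a c - box a c \<in> null_sets lebesgue"
      using negligible_frontier_interval[of a c] by (simp add: negligible_iff_null_sets)
    then have "AE x in lebesgue. x \<notin> cbox a c - box a c" by (rule AE_not_in)
    then have "AE x in M. x \<notin> cbox a c - box a c" by (rule AE_domain)
    moreover have "AE x in M. indicator (box a c) x *\<^sub>R h x = 0"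
      by (rule box_AE_zero[OF h _ sub]) (rule zero)
    ultimately show ?thesis
      by eventually_elim (auto simp: ac indicator_def)
  qed
  then have "AE x in M. \<forall>X\<in>D. x \<in> X \<longrightarrow> h x = 0"
    using D(1) by (subst AE_ball_countable) auto
  then show ?thesis
    using AE_space by eventually_elim (use D(4) in auto)
qed

section \<open>Weak derivatives\<close>

text \<open>In this form weak derivatives inherit linearity and stability under limits from the inner product of
  \<open>L2\<close>, because test functions and their derivatives are square integrable.\<close>

lemma weak_partial_iff:
  "weak_partial \<Omega> b u g \<longleftrightarrow> (\<forall>\<phi>. test_function \<Omega> \<phi> \<longrightarrow>
     L2_inner M u (\<lambda>x. complex_of_real (frechet_derivative \<phi> (at x) b)) = - L2_inner M g (\<lambda>x. complex_of_real (\<phi> x)))"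
  unfolding weak_partial_def L2_inner_def by (simp add: scaleR_conv_of_real mult.commute)

text \<open>The function \<open>wpartial\<close> is an arbitrary choice of a weak derivative; uniqueness makes it linear up to
  null sets.\<close>

lemma weak_partial_unique:
  assumes "g \<in> L2 M" "g' \<in> L2 M" "weak_partial \<Omega> b u g" "weak_partial \<Omega> b u g'"
  shows "AE x in M. g x = g' x"
proof -
  have "AE x in M. g x - g' x = 0"
  proof (rule fundamental_lemma)
    show "(\<lambda>x. g x - g' x) \<in> L2 M" by (intro L2_diff assms)
    fix \<phi> assume \<phi>: "test_function \<Omega> \<phi>"
    have "(\<integral>x. \<phi> x *\<^sub>R (g x - g' x) \<partial>M) = L2_inner M (\<lambda>x. g x - g' x) (\<lambda>x. complex_of_real (\<phi> x))"
      by (simp add: L2_inner_def scaleR_conv_of_real mult.commute)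
    also have "\<dots> = L2_inner M g (\<lambda>x. complex_of_real (\<phi> x)) - L2_inner M g' (\<lambda>x. complex_of_real (\<phi> x))"
      by (intro L2_inner_diff_left assms test_function_L2 \<phi>)
    also have "\<dots> = 0" using assms(3,4) \<phi> unfolding weak_partial_iff by (metis eq_iff_diff_eq_0 minus_equation_iff)
    finally show "(\<integral>x. \<phi> x *\<^sub>R (g x - g' x) \<partial>M) = 0" .
  qed
  then show ?thesis by simp
qed

lemma weak_partial_add:
  assumes "u \<in> L2 M" "v \<in> L2 M" "g \<in> L2 M" "h \<in> L2 M" "weak_partial \<Omega> b u g" "weak_partial \<Omega> b v h"
  shows "weak_partial \<Omega> b (\<lambda>x. u x + v x) (\<lambda>x. g x + h x)"
  using assms unfolding weak_partial_iff
  by (simp add: L2_inner_add_left test_function_L2 test_function_derivative)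

lemma weak_partial_scale:
  assumes "weak_partial \<Omega> b u g" shows "weak_partial \<Omega> b (\<lambda>x. c * u x) (\<lambda>x. c * g x)"
  using assms unfolding weak_partial_iff by (simp add: L2_inner_scale_left)

lemma weak_partial_cong_AE:
  assumes "weak_partial \<Omega> b u g" "u \<in> L2 M" "v \<in> L2 M" "AE x in M. u x = v x"
  shows "weak_partial \<Omega> b v g"
proof -
  have "L2_inner M v (\<lambda>x. complex_of_real (frechet_derivative \<phi> (at x) b))
      = L2_inner M u (\<lambda>x. complex_of_real (frechet_derivative \<phi> (at x) b))"
    if "test_function \<Omega> \<phi>" for \<phi>
    using assms(4) test_function_L2[OF test_function_derivative[OF that, of b]]
    by (intro L2_inner_cong_AE) (auto intro: L2_measurable assms)
  then show ?thesis using assms(1) unfolding weak_partial_iff by simp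
qed

lemma L2_inner_tendsto:
  assumes "\<And>n. f n \<in> L2 N" "g \<in> L2 N" "h \<in> L2 N" "(\<lambda>n. L2_norm N (\<lambda>x. f n x - g x)) \<longlonglongrightarrow> 0"
  shows "(\<lambda>n. L2_inner N (f n) h) \<longlonglongrightarrow> L2_inner N g h"
proof -
  have "(\<lambda>n. L2_inner N (\<lambda>x. f n x - g x) h) \<longlonglongrightarrow> 0"
  proof (rule Lim_null_comparison)
    show "\<forall>\<^sub>F n in sequentially. norm (L2_inner N (\<lambda>x. f n x - g x) h) \<le> L2_norm N (\<lambda>x. f n x - g x) * L2_norm N h"
      by (intro always_eventually allI L2_Cauchy_Schwarz L2_diff assms)
    show "(\<lambda>n. L2_norm N (\<lambda>x. f n x - g x) * L2_norm N h) \<longlonglongrightarrow> 0"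
      using tendsto_mult[OF assms(4) tendsto_const, of "L2_norm N h"] by simp
  qed
  then show ?thesis using assms by (simp add: L2_inner_diff_left LIM_zero_iff)
qed

lemma weak_partial_closed:
  assumes "\<And>n. u n \<in> L2 M" "\<And>n. g n \<in> L2 M" "\<And>n. weak_partial \<Omega> b (u n) (g n)"
    and "v \<in> L2 M" "(\<lambda>n. L2_norm M (\<lambda>x. u n x - v x)) \<longlonglongrightarrow> 0"
    and "h \<in> L2 M" "(\<lambda>n. L2_norm M (\<lambda>x. g n x - h x)) \<longlonglongrightarrow> 0"
  shows "weak_partial \<Omega> b v h"
  unfolding weak_partial_iff
proof (intro allI impI)
  fix \<phi> assume \<phi>: "test_function \<Omega> \<phi>"
  let ?d = "\<lambda>x. complex_of_real (frechet_derivative \<phi> (at x) b)"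
  let ?p = "\<lambda>x. complex_of_real (\<phi> x)"
  have "(\<lambda>n. L2_inner M (u n) ?d) \<longlonglongrightarrow> L2_inner M v ?d"
    by (intro L2_inner_tendsto assms test_function_L2 test_function_derivative \<phi>)
  moreover have "(\<lambda>n. L2_inner M (u n) ?d) = (\<lambda>n. - L2_inner M (g n) ?p)"
    using assms(3) \<phi> by (auto simp: weak_partial_iff)
  moreover have "(\<lambda>n. - L2_inner M (g n) ?p) \<longlonglongrightarrow> - L2_inner M h ?p"
    by (intro tendsto_minus L2_inner_tendsto assms test_function_L2 \<phi>)
  ultimately show "L2_inner M v ?d = - L2_inner M h ?p" by (simp add: LIMSEQ_unique)
qed

section \<open>The Sobolev space\<close>

lemma H1_L2: "u \<in> H1 \<Omega> \<Longrightarrow> u \<in> L2 M"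
  by (simp add: H1_def)

lemma H1_I: "u \<in> L2 M \<Longrightarrow> (\<And>b. b \<in> Basis \<Longrightarrow> g b \<in> L2 M) \<Longrightarrow> (\<And>b. b \<in> Basis \<Longrightarrow> weak_partial \<Omega> b u (g b)) \<Longrightarrow> u \<in> H1 \<Omega>"
  by (auto simp: H1_def)

lemma wpartial:
  assumes "u \<in> H1 \<Omega>" "b \<in> Basis"
  shows "wpartial \<Omega> b u \<in> L2 M" "weak_partial \<Omega> b u (wpartial \<Omega> b u)"
proof -
  have "\<exists>g. g \<in> L2 M \<and> weak_partial \<Omega> b u g" using assms by (auto simp: H1_def)
  from someI_ex[OF this] show "wpartial \<Omega> b u \<in> L2 M" "weak_partial \<Omega> b u (wpartial \<Omega> b u)"
    by (auto simp: wpartial_def)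
qed

lemma wpartial_eqI:
  assumes "u \<in> H1 \<Omega>" "b \<in> Basis" "g \<in> L2 M" "weak_partial \<Omega> b u g"
  shows "AE x in M. wpartial \<Omega> b u x = g x"
  using weak_partial_unique wpartial[OF assms(1,2)] assms(3,4) by blast

lemma weak_partial_H1_add:
  assumes "u \<in> H1 \<Omega>" "v \<in> H1 \<Omega>" "b \<in> Basis"
  shows "weak_partial \<Omega> b (\<lambda>x. u x + v x) (\<lambda>x. wpartial \<Omega> b u x + wpartial \<Omega> b v x)"
  by (rule weak_partial_add[OF H1_L2[OF assms(1)] H1_L2[OF assms(2)] wpartial(1)[OF assms(1,3)]
      wpartial(1)[OF assms(2,3)] wpartial(2)[OF assms(1,3)] wpartial(2)[OF assms(2,3)]])

lemma H1_add:
  assumes "u \<in> H1 \<Omega>" "v \<in> H1 \<Omega>" shows "(\<lambda>x. u x + v x) \<in> H1 \<Omega>"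
proof (rule H1_I[where g = "\<lambda>b x. wpartial \<Omega> b u x + wpartial \<Omega> b v x"])
  show "(\<lambda>x. u x + v x) \<in> L2 M" by (rule L2_add[OF H1_L2[OF assms(1)] H1_L2[OF assms(2)]])
  show "(\<lambda>x. wpartial \<Omega> b u x + wpartial \<Omega> b v x) \<in> L2 M" if "b \<in> Basis" for b
    by (rule L2_add[OF wpartial(1)[OF assms(1) that] wpartial(1)[OF assms(2) that]])
qed (rule weak_partial_H1_add[OF assms])

lemma H1_scale:
  assumes "u \<in> H1 \<Omega>" shows "(\<lambda>x. c * u x) \<in> H1 \<Omega>"
proof (rule H1_I[where g = "\<lambda>b x. c * wpartial \<Omega> b u x"])
  show "(\<lambda>x. c * u x) \<in> L2 M" by (rule L2_scale[OF H1_L2[OF assms]])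
  show "(\<lambda>x. c * wpartial \<Omega> b u x) \<in> L2 M" if "b \<in> Basis" for b
    by (rule L2_scale[OF wpartial(1)[OF assms that]])
qed (rule weak_partial_scale[OF wpartial(2)[OF assms]])

lemma H1_zero: "(\<lambda>_. 0) \<in> H1 \<Omega>"
  by (rule H1_I[where g = "\<lambda>_ _. 0"]) (auto simp: weak_partial_def)

lemma H1_diff:
  assumes "u \<in> H1 \<Omega>" "v \<in> H1 \<Omega>" shows "(\<lambda>x. u x - v x) \<in> H1 \<Omega>"
  using H1_add[OF assms(1) H1_scale[OF assms(2), of "-1"]] by simp

lemma H1_sum: "(\<And>i. i \<in> I \<Longrightarrow> f i \<in> H1 \<Omega>) \<Longrightarrow> (\<lambda>x. \<Sum>i\<in>I. f i x) \<in> H1 \<Omega>"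
  by (induction I rule: infinite_finite_induct) (auto intro: H1_add H1_zero)

lemma wpartial_add:
  assumes "u \<in> H1 \<Omega>" "v \<in> H1 \<Omega>" "b \<in> Basis"
  shows "AE x in M. wpartial \<Omega> b (\<lambda>x. u x + v x) x = wpartial \<Omega> b u x + wpartial \<Omega> b v x"
  by (rule wpartial_eqI[OF H1_add[OF assms(1,2)] assms(3)
      L2_add[OF wpartial(1)[OF assms(1,3)] wpartial(1)[OF assms(2,3)]] weak_partial_H1_add[OF assms]])

lemma wpartial_scale:
  assumes "u \<in> H1 \<Omega>" "b \<in> Basis"
  shows "AE x in M. wpartial \<Omega> b (\<lambda>x. c * u x) x = c * wpartial \<Omega> b u x"
  by (rule wpartial_eqI[OF H1_scale[OF assms(1)] assms(2) L2_scale[OF wpartial(1)[OF assms]]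
      weak_partial_scale[OF wpartial(2)[OF assms]]])

lemma wpartial_cong_AE:
  assumes "u \<in> H1 \<Omega>" "v \<in> H1 \<Omega>" "AE x in M. u x = v x" "b \<in> Basis"
  shows "AE x in M. wpartial \<Omega> b v x = wpartial \<Omega> b u x"
  by (rule wpartial_eqI[OF assms(2,4) wpartial(1)[OF assms(1,4)]
      weak_partial_cong_AE[OF wpartial(2)[OF assms(1,4)] H1_L2[OF assms(1)] H1_L2[OF assms(2)] assms(3)]])

lemma wpartial_diff:
  assumes "u \<in> H1 \<Omega>" "v \<in> H1 \<Omega>" "b \<in> Basis"
  shows "AE x in M. wpartial \<Omega> b (\<lambda>x. u x - v x) x = wpartial \<Omega> b u x - wpartial \<Omega> b v x"
  using wpartial_add[OF assms(1) H1_scale[OF assms(2), of "-1"] assms(3)] wpartial_scale[OF assms(2,3), of "-1"]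
  by (simp, eventually_elim) simp

lemma grad_inner_add_left:
  assumes "u \<in> H1 \<Omega>" "v \<in> H1 \<Omega>" "\<eta> \<in> H1 \<Omega>"
  shows "grad_inner \<Omega> (\<lambda>x. u x + v x) \<eta> = grad_inner \<Omega> u \<eta> + grad_inner \<Omega> v \<eta>"
proof -
  have "L2_inner M (wpartial \<Omega> b (\<lambda>x. u x + v x)) (wpartial \<Omega> b \<eta>)
      = L2_inner M (wpartial \<Omega> b u) (wpartial \<Omega> b \<eta>) + L2_inner M (wpartial \<Omega> b v) (wpartial \<Omega> b \<eta>)"
    if b: "b \<in> Basis" for b
  proof -
    have "L2_inner M (wpartial \<Omega> b (\<lambda>x. u x + v x)) (wpartial \<Omega> b \<eta>)
       = L2_inner M (\<lambda>x. wpartial \<Omega> b u x + wpartial \<Omega> b v x) (wpartial \<Omega> b \<eta>)"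
      using wpartial_add[OF assms(1,2) b] wpartial(1)[OF assms(1) b] wpartial(1)[OF assms(2) b]
        wpartial(1)[OF assms(3) b] wpartial(1)[OF H1_add[OF assms(1,2)] b]
      by (intro L2_inner_cong_AE L2_measurable) (auto intro: L2_add)
    also have "\<dots> = L2_inner M (wpartial \<Omega> b u) (wpartial \<Omega> b \<eta>) + L2_inner M (wpartial \<Omega> b v) (wpartial \<Omega> b \<eta>)"
      by (intro L2_inner_add_left wpartial assms b)
    finally show ?thesis .
  qed
  then show ?thesis by (simp add: grad_inner_def sum.distrib)
qed

lemma grad_inner_scale_left:
  assumes "u \<in> H1 \<Omega>" "\<eta> \<in> H1 \<Omega>"
  shows "grad_inner \<Omega> (\<lambda>x. c * u x) \<eta> = c * grad_inner \<Omega> u \<eta>"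
proof -
  have "L2_inner M (wpartial \<Omega> b (\<lambda>x. c * u x)) (wpartial \<Omega> b \<eta>) = c * L2_inner M (wpartial \<Omega> b u) (wpartial \<Omega> b \<eta>)"
    if b: "b \<in> Basis" for b
    unfolding L2_inner_scale_left[symmetric]
    using wpartial_scale[OF assms(1) b, of c] wpartial(1)[OF assms(1) b]
      wpartial(1)[OF assms(2) b] wpartial(1)[OF H1_scale[OF assms(1)] b]
    by (intro L2_inner_cong_AE L2_measurable) (auto intro: L2_scale)
  then show ?thesis by (simp add: grad_inner_def sum_distrib_left)
qed

lemma grad_inner_commute: "grad_inner \<Omega> v u = cnj (grad_inner \<Omega> u v)"
  unfolding grad_inner_def by (subst L2_inner_commute) simp

lemma grad_inner_add_right:
  assumes "u \<in> H1 \<Omega>" "v \<in> H1 \<Omega>" "\<eta> \<in> H1 \<Omega>"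
  shows "grad_inner \<Omega> \<eta> (\<lambda>x. u x + v x) = grad_inner \<Omega> \<eta> u + grad_inner \<Omega> \<eta> v"
  by (subst (1 2 3) grad_inner_commute) (simp add: grad_inner_add_left assms)

lemma grad_inner_scale_right:
  assumes "u \<in> H1 \<Omega>" "\<eta> \<in> H1 \<Omega>"
  shows "grad_inner \<Omega> \<eta> (\<lambda>x. c * u x) = cnj c * grad_inner \<Omega> \<eta> u"
  by (subst (1 2) grad_inner_commute) (simp add: grad_inner_scale_left assms)

lemma H1_norm_nonneg [simp]: "0 \<le> H1_norm \<Omega> u"
  unfolding H1_norm_def by (auto intro!: add_nonneg_nonneg sum_nonneg)

lemma H1_norm_sq: "(H1_norm \<Omega> u)\<^sup>2 = (L2_norm M u)\<^sup>2 + (\<Sum>b\<in>Basis. (L2_norm M (wpartial \<Omega> b u))\<^sup>2)"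
  unfolding H1_norm_def by (auto intro!: add_nonneg_nonneg sum_nonneg)

lemma grad_inner_self: "grad_inner \<Omega> u u = complex_of_real ((H1_norm \<Omega> u)\<^sup>2 - (L2_norm M u)\<^sup>2)"
  unfolding H1_norm_sq grad_inner_def by (simp add: L2_inner_self)

lemma L2_norm_le_H1_norm: "L2_norm M u \<le> H1_norm \<Omega> u"
proof (rule power2_le_imp_le)
  show "(L2_norm M u)\<^sup>2 \<le> (H1_norm \<Omega> u)\<^sup>2" unfolding H1_norm_sq by (auto intro!: sum_nonneg)
qed simp

lemma wpartial_le_H1_norm: "b \<in> Basis \<Longrightarrow> L2_norm M (wpartial \<Omega> b u) \<le> H1_norm \<Omega> u"
proof (rule power2_le_imp_le)
  assume b: "b \<in> Basis"
  have "(L2_norm M (wpartial \<Omega> b u))\<^sup>2 \<le> (\<Sum>b\<in>Basis. (L2_norm M (wpartial \<Omega> b u))\<^sup>2)"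
    by (rule member_le_sum[OF b]) auto
  then show "(L2_norm M (wpartial \<Omega> b u))\<^sup>2 \<le> (H1_norm \<Omega> u)\<^sup>2"
    unfolding H1_norm_sq using zero_le_power2[of "L2_norm M u"] by linarith
qed simp

lemma grad_inner_bound:
  assumes "u \<in> H1 \<Omega>" "v \<in> H1 \<Omega>"
  shows "cmod (grad_inner \<Omega> u v) \<le> real DIM('a) * (H1_norm \<Omega> u * H1_norm \<Omega> v)"
proof -
  have "cmod (grad_inner \<Omega> u v) \<le> (\<Sum>b\<in>(Basis::'a set). H1_norm \<Omega> u * H1_norm \<Omega> v)"
    unfolding grad_inner_def
  proof (rule sum_norm_le)
    fix b :: 'a assume b: "b \<in> Basis"
    show "cmod (L2_inner M (wpartial \<Omega> b u) (wpartial \<Omega> b v)) \<le> H1_norm \<Omega> u * H1_norm \<Omega> v"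
      by (rule order_trans[OF L2_Cauchy_Schwarz])
        (auto intro!: mult_mono wpartial_le_H1_norm wpartial assms b)
  qed
  then show ?thesis by simp
qed

lemma H1_norm_cong_AE:
  assumes "u \<in> H1 \<Omega>" "v \<in> H1 \<Omega>" "AE x in M. u x = v x"
  shows "H1_norm \<Omega> u = H1_norm \<Omega> v"
proof -
  have "L2_norm M u = L2_norm M v"
    using assms(3) by (rule L2_norm_cong_AE[OF L2_measurable[OF H1_L2[OF assms(1)]] L2_measurable[OF H1_L2[OF assms(2)]]])
  moreover have "L2_norm M (wpartial \<Omega> b u) = L2_norm M (wpartial \<Omega> b v)" if "b \<in> Basis" for b
    using wpartial_cong_AE[OF assms that] L2_measurable[OF wpartial(1)[OF assms(1) that]]
      L2_measurable[OF wpartial(1)[OF assms(2) that]]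
    by (intro L2_norm_cong_AE[symmetric])
  ultimately show ?thesis by (simp add: H1_norm_def)
qed

text \<open>The functions and their weak derivatives converge in \<open>L2\<close>, and the limits of the latter are weak derivatives
  of the limit of the former.\<close>

lemma H1_limit:
  assumes u: "\<And>n. u n \<in> H1 \<Omega>"
    and cauchy: "\<And>e. e > 0 \<Longrightarrow> \<exists>N. \<forall>m\<ge>N. \<forall>n\<ge>N. H1_norm \<Omega> (\<lambda>x. u m x - u n x) \<le> e"
  obtains v where "v \<in> H1 \<Omega>" "(\<lambda>n. H1_norm \<Omega> (\<lambda>x. u n x - v x)) \<longlonglongrightarrow> 0"
proof -
  have dn: "L2_norm M (\<lambda>x. wpartial \<Omega> b (u m) x - wpartial \<Omega> b (u n) x) = L2_norm M (wpartial \<Omega> b (\<lambda>x. u m x - u n x))"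
    if "b \<in> Basis" for b m n
    using wpartial_diff[OF u[of m] u[of n] that]
      wpartial(1)[OF u[of m] that] wpartial(1)[OF u[of n] that] wpartial(1)[OF H1_diff[OF u[of m] u[of n]] that]
    by (intro L2_norm_cong_AE[symmetric] L2_measurable) (auto intro: L2_diff)
  obtain v where v: "v \<in> L2 M" "(\<lambda>n. L2_norm M (\<lambda>x. u n x - v x)) \<longlonglongrightarrow> 0"
  proof (rule L2_complete[of u M])
    show "u n \<in> L2 M" for n by (intro H1_L2 u)
    fix e :: real assume "e > 0"
    from cauchy[OF this] show "\<exists>N. \<forall>m\<ge>N. \<forall>n\<ge>N. L2_norm M (\<lambda>x. u m x - u n x) \<le> e"
      by (meson L2_norm_le_H1_norm order_trans)
  qed (use that in blast)
  have "\<exists>g. g \<in> L2 M \<and> (\<lambda>n. L2_norm M (\<lambda>x. wpartial \<Omega> b (u n) x - g x)) \<longlonglongrightarrow> 0" if b: "b \<in> Basis" for b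
  proof (rule L2_complete[of "\<lambda>n. wpartial \<Omega> b (u n)" M])
    show "wpartial \<Omega> b (u n) \<in> L2 M" for n by (intro wpartial u b)
    fix e :: real assume "e > 0"
    from cauchy[OF this]
    show "\<exists>N. \<forall>m\<ge>N. \<forall>n\<ge>N. L2_norm M (\<lambda>x. wpartial \<Omega> b (u m) x - wpartial \<Omega> b (u n) x) \<le> e"
      unfolding dn[OF b] by (meson wpartial_le_H1_norm[OF b] order_trans)
  qed blast
  then have "\<forall>b\<in>Basis. \<exists>g. g \<in> L2 M \<and> (\<lambda>n. L2_norm M (\<lambda>x. wpartial \<Omega> b (u n) x - g x)) \<longlonglongrightarrow> 0"
    by blast
  from bchoice[OF this] obtain g where g: "\<And>b. b \<in> Basis \<Longrightarrow> g b \<in> L2 M"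
    "\<And>b. b \<in> Basis \<Longrightarrow> (\<lambda>n. L2_norm M (\<lambda>x. wpartial \<Omega> b (u n) x - g b x)) \<longlonglongrightarrow> 0" by blast
  have wg: "weak_partial \<Omega> b v (g b)" if b: "b \<in> Basis" for b
    by (rule weak_partial_closed[OF H1_L2[OF u] wpartial(1)[OF u b] wpartial(2)[OF u b] v(1) v(2) g(1)[OF b] g(2)[OF b]])
  have v1: "v \<in> H1 \<Omega>" by (rule H1_I[OF v(1) g(1) wg])
  have eq: "L2_norm M (wpartial \<Omega> b (\<lambda>x. u n x - v x)) = L2_norm M (\<lambda>x. wpartial \<Omega> b (u n) x - g b x)"
    if b: "b \<in> Basis" for b n
  proof (rule L2_norm_cong_AE)
    show "AE x in M. wpartial \<Omega> b (\<lambda>x. u n x - v x) x = wpartial \<Omega> b (u n) x - g b x"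
      using wpartial_diff[OF u[of n] v1 b] wpartial_eqI[OF v1 b g(1)[OF b] wg[OF b]]
      by eventually_elim simp
    show "wpartial \<Omega> b (\<lambda>x. u n x - v x) \<in> borel_measurable M"
      by (rule L2_measurable[OF wpartial(1)[OF H1_diff[OF u v1] b]])
    show "(\<lambda>x. wpartial \<Omega> b (u n) x - g b x) \<in> borel_measurable M"
      by (rule L2_measurable[OF L2_diff[OF wpartial(1)[OF u b] g(1)[OF b]]])
  qed
  have "(\<lambda>n. sqrt ((L2_norm M (\<lambda>x. u n x - v x))\<^sup>2
          + (\<Sum>b\<in>Basis. (L2_norm M (\<lambda>x. wpartial \<Omega> b (u n) x - g b x))\<^sup>2)))
      \<longlonglongrightarrow> sqrt (0\<^sup>2 + (\<Sum>b\<in>(Basis::'a set). 0\<^sup>2))"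
    by (intro tendsto_intros v g)
  then have "(\<lambda>n. H1_norm \<Omega> (\<lambda>x. u n x - v x)) \<longlonglongrightarrow> 0"
    by (simp add: H1_norm_def eq)
  with v1 show ?thesis by (rule that)
qed

end

section \<open>The kernel on the imaginary axis\<close>

lemma Re_resolvent_kernel: "Re (1 / (\<i> * complex_of_real s + complex_of_real \<tau>)) = \<tau> / (s\<^sup>2 + \<tau>\<^sup>2)"
  by (simp add: Re_divide power2_eq_square add.commute)

lemma norm_resolvent_kernel_le:
  assumes "\<tau> > 0" shows "cmod (1 / (\<i> * complex_of_real s + complex_of_real \<tau>)) \<le> 1 / \<tau>"
proof -
  have "\<tau> \<le> cmod (\<i> * complex_of_real s + complex_of_real \<tau>)"
    using complex_Re_le_cmod[of "\<i> * complex_of_real s + complex_of_real \<tau>"] by simp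
  then show ?thesis using assms by (simp add: norm_divide frac_le)
qed

context
  fixes k :: "real \<Rightarrow> real" and \<nu> :: "real measure"
  assumes kernel: "integrable_cm_kernel k \<nu>"
begin

lemma kernel_sets [measurable_cong]: "sets \<nu> = sets borel"
  using kernel by (simp add: integrable_cm_kernel_def radon_measure_halfline_def)

lemma kernel_sigma_finite: "sigma_finite_measure \<nu>"
proof
  have "emeasure \<nu> (cbox (- real n) (real n)) < \<infinity>" for n
    using kernel by (auto simp: integrable_cm_kernel_def radon_measure_halfline_def)
  moreover have "(\<Union>n. cbox (- real n) (real n)) = UNIV"
  proof -
    have "\<exists>n. x \<in> cbox (- real n) (real n)" for x
      using real_arch_simple[of "\<bar>x\<bar>"] by (auto simp: abs_le_iff minus_le_iff)
    then show ?thesis by auto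
  qed
  moreover have "space \<nu> = UNIV" using sets_eq_imp_space_eq[OF kernel_sets] by simp
  ultimately show "\<exists>A. countable A \<and> A \<subseteq> sets \<nu> \<and> \<Union> A = space \<nu> \<and> (\<forall>a\<in>A. emeasure \<nu> a \<noteq> \<infinity>)"
    by (intro exI[of _ "range (\<lambda>n. cbox (- real n) (real n))"]) (auto simp: kernel_sets less_top)
qed

text \<open>By Tonelli's theorem this is the integral of the kernel.\<close>

lemma kernel_double_integral_finite:
  "(\<integral>\<^sup>+ \<tau>. (\<integral>\<^sup>+ t. ennreal (indicator {0<..} t * exp (- \<tau> * t)) \<partial>lborel) \<partial>\<nu>) < \<infinity>"
proof -
  interpret sigma_finite_measure \<nu> by (rule kernel_sigma_finite)
  interpret pair_sigma_finite lborel \<nu> ..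
  have hb: "has_bochner_integral \<nu> (\<lambda>\<tau>. exp (- \<tau> * t)) (k t)" if "t > 0" for t
    using kernel that by (auto simp: integrable_cm_kernel_def)
  have "(\<integral>\<^sup>+ \<tau>. (\<integral>\<^sup>+ t. ennreal (indicator {0<..} t * exp (- \<tau> * t)) \<partial>lborel) \<partial>\<nu>)
     = (\<integral>\<^sup>+ t. (\<integral>\<^sup>+ \<tau>. ennreal (indicator {0<..} t * exp (- \<tau> * t)) \<partial>\<nu>) \<partial>lborel)"
    by (rule Fubini') measurable
  also have "\<dots> = (\<integral>\<^sup>+ t. ennreal (norm (indicator {0<..} t *\<^sub>R k t)) \<partial>lborel)"
  proof (intro nn_integral_cong)
    fix t :: real
    show "(\<integral>\<^sup>+ \<tau>. ennreal (indicator {0<..} t * exp (- \<tau> * t)) \<partial>\<nu>) = ennreal (norm (indicator {0<..} t *\<^sub>R k t))"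
    proof (cases "t > 0")
      case True
      have "k t = (\<integral>\<tau>. exp (- \<tau> * t) \<partial>\<nu>)"
        using hb[OF True] by (simp add: has_bochner_integral_iff)
      then have "0 \<le> k t" by (simp add: integral_nonneg_AE)
      moreover have "(\<integral>\<^sup>+ \<tau>. ennreal (exp (- \<tau> * t)) \<partial>\<nu>) = ennreal (k t)"
        using hb[OF True] by (simp add: has_bochner_integral_iff nn_integral_eq_integral)
      ultimately show ?thesis using True by simp
    qed simp
  qed
  also have "\<dots> < \<infinity>"
    using kernel unfolding integrable_cm_kernel_def set_integrable_def integrable_iff_bounded by blast
  finally show ?thesis .
qed

text \<open>For \<open>0 < t \<le> 1/\<tau>\<close> the exponential is at least \<open>exp (-1)\<close>; for \<open>\<tau> = 0\<close> this holds on every bounded interval,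
  which makes the integral infinite. So finiteness of the double integral forces \<open>\<nu> {0} = 0\<close> and the
  integrability of \<open>1/\<tau>\<close>.\<close>

lemma kernel_inverse_bound:
  assumes "0 \<le> \<tau>"
  shows "ennreal (exp (-1)) * (if \<tau> = 0 then \<infinity> else ennreal (1 / \<tau>))
      \<le> (\<integral>\<^sup>+ t. ennreal (indicator {0<..} t * exp (- \<tau> * t)) \<partial>lborel)"
proof -
  \<comment> \<open>A common bound for both cases: any \<open>B\<close> with \<open>\<tau> B \<le> 1\<close> is admissible as length of the interval.\<close>
  have low: "ennreal (exp (-1)) * ennreal B \<le> (\<integral>\<^sup>+ t. ennreal (indicator {0<..} t * exp (- \<tau> * t)) \<partial>lborel)"
    if B: "0 \<le> B" "\<tau> * B \<le> 1" for B
  proof -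
    have "ennreal (exp (-1)) * ennreal B = (\<integral>\<^sup>+ t. ennreal (exp (-1)) * indicator {0<..B} t \<partial>lborel)"
      using B by (simp add: nn_integral_cmult_indicator)
    also have "\<dots> \<le> (\<integral>\<^sup>+ t. ennreal (indicator {0<..} t * exp (- \<tau> * t)) \<partial>lborel)"
    proof (intro nn_integral_mono)
      fix t :: real
      have "\<tau> * t \<le> 1" if "t \<le> B" using mult_left_mono[OF that assms] B by linarith
      then show "ennreal (exp (-1)) * indicator {0<..B} t \<le> ennreal (indicator {0<..} t * exp (- \<tau> * t))"
        by (auto simp: indicator_def intro!: ennreal_leI)
    qed
    finally show ?thesis .
  qed
  show ?thesis
  proof (cases "\<tau> = 0")
    case True
    have "(\<integral>\<^sup>+ t. ennreal (indicator {0<..} t * exp (- \<tau> * t)) \<partial>lborel) = \<infinity>"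
    proof (rule ccontr)
      assume "(\<integral>\<^sup>+ t. ennreal (indicator {0<..} t * exp (- \<tau> * t)) \<partial>lborel) \<noteq> \<infinity>"
      then obtain r where r: "(\<integral>\<^sup>+ t. ennreal (indicator {0<..} t * exp (- \<tau> * t)) \<partial>lborel) = ennreal r" "0 \<le> r"
        by (cases "\<integral>\<^sup>+ t. ennreal (indicator {0<..} t * exp (- \<tau> * t)) \<partial>lborel") auto
      have "ennreal (exp (-1)) * ennreal ((r + 1) * exp 1) \<le> ennreal r"
        using low[of "(r + 1) * exp 1"] True r by simp
      then have "exp (-1) * ((r + 1) * exp 1) \<le> r"
        using r(2) by (simp add: ennreal_mult[symmetric])
      then show False by (simp add: exp_minus field_simps)
    qed
    then show ?thesis by simp
  next
    case False
    then show ?thesis using low[of "1 / \<tau>"] assms by simp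
  qed
qed

lemma kernel_AE_pos: "AE \<tau> in \<nu>. 0 < \<tau>"
  and kernel_nn_integral_inverse: "(\<integral>\<^sup>+ \<tau>. ennreal (1 / \<tau>) \<partial>\<nu>) < \<infinity>"
proof -
  let ?g = "\<lambda>\<tau>. \<integral>\<^sup>+ t. ennreal (indicator {0<..} t * exp (- \<tau> * t)) \<partial>lborel"
  interpret sigma_finite_measure \<nu> by (rule kernel_sigma_finite)
  have m [measurable]: "?g \<in> borel_measurable \<nu>"
    by (rule sigma_finite_measure.borel_measurable_nn_integral[OF sigma_finite_lborel]) measurable
  have "{..<0} \<in> null_sets \<nu>"
    using kernel by (auto simp: null_sets_def kernel_sets integrable_cm_kernel_def radon_measure_halfline_def)
  then have "AE \<tau> in \<nu>. \<tau> \<notin> {..<0}" by (rule AE_not_in)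
  moreover have fin: "AE \<tau> in \<nu>. ?g \<tau> \<noteq> \<infinity>"
    using kernel_double_integral_finite by (intro nn_integral_PInf_AE m) auto
  ultimately show pos: "AE \<tau> in \<nu>. 0 < \<tau>"
  proof eventually_elim
    case (elim \<tau>)
    have "\<tau> \<noteq> 0"
    proof
      assume "\<tau> = 0"
      then have "ennreal (exp (-1)) * \<infinity> \<le> ?g \<tau>" using kernel_inverse_bound[of \<tau>] by simp
      then have "?g \<tau> = \<infinity>" by (simp add: ennreal_mult_top top_unique)
      with elim(2) show False by simp
    qed
    with elim(1) show ?case by auto
  qed
  have "(\<lambda>\<tau>. ennreal (1 / \<tau>)) \<in> borel_measurable \<nu>" by measurable
  then have "ennreal (exp (-1)) * (\<integral>\<^sup>+ \<tau>. ennreal (1 / \<tau>) \<partial>\<nu>) = (\<integral>\<^sup>+ \<tau>. ennreal (exp (-1)) * ennreal (1 / \<tau>) \<partial>\<nu>)"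
    by (rule nn_integral_cmult[symmetric])
  also have "\<dots> \<le> (\<integral>\<^sup>+ \<tau>. ?g \<tau> \<partial>\<nu>)"
  proof (rule nn_integral_mono_AE)
    show "AE \<tau> in \<nu>. ennreal (exp (-1)) * ennreal (1 / \<tau>) \<le> ?g \<tau>"
      using pos
    proof eventually_elim
      case (elim \<tau>)
      then show ?case using kernel_inverse_bound[of \<tau>] by simp
    qed
  qed
  also have "\<dots> < \<infinity>" by (rule kernel_double_integral_finite)
  finally show "(\<integral>\<^sup>+ \<tau>. ennreal (1 / \<tau>) \<partial>\<nu>) < \<infinity>"
    by (auto simp: ennreal_mult_less_top)
qed

lemma kernel_integrable_inverse: "integrable \<nu> (\<lambda>\<tau>. 1 / \<tau>)"
proof -
  have "(\<integral>\<^sup>+ \<tau>. ennreal (norm (1 / \<tau>)) \<partial>\<nu>) = (\<integral>\<^sup>+ \<tau>. ennreal (1 / \<tau>) \<partial>\<nu>)"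
  proof (rule nn_integral_cong_AE)
    show "AE \<tau> in \<nu>. ennreal (norm (1 / \<tau>)) = ennreal (1 / \<tau>)"
      using kernel_AE_pos by eventually_elim simp
  qed
  then show ?thesis using kernel_nn_integral_inverse
    by (subst integrable_iff_bounded) (auto simp del: norm_divide intro!: borel_measurable_divide)
qed

lemma khat_integrable: "integrable \<nu> (\<lambda>\<tau>. 1 / (\<i> * complex_of_real s + complex_of_real \<tau>))"
proof (rule Bochner_Integration.integrable_bound[OF kernel_integrable_inverse])
  have "(\<lambda>\<tau>. 1 / (\<i> * complex_of_real s + complex_of_real \<tau>)) \<in> borel_measurable borel" by measurable
  then show "(\<lambda>\<tau>. 1 / (\<i> * complex_of_real s + complex_of_real \<tau>)) \<in> borel_measurable \<nu>"
    by (simp cong: measurable_cong_sets add: measurable_cong_sets[OF kernel_sets refl])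
  show "AE \<tau> in \<nu>. norm (1 / (\<i> * complex_of_real s + complex_of_real \<tau>)) \<le> norm (1 / \<tau>)"
    using kernel_AE_pos by eventually_elim (use norm_resolvent_kernel_le in auto)
qed

lemma khat_bound: "cmod (khat \<nu> (\<i> * complex_of_real s)) \<le> (\<integral>\<tau>. 1 / \<tau> \<partial>\<nu>)"
proof -
  have "cmod (khat \<nu> (\<i> * complex_of_real s)) \<le> (\<integral>\<tau>. cmod (1 / (\<i> * complex_of_real s + complex_of_real \<tau>)) \<partial>\<nu>)"
    unfolding khat_def by (rule integral_norm_bound)
  also have "\<dots> \<le> (\<integral>\<tau>. 1 / \<tau> \<partial>\<nu>)"
  proof (rule integral_mono_AE[OF integrable_norm[OF khat_integrable] kernel_integrable_inverse])
    show "AE \<tau> in \<nu>. cmod (1 / (\<i> * complex_of_real s + complex_of_real \<tau>)) \<le> 1 / \<tau>"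
      using kernel_AE_pos by eventually_elim (rule norm_resolvent_kernel_le)
  qed
  finally show ?thesis .
qed

text \<open>The integrand \<open>\<tau> / (s\<^sup>2 + \<tau>\<^sup>2)\<close> is positive almost everywhere. Were its integral zero, \<open>\<nu>\<close> would vanish and
  with it the kernel.\<close>

lemma Re_khat_pos: "0 < Re (khat \<nu> (\<i> * complex_of_real s))"
proof -
  have int: "integrable \<nu> (\<lambda>\<tau>. \<tau> / (s\<^sup>2 + \<tau>\<^sup>2))"
    using integrable_Re[OF khat_integrable[of s]] unfolding Re_resolvent_kernel .
  have eq: "Re (khat \<nu> (\<i> * complex_of_real s)) = (\<integral>\<tau>. \<tau> / (s\<^sup>2 + \<tau>\<^sup>2) \<partial>\<nu>)"
    unfolding khat_def integral_Re[OF khat_integrable, symmetric] Re_resolvent_kernel ..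
  have pos: "AE \<tau> in \<nu>. 0 < \<tau> / (s\<^sup>2 + \<tau>\<^sup>2)"
    using kernel_AE_pos by eventually_elim (simp add: add_nonneg_pos)
  then have nn: "AE \<tau> in \<nu>. 0 \<le> \<tau> / (s\<^sup>2 + \<tau>\<^sup>2)" by eventually_elim simp
  have "(\<integral>\<tau>. \<tau> / (s\<^sup>2 + \<tau>\<^sup>2) \<partial>\<nu>) \<noteq> 0"
  proof
    assume "(\<integral>\<tau>. \<tau> / (s\<^sup>2 + \<tau>\<^sup>2) \<partial>\<nu>) = 0"
    then have "AE \<tau> in \<nu>. \<tau> / (s\<^sup>2 + \<tau>\<^sup>2) = 0"
      using integral_nonneg_eq_0_iff_AE[OF int nn] by simp
    with pos have F: "AE \<tau> in \<nu>. False" by eventually_elim simp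
    obtain t where t: "t > 0" "k t \<noteq> 0" using kernel by (auto simp: integrable_cm_kernel_def)
    then have "has_bochner_integral \<nu> (\<lambda>\<tau>. exp (- \<tau> * t)) (k t)"
      using kernel by (auto simp: integrable_cm_kernel_def)
    then have "k t = (\<integral>\<tau>. exp (- \<tau> * t) \<partial>\<nu>)" by (simp add: has_bochner_integral_iff)
    also have "\<dots> = 0" by (rule integral_eq_zero_AE) (use F in eventually_elim, simp)
    finally show False using t by simp
  qed
  moreover have "0 \<le> (\<integral>\<tau>. \<tau> / (s\<^sup>2 + \<tau>\<^sup>2) \<partial>\<nu>)" by (rule integral_nonneg_AE[OF nn])
  ultimately show ?thesis unfolding eq by simp
qed

end

section \<open>Sums over spectral clusters\<close>

lemma harm_upper: "(\<Sum>j\<le>n. 1 / (real j + 1)) \<le> 1 + ln (real n + 1)"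
proof -
  have "harm (Suc n) - ln (real (Suc n)) \<le> (harm (Suc 0) - ln (real (Suc 0)) :: real)"
    using decseqD[OF decseq_harm_diff_ln, of 0 n] by simp
  moreover have "(harm (Suc n) :: real) = (\<Sum>j\<le>n. 1 / (real j + 1))"
    unfolding harm_def
    by (rule sum.reindex_bij_witness[of _ Suc "\<lambda>i. i - 1"]) (auto simp: field_simps)
  ultimately show ?thesis by (simp add: harm_def add.commute)
qed

lemma sum_Un_le:
  fixes f :: "'b \<Rightarrow> real"
  assumes "finite A" "finite B" "\<And>x. x \<in> A \<inter> B \<Longrightarrow> 0 \<le> f x"
  shows "sum f (A \<union> B) \<le> sum f A + sum f B"
proof -
  have "0 \<le> sum f (A \<inter> B)" by (rule sum_nonneg) (rule assms(3))
  then show ?thesis using sum.union_inter[OF assms(1,2), of f] by linarith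
qed

text \<open>Two harmonic sums, one on each side of \<open>M\<close>. They are the source of the logarithm in \<open>L(s)\<close>.\<close>

lemma near_bins_sum:
  assumes "M \<ge> (1::nat)"
  shows "(\<Sum>m\<le>2*M. 1 / (\<bar>real m - real M\<bar> + 1)) \<le> 4 * (1 + ln (real M))"
proof -
  have "(\<Sum>m\<le>2*M. 1 / (\<bar>real m - real M\<bar> + 1))
      \<le> (\<Sum>m\<in>{..M} \<union> {M..2*M}. 1 / (\<bar>real m - real M\<bar> + 1))"
    by (intro sum_mono2) auto
  also have "\<dots> \<le> (\<Sum>m\<le>M. 1 / (\<bar>real m - real M\<bar> + 1)) + (\<Sum>m=M..2*M. 1 / (\<bar>real m - real M\<bar> + 1))"
    by (intro sum_Un_le) auto
  also have "(\<Sum>m\<le>M. 1 / (\<bar>real m - real M\<bar> + 1)) = (\<Sum>j\<le>M. 1 / (real j + 1))"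
    by (rule sum.reindex_bij_witness[of _ "\<lambda>j. M - j" "\<lambda>m. M - m"]) auto
  also have "(\<Sum>m=M..2*M. 1 / (\<bar>real m - real M\<bar> + 1)) = (\<Sum>j\<le>M. 1 / (real j + 1))"
    by (rule sum.reindex_bij_witness[of _ "\<lambda>j. M + j" "\<lambda>m. m - M"]) auto
  also have "(\<Sum>j\<le>M. 1 / (real j + 1)) + (\<Sum>j\<le>M. 1 / (real j + 1)) \<le> 2 * (1 + ln (real M + 1))"
    using harm_upper[of M] by simp
  also have "ln (real M + 1) \<le> ln (2 * real M)" using assms by (subst ln_le_cancel_iff) auto
  also have "ln (2 * real M) = ln 2 + ln (real M)" using assms by (simp add: ln_mult)
  also have "ln 2 \<le> (1::real)" using ln_2_less_1 by simp
  finally have "(\<Sum>m\<le>2*M. 1 / (\<bar>real m - real M\<bar> + 1)) \<le> 2 * (1 + (1 + ln (real M)))" by simp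
  moreover have "0 \<le> ln (real M)" using assms by simp
  ultimately show ?thesis by simp
qed

text \<open>The mean value theorem for \<open>x\<^bsup>\<alpha>-1\<^esup>\<close>; it bounds the tail of \<open>\<Sum> m\<^bsup>\<alpha>-2\<^esup>\<close> by a telescoping sum.\<close>

lemma powr_telescope:
  fixes x \<alpha> :: real
  assumes "x > 1" "\<alpha> < 1"
  shows "(1 - \<alpha>) * x powr (\<alpha> - 2) \<le> (x - 1) powr (\<alpha> - 1) - x powr (\<alpha> - 1)"
proof -
  have "\<exists>z. x - 1 < z \<and> z < x \<and> x powr (\<alpha> - 1) - (x - 1) powr (\<alpha> - 1) = (x - (x - 1)) * ((\<alpha> - 1) * z powr (\<alpha> - 1 - 1))"
    using assms by (intro MVT2) (auto intro!: derivative_eq_intros)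
  then obtain z where z: "x - 1 < z" "z < x"
    "x powr (\<alpha> - 1) - (x - 1) powr (\<alpha> - 1) = (\<alpha> - 1) * z powr (\<alpha> - 2)" by auto
  have "x powr (\<alpha> - 2) \<le> z powr (\<alpha> - 2)" using z assms by (intro powr_mono2') auto
  then have "(1 - \<alpha>) * x powr (\<alpha> - 2) \<le> (1 - \<alpha>) * z powr (\<alpha> - 2)" using assms by (intro mult_left_mono) auto
  then show ?thesis using z(3) by (simp add: algebra_simps)
qed

lemma far_bins_sum:
  fixes \<alpha> :: real
  assumes "M \<ge> (1::nat)" "\<alpha> < 1"
  shows "(\<Sum>m\<in>{M<..M+n}. real m powr (\<alpha> - 2)) \<le> real M powr (\<alpha> - 1) / (1 - \<alpha>)"
proof -
  have "(1 - \<alpha>) * (\<Sum>m\<in>{M<..M+n}. real m powr (\<alpha> - 2)) \<le> real M powr (\<alpha> - 1) - real (M + n) powr (\<alpha> - 1)"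
  proof (induction n)
    case (Suc n)
    have "{M<..M + Suc n} = insert (Suc (M + n)) {M<..M+n}" by auto
    then have "(1 - \<alpha>) * (\<Sum>m\<in>{M<..M+Suc n}. real m powr (\<alpha> - 2))
        = (1 - \<alpha>) * (\<Sum>m\<in>{M<..M+n}. real m powr (\<alpha> - 2)) + (1 - \<alpha>) * real (Suc (M + n)) powr (\<alpha> - 2)"
      by (simp add: distrib_left add.commute)
    moreover have "(1 - \<alpha>) * real (Suc (M + n)) powr (\<alpha> - 2)
        \<le> (real (Suc (M + n)) - 1) powr (\<alpha> - 1) - real (Suc (M + n)) powr (\<alpha> - 1)"
      using assms by (intro powr_telescope) auto
    moreover have "real (Suc (M + n)) - 1 = real (M + n)" "M + Suc n = Suc (M + n)" by auto
    ultimately show ?case using Suc by simp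
  qed simp
  also have "\<dots> \<le> real M powr (\<alpha> - 1)" by simp
  finally show ?thesis using assms by (simp add: pos_le_divide_eq mult.commute)
qed

text \<open>Here \<open>m\<close> and \<open>M\<close> number the frequency intervals of length \<open>\<delta>\<close> that contain a mode and \<open>s\<close>. Up to \<open>m = 2M\<close> the
  factors \<open>(1 + m)\<^bsup>\<alpha>\<^esup>\<close> and \<open>m + M + 1\<close> are comparable to \<open>M\<^bsup>\<alpha>\<^esup>\<close> and \<open>M\<close>, which leaves a harmonic sum; beyond, the
  terms decay like \<open>m\<^bsup>\<alpha>-2\<^esup>\<close> and are summable because \<open>\<alpha> < 1\<close>.\<close>

lemma bin_sum:
  fixes \<alpha> :: real
  assumes M: "M \<ge> (1::nat)" and \<alpha>: "0 \<le> \<alpha>" "\<alpha> < 1" and S: "finite S"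
  shows "(\<Sum>m\<in>S. (1 + real m) powr \<alpha> / ((\<bar>real m - real M\<bar> + 1) * (real m + real M + 1)))
    \<le> (12 + 4 / (1 - \<alpha>)) * (real M powr (\<alpha> - 1) * (1 + ln (real M)))"
proof -
  let ?a = "\<lambda>m. (1 + real m) powr \<alpha> / ((\<bar>real m - real M\<bar> + 1) * (real m + real M + 1))"
  have a0: "0 \<le> ?a m" for m by (intro divide_nonneg_nonneg mult_nonneg_nonneg) auto
  obtain n where n: "\<And>m. m \<in> S \<Longrightarrow> m \<le> n" using S unfolding finite_nat_set_iff_bounded_le by auto
  have near: "?a m \<le> 3 * real M powr (\<alpha> - 1) * (1 / (\<bar>real m - real M\<bar> + 1))" if "m \<le> 2 * M" for m
  proof -
    have "(1 + real m) powr \<alpha> \<le> (3 * real M) powr \<alpha>" using that M \<alpha> by (intro powr_mono2) auto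
    also have "\<dots> = 3 powr \<alpha> * real M powr \<alpha>" by (simp add: powr_mult)
    also have "\<dots> \<le> 3 powr 1 * real M powr \<alpha>" using \<alpha> by (intro mult_right_mono powr_mono) auto
    also have "real M powr \<alpha> = real M powr (\<alpha> - 1) * real M" using M by (simp add: powr_diff)
    also have "3 powr 1 * (real M powr (\<alpha> - 1) * real M) \<le> 3 powr 1 * (real M powr (\<alpha> - 1) * (real m + real M + 1))"
      by (intro mult_left_mono) auto
    finally have "(1 + real m) powr \<alpha> \<le> 3 * real M powr (\<alpha> - 1) * (real m + real M + 1)" by simp
    then have "?a m \<le> 3 * real M powr (\<alpha> - 1) * (real m + real M + 1) / ((\<bar>real m - real M\<bar> + 1) * (real m + real M + 1))"
      by (intro divide_right_mono mult_nonneg_nonneg) auto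
    also have "\<dots> = 3 * real M powr (\<alpha> - 1) * (1 / (\<bar>real m - real M\<bar> + 1))"
      by (simp add: add_nonneg_eq_0_iff)
    finally show ?thesis .
  qed
  have far: "?a m \<le> 4 * real m powr (\<alpha> - 2)" if "m > 2 * M" for m
  proof -
    have m: "real m \<ge> 1" using that by simp
    have "(1 + real m) powr \<alpha> \<le> (2 * real m) powr \<alpha>" using m \<alpha> by (intro powr_mono2) auto
    also have "\<dots> = 2 powr \<alpha> * real m powr \<alpha>" by (simp add: powr_mult)
    also have "\<dots> \<le> 2 powr 1 * real m powr \<alpha>" using \<alpha> by (intro mult_right_mono powr_mono) auto
    finally have 1: "(1 + real m) powr \<alpha> \<le> 2 * real m powr \<alpha>" by simp
    have 2: "real m / 2 * real m \<le> (\<bar>real m - real M\<bar> + 1) * (real m + real M + 1)"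
      using that by (intro mult_mono) auto
    have "?a m \<le> 2 * real m powr \<alpha> / (real m / 2 * real m)"
      using m by (intro frac_le 1 2) auto
    also have "\<dots> = 4 * (real m powr \<alpha> / real m ^ 2)" by (simp add: power2_eq_square)
    also have "\<dots> = 4 * real m powr (\<alpha> - 2)" using m by (simp add: powr_diff powr_numeral)
    finally show ?thesis .
  qed
  have "sum ?a S \<le> sum ?a ({..2*M} \<union> {2*M<..2*M+n})"
  proof (intro sum_mono2 a0)
    show "S \<subseteq> {..2*M} \<union> {2*M<..2*M+n}" using n by (force dest: n)
  qed auto
  also have "\<dots> \<le> sum ?a {..2*M} + sum ?a {2*M<..2*M+n}" by (intro sum_Un_le) (auto intro: a0)
  finally have split: "sum ?a S \<le> sum ?a {..2*M} + sum ?a {2*M<..2*M+n}" .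
  have "sum ?a {..2*M} \<le> 3 * real M powr (\<alpha> - 1) * (\<Sum>m\<le>2*M. 1 / (\<bar>real m - real M\<bar> + 1))"
    unfolding sum_distrib_left by (intro sum_mono near) auto
  also have "\<dots> \<le> 3 * real M powr (\<alpha> - 1) * (4 * (1 + ln (real M)))"
    by (intro mult_left_mono near_bins_sum M) auto
  finally have A: "sum ?a {..2*M} \<le> 12 * (real M powr (\<alpha> - 1) * (1 + ln (real M)))"
    by (simp only: algebra_simps)
  have "sum ?a {2*M<..2*M+n} \<le> 4 * (\<Sum>m\<in>{2*M<..2*M+n}. real m powr (\<alpha> - 2))"
    unfolding sum_distrib_left by (intro sum_mono far) auto
  also have "\<dots> \<le> 4 * (real (2*M) powr (\<alpha> - 1) / (1 - \<alpha>))"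
    using M \<alpha> by (intro mult_left_mono far_bins_sum) auto
  also have "\<dots> = 4 / (1 - \<alpha>) * real (2*M) powr (\<alpha> - 1)" by simp
  also have "\<dots> \<le> 4 / (1 - \<alpha>) * (real M powr (\<alpha> - 1) * (1 + ln (real M)))"
  proof (intro mult_left_mono)
    have "real (2*M) powr (\<alpha> - 1) \<le> real M powr (\<alpha> - 1)"
      using M \<alpha> by (intro powr_mono2') auto
    also have "\<dots> \<le> real M powr (\<alpha> - 1) * (1 + ln (real M))"
      using M by (simp add: mult_le_cancel_left1)
    finally show "real (2*M) powr (\<alpha> - 1) \<le> real M powr (\<alpha> - 1) * (1 + ln (real M))" .
  qed (use \<alpha> in auto)
  finally show ?thesis using split A by (simp only: distrib_right)
qed

lemma floor_bin_weight:
  fixes \<alpha> \<delta> s :: real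
  assumes \<delta>: "0 < \<delta>" "\<delta> \<le> 1" and \<alpha>: "0 \<le> \<alpha>" "\<alpha> < 1" and s: "s \<ge> 1"
  defines "M \<equiv> nat \<lfloor>s / \<delta>\<rfloor>"
  shows "M \<ge> 1" "real M powr (\<alpha> - 1) * (1 + ln (real M))
      \<le> 2 * (1 + ln (1 / \<delta>)) * (s powr (\<alpha> - 1) * (1 + ln s))"
proof -
  have s\<delta>: "1 \<le> s / \<delta>" using \<delta> s by simp
  then show M1: "M \<ge> 1" unfolding M_def by (simp add: le_nat_floor)
  have up: "real M \<le> s / \<delta>" unfolding M_def using s\<delta> by (simp add: of_nat_floor)
  have "s / \<delta> < real M + 1" unfolding M_def using s\<delta> by linarith
  then have "s / \<delta> \<le> 2 * real M" using M1 by linarith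
  then have low: "s / (2 * \<delta>) \<le> real M" using \<delta> by (simp add: field_simps)
  have "s / 2 \<le> s / (2 * \<delta>)" using \<delta> s by (intro frac_le) auto
  then have low': "s / 2 \<le> real M" using low by linarith
  have "real M powr (\<alpha> - 1) \<le> (s / 2) powr (\<alpha> - 1)" using low' s \<alpha> by (intro powr_mono2') auto
  also have "\<dots> = s powr (\<alpha> - 1) * 2 powr (1 - \<alpha>)" by (simp add: powr_divide powr_diff)
  also have "\<dots> \<le> s powr (\<alpha> - 1) * 2 powr 1" using \<alpha> by (intro mult_left_mono powr_mono) auto
  finally have 1: "real M powr (\<alpha> - 1) \<le> 2 * s powr (\<alpha> - 1)" by simp
  have "ln (real M) \<le> ln (s / \<delta>)" using up M1 s\<delta> by (subst ln_le_cancel_iff) auto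
  also have "\<dots> = ln s + ln (1 / \<delta>)" using s \<delta> by (simp add: ln_div)
  finally have "ln (real M) \<le> ln s + ln (1 / \<delta>)" .
  moreover have "0 \<le> ln (1 / \<delta>) * ln s" using s \<delta> by (intro mult_nonneg_nonneg) auto
  ultimately have "1 + ln (real M) \<le> (1 + ln (1 / \<delta>)) * (1 + ln s)"
    unfolding distrib_left distrib_right by linarith
  then have "real M powr (\<alpha> - 1) * (1 + ln (real M)) \<le> (2 * s powr (\<alpha> - 1)) * ((1 + ln (1 / \<delta>)) * (1 + ln s))"
    using 1 M1 by (intro mult_mono) auto
  then show "real M powr (\<alpha> - 1) * (1 + ln (real M))
      \<le> 2 * (1 + ln (1 / \<delta>)) * (s powr (\<alpha> - 1) * (1 + ln s))" by (simp only: mult_ac)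
qed

text \<open>An abstraction of the finite sum \<open>\<Sum>\<^bsub>j\<in>I\<^esub> u\<^sub>j w\<^sub>j\<close>: \<open>x j\<close> stands for \<open>\<bar>u\<^sub>j\<bar>\<^sup>2\<close>, and \<open>b J\<close> for the norm of the trace of
  the partial sum over \<open>J\<close>. The last two assumptions are the hypothesis on clusters, applied to the modes
  with frequencies in \<open>[a, a + \<delta>]\<close>; there the mean frequency is at most \<open>a + \<delta>\<close>.\<close>

locale cluster_seminorm =
  fixes lam :: "nat \<Rightarrow> real" and \<alpha> \<delta> c C :: real
    and b :: "nat set \<Rightarrow> real" and x :: "nat \<Rightarrow> real" and I :: "nat set"
  assumes \<alpha>: "0 \<le> \<alpha>" "\<alpha> < 1" and \<delta>: "0 < \<delta>" "\<delta> \<le> 1" and c: "0 < c" and C: "0 < C"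
    and lam: "\<And>j. 0 \<le> lam j" and x: "\<And>j. 0 \<le> x j" and I: "finite I"
    and b0: "\<And>J. 0 \<le> b J" and b_empty: "b {} = 0"
    and b_union: "\<And>J J'. J \<subseteq> I \<Longrightarrow> J' \<subseteq> I \<Longrightarrow> J \<inter> J' = {} \<Longrightarrow> b (J \<union> J') \<le> b J + b J'"
    and b_diff: "\<And>J J'. J \<subseteq> I \<Longrightarrow> J' \<subseteq> I \<Longrightarrow> J \<inter> J' = {} \<Longrightarrow> b J \<le> b (J \<union> J') + b J'"
    and lower: "\<And>J a. J \<subseteq> I \<Longrightarrow> 0 \<le> a \<Longrightarrow> lam ` J \<subseteq> {a..a+\<delta>} \<Longrightarrow> c * sum x J \<le> (b J)\<^sup>2"
    and upper: "\<And>J a. J \<subseteq> I \<Longrightarrow> 0 \<le> a \<Longrightarrow> lam ` J \<subseteq> {a..a+\<delta>} \<Longrightarrow>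
                  (b J)\<^sup>2 \<le> C * (1 + (a + \<delta>)) powr \<alpha> * sum x J"
begin

definition near where "near s = {j\<in>I. \<bar>lam j - s\<bar> \<le> \<delta> / 2}"
definition far where "far s = {j\<in>I. \<bar>lam j - s\<bar> > \<delta> / 2}"
definition energy where "energy s = (\<Sum>j\<in>far s. \<bar>(lam j)\<^sup>2 - s\<^sup>2\<bar> * x j)"

lemma finite_parts: "finite (near s)" "finite (far s)" and parts: "near s \<union> far s = I" "near s \<inter> far s = {}"
  using I by (auto simp: near_def far_def)

lemma sum_parts: "sum f I = sum f (near s) + sum f (far s)"
  using sum.union_disjoint[OF finite_parts(1)[of s] finite_parts(2)[of s] parts(2)[of s], of f] parts(1)[of s] by simp

lemma energy_nonneg: "0 \<le> energy s"
  unfolding energy_def by (intro sum_nonneg mult_nonneg_nonneg x) auto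

lemma b_Union: "finite S \<Longrightarrow> (\<And>m. m \<in> S \<Longrightarrow> J m \<subseteq> I) \<Longrightarrow> disjoint_family_on J S \<Longrightarrow> b (\<Union>m\<in>S. J m) \<le> (\<Sum>m\<in>S. b (J m))"
proof (induction S rule: finite_induct)
  case (insert m S)
  have "b (J m \<union> (\<Union>m\<in>S. J m)) \<le> b (J m) + b (\<Union>m\<in>S. J m)"
  proof (rule b_union)
    show "J m \<inter> (\<Union>m\<in>S. J m) = {}"
      using insert.prems(2) insert.hyps(2) by (fastforce simp: disjoint_family_on_def)
  qed (use insert.prems in auto)
  also have "b (\<Union>m\<in>S. J m) \<le> (\<Sum>m\<in>S. b (J m))"
    using insert.prems by (intro insert.IH) (auto simp: disjoint_family_on_def)
  finally show ?case using insert.hyps by simp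
qed (simp add: b_empty)

text \<open>The gap \<open>\<bar>lam j - s\<bar>\<close> is at least \<open>\<delta>\<close> times the number of intervals strictly between, and \<open>\<delta>/2\<close> takes over
  when the intervals of \<open>lam j\<close> and \<open>s\<close> coincide or are adjacent.\<close>

lemma gap_bound:
  assumes s: "s \<ge> 1" and j: "\<bar>lam j - s\<bar> > \<delta> / 2"
  defines "m \<equiv> nat \<lfloor>lam j / \<delta>\<rfloor>" and "M \<equiv> nat \<lfloor>s / \<delta>\<rfloor>"
  shows "\<delta>\<^sup>2 / 8 * ((\<bar>real m - real M\<bar> + 1) * (real m + real M + 1)) \<le> \<bar>(lam j)\<^sup>2 - s\<^sup>2\<bar>"
proof -
  have sc: "real n * \<delta> \<le> t \<and> t < real n * \<delta> + \<delta>" if "n = nat \<lfloor>t / \<delta>\<rfloor>" "0 \<le> t" for n t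
  proof -
    have "0 \<le> t / \<delta>" using that \<delta> by simp
    then have "real n \<le> t / \<delta>" "t / \<delta> < real n + 1" using that(1) by linarith+
    then show ?thesis using \<delta> by (simp add: field_simps)
  qed
  have m: "real m * \<delta> \<le> lam j" "lam j < real m * \<delta> + \<delta>" using sc[of m "lam j", OF meta_eq_to_obj_eq[OF m_def] lam] by auto
  have M: "real M * \<delta> \<le> s" "s < real M * \<delta> + \<delta>" using sc[of M s, OF meta_eq_to_obj_eq[OF M_def]] s by auto
  have M1: "M \<ge> 1" unfolding M_def using \<delta> s by (simp add: le_nat_floor)
  have 1: "\<delta> / 4 * (\<bar>real m - real M\<bar> + 1) \<le> \<bar>lam j - s\<bar>"
  proof (cases "\<bar>real m - real M\<bar> \<le> 1")
    case True
    then have "\<delta> / 4 * (\<bar>real m - real M\<bar> + 1) \<le> \<delta> / 4 * 2" using \<delta> by (intro mult_left_mono) auto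
    then show ?thesis using j by simp
  next
    case False
    then have "\<bar>int m - int M\<bar> \<ge> 2" by linarith
    then have "\<bar>real m - real M\<bar> \<ge> 2" by linarith
    then have "\<delta> / 4 * (\<bar>real m - real M\<bar> + 1) \<le> \<delta> * (\<bar>real m - real M\<bar> - 1)" using \<delta> by (simp add: field_simps)
    also have "\<dots> \<le> \<bar>lam j - s\<bar>"
    proof (cases "m \<le> M")
      case True
      then have "\<bar>real m - real M\<bar> = real M - real m" by simp
      then show ?thesis using m M by (simp add: algebra_simps)
    next
      case False
      then have "\<bar>real m - real M\<bar> = real m - real M" by simp
      then show ?thesis using m M by (simp add: algebra_simps)
    qed
    finally show ?thesis .
  qed
  have "\<delta> / 2 * (real m + real M + 1) \<le> \<delta> / 2 * (2 * (real m + real M))"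
    using \<delta> M1 by (intro mult_left_mono) auto
  also have "\<dots> \<le> lam j + s" using m M by (simp add: algebra_simps)
  finally have 2: "\<delta> / 2 * (real m + real M + 1) \<le> lam j + s" .
  have "\<delta>\<^sup>2 / 8 * ((\<bar>real m - real M\<bar> + 1) * (real m + real M + 1))
      = (\<delta> / 4 * (\<bar>real m - real M\<bar> + 1)) * (\<delta> / 2 * (real m + real M + 1))"
    by (simp add: power2_eq_square)
  also have "\<dots> \<le> \<bar>lam j - s\<bar> * (lam j + s)" using \<delta> by (intro mult_mono 1 2) auto
  also have "\<dots> = \<bar>(lam j - s) * (lam j + s)\<bar>" using lam[of j] s by (simp add: abs_mult)
  also have "(lam j - s) * (lam j + s) = (lam j)\<^sup>2 - s\<^sup>2" by (simp add: power2_eq_square algebra_simps)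
  finally show ?thesis .
qed

definition K_far where "K_far = 16 * C / \<delta>\<^sup>2 * ((12 + 4 / (1 - \<alpha>)) * (2 * (1 + ln (1 / \<delta>))))"

text \<open>The far modes are split into the clusters \<open>J m\<close> with frequencies in \<open>[m\<delta>, (m+1)\<delta>)\<close>. On \<open>J m\<close> the seminorm costs
  \<open>(1 + m)\<^bsup>\<alpha>\<^esup>\<close>, while the energy gains the gap; the Cauchy--Schwarz inequality over \<open>m\<close> reduces the claim to
  \<open>bin_sum\<close>.\<close>

lemma far_seminorm_bound:
  assumes s: "s \<ge> 1"
  shows "(b (far s))\<^sup>2 \<le> K_far * (s powr (\<alpha> - 1) * (1 + ln s)) * energy s"
proof -
  define M where "M = nat \<lfloor>s / \<delta>\<rfloor>"
  define bin where "bin j = nat \<lfloor>lam j / \<delta>\<rfloor>" for j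
  define S where "S = bin ` far s"
  define J where "J m = {j\<in>far s. bin j = m}" for m
  define g where "g m = (\<bar>real m - real M\<bar> + 1) * (real m + real M + 1)" for m
  have g: "g m > 0" for m unfolding g_def by (intro mult_pos_pos) auto
  have JI: "J m \<subseteq> I" and Jfin: "finite (J m)" for m
    using finite_parts(2)[of s] by (auto simp: J_def far_def intro: finite_subset[OF _ I])
  have Sfin: "finite S" unfolding S_def using finite_parts by simp
  have farU: "far s = (\<Union>m\<in>S. J m)" by (auto simp: S_def J_def)
  have disj: "disjoint_family_on J S" by (auto simp: disjoint_family_on_def J_def)
  have X0: "0 \<le> sum x (J m)" for m by (intro sum_nonneg x)
  \<comment> \<open>Written as a product that separates the weight of the cluster from its share of the energy.\<close>
  have bJ: "b (J m) \<le> sqrt (2 * C * (1 + real m) powr \<alpha> / (\<delta>\<^sup>2 / 8 * g m)) * sqrt (\<delta>\<^sup>2 / 8 * g m * sum x (J m))" for m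
  proof -
    have "lam ` J m \<subseteq> {real m * \<delta>..real m * \<delta> + \<delta>}"
    proof
      fix l assume "l \<in> lam ` J m"
      then obtain j where j: "l = lam j" "bin j = m" by (auto simp: J_def)
      have "0 \<le> lam j / \<delta>" using lam \<delta> by simp
      then have "real m \<le> lam j / \<delta>" "lam j / \<delta> < real m + 1" using j(2) unfolding bin_def by linarith+
      then show "l \<in> {real m * \<delta>..real m * \<delta> + \<delta>}" using \<delta> j(1) by (simp add: field_simps)
    qed
    then have "(b (J m))\<^sup>2 \<le> C * (1 + (real m * \<delta> + \<delta>)) powr \<alpha> * sum x (J m)"
      using \<delta> by (intro upper JI) auto
    also have "(1 + (real m * \<delta> + \<delta>)) powr \<alpha> \<le> (2 * (1 + real m)) powr \<alpha>"
    proof (intro powr_mono2)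
      have "real m * \<delta> \<le> real m * 1" using \<delta> by (intro mult_left_mono) auto
      then show "1 + (real m * \<delta> + \<delta>) \<le> 2 * (1 + real m)" using \<delta> by simp
    qed (use \<alpha> \<delta> in auto)
    also have "(2 * (1 + real m)) powr \<alpha> = 2 powr \<alpha> * (1 + real m) powr \<alpha>" by (rule powr_mult)
    also have "2 powr \<alpha> \<le> 2 powr (1::real)" using \<alpha> by (intro powr_mono) auto
    finally have "(b (J m))\<^sup>2 \<le> C * (2 * (1 + real m) powr \<alpha>) * sum x (J m)"
      using C X0[of m] by (simp add: mult_left_mono mult_right_mono)
    also have "\<dots> = (2 * C * (1 + real m) powr \<alpha> / (\<delta>\<^sup>2 / 8 * g m)) * (\<delta>\<^sup>2 / 8 * g m * sum x (J m))"
      using g[of m] \<delta> by (simp add: field_simps)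
    finally have "b (J m) \<le> sqrt \<dots>" by (rule real_le_rsqrt)
    then show ?thesis by (simp only: real_sqrt_mult)
  qed
  have en: "(\<Sum>m\<in>S. \<delta>\<^sup>2 / 8 * g m * sum x (J m)) \<le> energy s"
  proof -
    have "(\<Sum>m\<in>S. \<delta>\<^sup>2 / 8 * g m * sum x (J m)) \<le> (\<Sum>m\<in>S. \<Sum>j\<in>J m. \<bar>(lam j)\<^sup>2 - s\<^sup>2\<bar> * x j)"
      unfolding sum_distrib_left
    proof (intro sum_mono mult_right_mono x)
      fix m j assume "j \<in> J m"
      then show "\<delta>\<^sup>2 / 8 * g m \<le> \<bar>(lam j)\<^sup>2 - s\<^sup>2\<bar>"
        using gap_bound[OF s, of j] by (auto simp: J_def far_def bin_def g_def M_def)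
    qed
    also have "\<dots> = energy s" unfolding energy_def farU
      using Sfin Jfin disj by (intro sum.UNION_disjoint[symmetric]) (auto simp: disjoint_family_on_def)
    finally show ?thesis .
  qed
  have w: "(\<Sum>m\<in>S. 2 * C * (1 + real m) powr \<alpha> / (\<delta>\<^sup>2 / 8 * g m)) \<le> K_far * (s powr (\<alpha> - 1) * (1 + ln s))"
  proof -
    have "(\<Sum>m\<in>S. 2 * C * (1 + real m) powr \<alpha> / (\<delta>\<^sup>2 / 8 * g m)) = 16 * C / \<delta>\<^sup>2 * (\<Sum>m\<in>S. (1 + real m) powr \<alpha> / g m)"
      unfolding sum_distrib_left by (intro sum.cong) (auto simp: field_simps)
    also have "\<dots> \<le> 16 * C / \<delta>\<^sup>2 * ((12 + 4 / (1 - \<alpha>)) * (real M powr (\<alpha> - 1) * (1 + ln (real M))))"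
      unfolding g_def using floor_bin_weight(1)[OF \<delta> \<alpha> s] C
      by (intro mult_left_mono bin_sum \<alpha> Sfin) (simp_all add: M_def)
    also have "\<dots> \<le> 16 * C / \<delta>\<^sup>2 * ((12 + 4 / (1 - \<alpha>)) * (2 * (1 + ln (1 / \<delta>)) * (s powr (\<alpha> - 1) * (1 + ln s))))"
      unfolding M_def using C \<alpha> by (intro mult_left_mono floor_bin_weight(2)[OF \<delta> \<alpha> s]) auto
    also have "\<dots> = K_far * (s powr (\<alpha> - 1) * (1 + ln s))" by (simp only: K_far_def mult.assoc)
    finally show ?thesis .
  qed
  have "(b (far s))\<^sup>2 \<le> (\<Sum>m\<in>S. b (J m))\<^sup>2"
    unfolding farU by (intro power_mono b_Union Sfin JI disj b0)
  also have "\<dots> \<le> (\<Sum>m\<in>S. sqrt (2 * C * (1 + real m) powr \<alpha> / (\<delta>\<^sup>2 / 8 * g m)) * sqrt (\<delta>\<^sup>2 / 8 * g m * sum x (J m)))\<^sup>2"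
    by (intro power_mono sum_mono bJ sum_nonneg b0)
  also have "\<dots> \<le> (\<Sum>m\<in>S. (sqrt (2 * C * (1 + real m) powr \<alpha> / (\<delta>\<^sup>2 / 8 * g m)))\<^sup>2) * (\<Sum>m\<in>S. (sqrt (\<delta>\<^sup>2 / 8 * g m * sum x (J m)))\<^sup>2)"
    by (rule Cauchy_Schwarz_ineq_sum)
  also have "\<dots> = (\<Sum>m\<in>S. 2 * C * (1 + real m) powr \<alpha> / (\<delta>\<^sup>2 / 8 * g m)) * (\<Sum>m\<in>S. \<delta>\<^sup>2 / 8 * g m * sum x (J m))"
    using g C X0 \<delta> by (intro arg_cong2[where f = times] sum.cong real_sqrt_pow2) (auto simp: less_imp_le)
  also have "\<dots> \<le> (K_far * (s powr (\<alpha> - 1) * (1 + ln s))) * energy s"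
    using g C X0 \<delta> by (intro mult_mono w en sum_nonneg order_trans[OF _ w]) (auto simp: less_imp_le)
  finally show ?thesis .
qed

lemma K_far_pos: "0 < K_far"
  unfolding K_far_def using C \<alpha> \<delta> by (intro mult_pos_pos divide_pos_pos add_pos_nonneg) auto

lemma far_gap: "s \<ge> 1 \<Longrightarrow> j \<in> far s \<Longrightarrow> \<delta> / 2 * s \<le> \<bar>(lam j)\<^sup>2 - s\<^sup>2\<bar>"
proof -
  assume s: "s \<ge> 1" and "j \<in> far s"
  then have "\<delta> / 2 * s \<le> \<bar>lam j - s\<bar> * (lam j + s)" using lam[of j] \<delta> by (intro mult_mono) (auto simp: far_def)
  also have "\<dots> = \<bar>(lam j - s) * (lam j + s)\<bar>" using lam[of j] s by (simp add: abs_mult)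
  also have "(lam j - s) * (lam j + s) = (lam j)\<^sup>2 - s\<^sup>2" by (simp add: power2_eq_square algebra_simps)
  finally show ?thesis .
qed

definition K_mass where "K_mass = 2 / c + 2 / c * K_far + 2 / \<delta>"

text \<open>The near modes form one cluster, so their mass is controlled by the seminorm of the near part, which is
  that of the whole sum up to the far part. The mass of the far modes is at most \<open>2E/(\<delta>s)\<close>, which is
  dominated by \<open>l E\<close> since \<open>s l \<ge> 1\<close>.\<close>

lemma mass_bound:
  assumes s: "s \<ge> 1"
  shows "sum x I \<le> K_mass * ((b I)\<^sup>2 + s powr (\<alpha> - 1) * (1 + ln s) * energy s)"
proof -
  let ?l = "s powr (\<alpha> - 1) * (1 + ln s)"
  have sl: "1 \<le> s * ?l"
  proof -
    have "1 * 1 \<le> s powr \<alpha> * (1 + ln s)" using s \<alpha> by (intro mult_mono ge_one_powr_ge_zero) auto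
    also have "s powr \<alpha> = s * s powr (\<alpha> - 1)" using s by (simp add: powr_diff)
    finally show ?thesis by (simp add: mult.assoc)
  qed
  have l0: "0 \<le> ?l" using s by simp
  \<comment> \<open>Frequencies are nonnegative, so the interval around \<open>s\<close> may be shifted to start at a nonnegative point.\<close>
  have "lam ` near s \<subseteq> {max 0 (s - \<delta> / 2)..max 0 (s - \<delta> / 2) + \<delta>}"
  proof
    fix l assume "l \<in> lam ` near s"
    then obtain j where j: "l = lam j" "lam j - s \<le> \<delta> / 2" "s - lam j \<le> \<delta> / 2"
    proof -
      from \<open>l \<in> lam ` near s\<close> obtain j where "l = lam j" "\<bar>lam j - s\<bar> \<le> \<delta> / 2" by (auto simp: near_def)
      then show ?thesis by (intro that[of j]) linarith+
    qed
    have "s \<le> max 0 (s - \<delta> / 2) + \<delta> / 2" by simp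
    then show "l \<in> {max 0 (s - \<delta> / 2)..max 0 (s - \<delta> / 2) + \<delta>}"
      using j lam[of j] unfolding atLeastAtMost_iff by (intro conjI) (simp, linarith)
  qed
  then have "c * sum x (near s) \<le> (b (near s))\<^sup>2" by (intro lower) (auto simp: near_def)
  also have "\<dots> \<le> (b I + b (far s))\<^sup>2"
    using b_diff[of "near s" "far s"] parts[of s] by (intro power_mono b0) (auto simp: near_def far_def)
  also have "\<dots> \<le> 2 * (b I)\<^sup>2 + 2 * (b (far s))\<^sup>2"
    using sum_squares_bound[of "b I" "b (far s)"] by (simp add: power2_sum)
  also have "\<dots> \<le> 2 * (b I)\<^sup>2 + 2 * (K_far * ?l * energy s)" using far_seminorm_bound[OF s] by simp
  finally have 1: "sum x (near s) \<le> 2 / c * (b I)\<^sup>2 + 2 / c * K_far * (?l * energy s)"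
    using c by (simp add: field_simps)
  have "\<delta> / 2 * s * sum x (far s) \<le> energy s"
    unfolding energy_def sum_distrib_left using far_gap[OF s] by (intro sum_mono mult_right_mono x)
  then have "\<delta> / 2 * s * sum x (far s) * ?l \<le> energy s * ?l" using l0 by (rule mult_right_mono)
  moreover have "\<delta> / 2 * sum x (far s) * 1 \<le> \<delta> / 2 * sum x (far s) * (s * ?l)"
    using \<delta> sl by (intro mult_left_mono mult_nonneg_nonneg sum_nonneg x) auto
  ultimately have "\<delta> / 2 * sum x (far s) \<le> ?l * energy s" by (simp add: mult_ac)
  then have 2: "sum x (far s) \<le> 2 / \<delta> * (?l * energy s)" using \<delta> by (simp add: field_simps)
  have "sum x I = sum x (near s) + sum x (far s)"
    by (rule sum_parts)
  also have "\<dots> \<le> 2 / c * (b I)\<^sup>2 + (2 / c * K_far + 2 / \<delta>) * (?l * energy s)"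
    using 1 2 by (simp add: distrib_right)
  also have "\<dots> \<le> K_mass * (b I)\<^sup>2 + K_mass * (?l * energy s)"
    unfolding K_mass_def using c \<delta> K_far_pos mult_nonneg_nonneg[OF l0 energy_nonneg[of s]]
    by (intro add_mono mult_right_mono) auto
  finally show ?thesis by (simp add: distrib_left)
qed

text \<open>For fixed \<open>s\<close> the weights \<open>1 + lam\<^sup>2\<close> of the \<open>H1\<close> norm are bounded on the near modes and dominated by the gap
  \<open>\<bar>lam\<^sup>2 - s\<^sup>2\<bar>\<close> on the far ones.\<close>

lemma weighted_mass_bound:
  assumes s: "s \<ge> 1"
  shows "(\<Sum>j\<in>I. (1 + (lam j)\<^sup>2) * x j) \<le> (1 + (s + 1)\<^sup>2) * sum x I + ((1 + s\<^sup>2) * (2 / \<delta>) + 1) * energy s"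
proof -
  have n: "(\<Sum>j\<in>near s. (1 + (lam j)\<^sup>2) * x j) \<le> (1 + (s + 1)\<^sup>2) * sum x I"
  proof -
    have "(\<Sum>j\<in>near s. (1 + (lam j)\<^sup>2) * x j) \<le> (\<Sum>j\<in>near s. (1 + (s + 1)\<^sup>2) * x j)"
    proof (intro sum_mono mult_right_mono x add_left_mono power_mono lam)
      fix j assume "j \<in> near s" then have "\<bar>lam j - s\<bar> \<le> \<delta> / 2" unfolding near_def by simp
      then have "lam j - s \<le> \<delta> / 2" by linarith
      then show "lam j \<le> s + 1" using \<delta> by linarith
    qed
    also have "\<dots> \<le> (\<Sum>j\<in>I. (1 + (s + 1)\<^sup>2) * x j)"
      using I x by (intro sum_mono2) (auto simp: near_def)
    finally show ?thesis by (simp add: sum_distrib_left)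
  qed
  have f: "(\<Sum>j\<in>far s. (1 + (lam j)\<^sup>2) * x j) \<le> ((1 + s\<^sup>2) * (2 / \<delta>) + 1) * energy s"
    unfolding energy_def sum_distrib_left mult.assoc[symmetric]
  proof (intro sum_mono mult_right_mono x)
    fix j assume j: "j \<in> far s"
    have "\<delta> / 2 * 1 \<le> \<delta> / 2 * s" using \<delta> s by (intro mult_left_mono) auto
    then have g: "\<delta> / 2 \<le> \<bar>(lam j)\<^sup>2 - s\<^sup>2\<bar>" using far_gap[OF s j] by simp
    have "(1 + s\<^sup>2) * 1 \<le> (1 + s\<^sup>2) * (2 / \<delta> * \<bar>(lam j)\<^sup>2 - s\<^sup>2\<bar>)"
      using g \<delta> by (intro mult_left_mono) (auto simp: field_simps)
    moreover have "(lam j)\<^sup>2 \<le> s\<^sup>2 + \<bar>(lam j)\<^sup>2 - s\<^sup>2\<bar>" by simp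
    ultimately have "1 + (lam j)\<^sup>2 \<le> (1 + s\<^sup>2) * (2 / \<delta> * \<bar>(lam j)\<^sup>2 - s\<^sup>2\<bar>) + \<bar>(lam j)\<^sup>2 - s\<^sup>2\<bar>"
      by simp
    also have "\<dots> = ((1 + s\<^sup>2) * (2 / \<delta>) + 1) * \<bar>(lam j)\<^sup>2 - s\<^sup>2\<bar>"
      by (simp only: distrib_right mult.assoc mult_1)
    finally show "1 + (lam j)\<^sup>2 \<le> ((1 + s\<^sup>2) * (2 / \<delta>) + 1) * \<bar>(lam j)\<^sup>2 - s\<^sup>2\<bar>" .
  qed
  have "(\<Sum>j\<in>I. (1 + (lam j)\<^sup>2) * x j) = (\<Sum>j\<in>near s. (1 + (lam j)\<^sup>2) * x j) + (\<Sum>j\<in>far s. (1 + (lam j)\<^sup>2) * x j)"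
    by (rule sum_parts)
  then show ?thesis using n f by linarith
qed

end

section \<open>Strongly monotone operators\<close>

lemma L2_count_space_iff: "f \<in> L2 (count_space (UNIV :: nat set)) \<longleftrightarrow> summable (\<lambda>j. (cmod (f j))\<^sup>2)"
  by (simp add: L2_def integrable_count_space_nat_iff)

lemma L2_norm_count_space:
  "f \<in> L2 (count_space (UNIV :: nat set)) \<Longrightarrow> (L2_norm (count_space UNIV) f)\<^sup>2 = (\<Sum>j. (cmod (f j))\<^sup>2)"
  unfolding L2_norm_sq by (rule integral_count_space_nat) (rule L2_integrable_sq)

lemma L2_inner_count_space_sums:
  assumes "f \<in> L2 (count_space (UNIV :: nat set))" "g \<in> L2 (count_space UNIV)"
  shows "(\<lambda>j. f j * cnj (g j)) sums L2_inner (count_space UNIV) f g"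
  unfolding L2_inner_def using sums_integral_count_space_nat[OF L2_inner_integrable[OF assms]] .


lemma geometric_increments_Cauchy:
  assumes x: "\<And>n. x n \<in> L2 M" and q: "0 \<le> q" "q < 1"
    and inc: "\<And>n. L2_norm M (\<lambda>t. x (Suc n) t - x n t) \<le> D * q ^ n"
    and e: "0 < e"
  shows "\<exists>N. \<forall>m\<ge>N. \<forall>n\<ge>N. L2_norm M (\<lambda>t. x m t - x n t) \<le> e"
proof -
  have D: "0 \<le> D" using order_trans[OF L2_norm_nonneg inc[of 0]] by simp
  have step: "L2_norm M (\<lambda>t. x (n + j) t - x n t) \<le> D * q ^ n * (\<Sum>i<j. q ^ i)" for n j
  proof (induction j)
    case (Suc j)
    have "L2_norm M (\<lambda>t. x (n + Suc j) t - x n t)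
        \<le> L2_norm M (\<lambda>t. x (Suc (n + j)) t - x (n + j) t) + L2_norm M (\<lambda>t. x (n + j) t - x n t)"
      using L2_norm_triangle_diff[OF x[of "Suc (n + j)"] x[of "n + j"] x[of n]] by simp
    also have "\<dots> \<le> D * q ^ (n + j) + D * q ^ n * (\<Sum>i<j. q ^ i)" using inc[of "n + j"] Suc by linarith
    finally show ?case by (simp add: algebra_simps power_add)
  qed (simp add: L2_norm_def)
  have tail: "L2_norm M (\<lambda>t. x m t - x n t) \<le> D * q ^ N / (1 - q)" if Nn: "N \<le> n" and nm: "n \<le> m" for N m n
  proof -
    obtain j where j: "m = n + j" using le_Suc_ex[OF nm] by blast
    have "(\<Sum>i<j. q ^ i) = (1 - q ^ j) / (1 - q)" using q by (simp add: sum_gp_strict)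
    also have "\<dots> \<le> 1 / (1 - q)" using q by (intro divide_right_mono) auto
    finally have "D * q ^ n * (\<Sum>i<j. q ^ i) \<le> D * q ^ n * (1 / (1 - q))"
      using D q by (intro mult_left_mono) auto
    also have "\<dots> \<le> D * q ^ N * (1 / (1 - q))"
      using D q Nn by (intro mult_right_mono mult_left_mono power_decreasing) auto
    finally show ?thesis using step[of n j] j by simp
  qed
  have "(\<lambda>N. D * q ^ N / (1 - q)) \<longlonglongrightarrow> D * 0 / (1 - q)"
    using q by (intro tendsto_intros LIMSEQ_power_zero) auto
  then have "\<forall>\<^sub>F N in sequentially. D * q ^ N / (1 - q) < e"
    using e by (intro order_tendstoD) auto
  then obtain N where N: "D * q ^ N / (1 - q) < e" by (auto simp: eventually_sequentially)
  show ?thesis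
  proof (intro exI[of _ N] allI impI)
    fix m n assume mn: "N \<le> m" "N \<le> n"
    show "L2_norm M (\<lambda>t. x m t - x n t) \<le> e"
    proof (cases "n \<le> m")
      case True then show ?thesis using tail[OF mn(2) True] N by simp
    next
      case False then show ?thesis using tail[OF mn(1), of n] N L2_norm_minus[of M "x m" "x n"] by simp
    qed
  qed
qed

text \<open>Zarantonello's theorem: with \<open>\<rho> = c / K\<^sup>2\<close> the map \<open>x \<mapsto> x - \<rho> (A x - g)\<close> contracts by the factor
  \<open>sqrt (1 - c\<^sup>2 / K\<^sup>2)\<close>, and its fixed points are the solutions of \<open>A x = g\<close>.\<close>

theorem strongly_monotone_onto:
  fixes A :: "('a \<Rightarrow> complex) \<Rightarrow> 'a \<Rightarrow> complex"
  assumes A: "\<And>x. x \<in> L2 M \<Longrightarrow> A x \<in> L2 M"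
    and lip: "\<And>x y. x \<in> L2 M \<Longrightarrow> y \<in> L2 M \<Longrightarrow>
                L2_norm M (\<lambda>t. A x t - A y t) \<le> K * L2_norm M (\<lambda>t. x t - y t)"
    and mono: "\<And>x y. x \<in> L2 M \<Longrightarrow> y \<in> L2 M \<Longrightarrow>
                c * (L2_norm M (\<lambda>t. x t - y t))\<^sup>2 \<le> Re (L2_inner M (\<lambda>t. A x t - A y t) (\<lambda>t. x t - y t))"
    and c: "0 < c" and K: "c \<le> K" and g: "g \<in> L2 M"
  shows "\<exists>x\<in>L2 M. AE t in M. A x t = g t"
proof -
  define \<rho> where "\<rho> = c / K\<^sup>2"
  have K0: "K > 0" using c K by simp
  have \<rho>: "\<rho> > 0" using c K0 by (simp add: \<rho>_def)
  define q where "q = sqrt (1 - c\<^sup>2 / K\<^sup>2)"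
  have cK: "c\<^sup>2 / K\<^sup>2 \<le> 1" "0 < c\<^sup>2 / K\<^sup>2" using c K by (auto simp: divide_le_eq power_mono)
  have q: "0 \<le> q" "q < 1" using cK by (auto simp: q_def)
  have qsq: "q\<^sup>2 = 1 - c\<^sup>2 / K\<^sup>2" using cK by (simp add: q_def)
  define T where "T x = (\<lambda>t. x t + complex_of_real (- \<rho>) * (A x t - g t))" for x
  have T: "T x \<in> L2 M" if "x \<in> L2 M" for x
    unfolding T_def using that A g by (intro L2_add L2_scale L2_diff) auto
  have contr: "L2_norm M (\<lambda>t. T x t - T y t) \<le> q * L2_norm M (\<lambda>t. x t - y t)"
    if x: "x \<in> L2 M" and y: "y \<in> L2 M" for x y
  proof -
    let ?d = "\<lambda>t. x t - y t" and ?D = "\<lambda>t. A x t - A y t"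
    have d: "?d \<in> L2 M" and D: "?D \<in> L2 M" by (intro L2_diff x y A)+
    have "(\<lambda>t. T x t - T y t) = (\<lambda>t. ?d t + complex_of_real (- \<rho>) * ?D t)"
      by (auto simp: T_def algebra_simps)
    then have "(L2_norm M (\<lambda>t. T x t - T y t))\<^sup>2
        = (L2_norm M ?d)\<^sup>2 + 2 * Re (L2_inner M ?d (\<lambda>t. complex_of_real (- \<rho>) * ?D t))
          + (L2_norm M (\<lambda>t. complex_of_real (- \<rho>) * ?D t))\<^sup>2"
      using L2_norm_add_sq[OF d L2_scale[OF D, of "complex_of_real (- \<rho>)"]] by simp
    also have "Re (L2_inner M ?d (\<lambda>t. complex_of_real (- \<rho>) * ?D t)) = - \<rho> * Re (L2_inner M ?D ?d)"
      unfolding L2_inner_scale_right by (subst L2_inner_commute) simp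
    also have "(L2_norm M (\<lambda>t. complex_of_real (- \<rho>) * ?D t))\<^sup>2 = \<rho>\<^sup>2 * (L2_norm M ?D)\<^sup>2"
      unfolding L2_norm_scale by (simp add: power_mult_distrib)
    also have "(L2_norm M ?D)\<^sup>2 \<le> (K * L2_norm M ?d)\<^sup>2" by (intro power_mono lip x y) auto
    finally have "(L2_norm M (\<lambda>t. T x t - T y t))\<^sup>2
        \<le> (L2_norm M ?d)\<^sup>2 + 2 * (- \<rho> * Re (L2_inner M ?D ?d)) + \<rho>\<^sup>2 * (K * L2_norm M ?d)\<^sup>2"
      by (simp add: mult_left_mono)
    moreover have "\<rho> * (c * (L2_norm M ?d)\<^sup>2) \<le> \<rho> * Re (L2_inner M ?D ?d)"
      using \<rho> by (intro mult_left_mono mono x y) auto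
    ultimately have "(L2_norm M (\<lambda>t. T x t - T y t))\<^sup>2
        \<le> (L2_norm M ?d)\<^sup>2 - 2 * (\<rho> * (c * (L2_norm M ?d)\<^sup>2)) + \<rho>\<^sup>2 * (K * L2_norm M ?d)\<^sup>2" by linarith
    also have "\<dots> = (1 - 2 * \<rho> * c + \<rho>\<^sup>2 * K\<^sup>2) * (L2_norm M ?d)\<^sup>2"
      by (simp add: algebra_simps power_mult_distrib)
    also have "1 - 2 * \<rho> * c + \<rho>\<^sup>2 * K\<^sup>2 = q\<^sup>2"
      unfolding qsq \<rho>_def using K0 by (simp add: field_simps power2_eq_square)
    finally have "(L2_norm M (\<lambda>t. T x t - T y t))\<^sup>2 \<le> (q * L2_norm M ?d)\<^sup>2" by (simp add: power_mult_distrib)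
    then show ?thesis by (rule power2_le_imp_le) (use q in simp)
  qed
  define x where "x n = (T ^^ n) (\<lambda>_. 0)" for n
  have xS: "x (Suc n) = T (x n)" for n by (simp add: x_def)
  have x: "x n \<in> L2 M" for n
  proof (induction n)
    case 0 show ?case by (simp add: x_def)
  next
    case (Suc n) then show ?case unfolding xS by (rule T)
  qed
  define D where "D = L2_norm M (\<lambda>t. x (Suc 0) t - x 0 t)"
  have inc: "L2_norm M (\<lambda>t. x (Suc n) t - x n t) \<le> D * q ^ n" for n
  proof (induction n)
    case (Suc n)
    have "L2_norm M (\<lambda>t. x (Suc (Suc n)) t - x (Suc n) t) \<le> q * L2_norm M (\<lambda>t. x (Suc n) t - x n t)"
      using contr[OF x x, of "Suc n" n] by (simp only: xS)
    also have "\<dots> \<le> q * (D * q ^ n)" using q Suc by (intro mult_left_mono) auto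
    finally show ?case by (simp add: mult_ac)
  qed (simp add: D_def)
  obtain z where z: "z \<in> L2 M" "(\<lambda>n. L2_norm M (\<lambda>t. x n t - z t)) \<longlonglongrightarrow> 0"
    by (rule L2_complete[OF x geometric_increments_Cauchy[OF x q inc]]) blast
  have bound: "\<rho> * L2_norm M (\<lambda>t. A z t - g t) \<le> \<rho> * (K * L2_norm M (\<lambda>t. x n t - z t)) + D * q ^ n" for n
  proof -
    have "L2_norm M (\<lambda>t. A z t - g t) \<le> L2_norm M (\<lambda>t. A z t - A (x n) t) + L2_norm M (\<lambda>t. A (x n) t - g t)"
      by (intro L2_norm_triangle_diff A z x g)
    also have "L2_norm M (\<lambda>t. A z t - A (x n) t) \<le> K * L2_norm M (\<lambda>t. x n t - z t)"
      using lip[OF x z(1), of n] L2_norm_minus[of M "A z" "A (x n)"] by simp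
    finally have "\<rho> * L2_norm M (\<lambda>t. A z t - g t)
        \<le> \<rho> * (K * L2_norm M (\<lambda>t. x n t - z t)) + \<rho> * L2_norm M (\<lambda>t. A (x n) t - g t)"
      using \<rho> by (simp add: distrib_left[symmetric])
    also have "\<rho> * L2_norm M (\<lambda>t. A (x n) t - g t) = L2_norm M (\<lambda>t. complex_of_real (- \<rho>) * (A (x n) t - g t))"
      unfolding L2_norm_scale using \<rho> by simp
    also have "(\<lambda>t. complex_of_real (- \<rho>) * (A (x n) t - g t)) = (\<lambda>t. x (Suc n) t - x n t)"
      unfolding xS T_def by auto
    finally show ?thesis using inc[of n] by linarith
  qed
  have "(\<lambda>n. \<rho> * (K * L2_norm M (\<lambda>t. x n t - z t)) + D * q ^ n) \<longlonglongrightarrow> \<rho> * (K * 0) + D * 0"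
    using q by (intro tendsto_intros z LIMSEQ_power_zero) auto
  then have "\<rho> * L2_norm M (\<lambda>t. A z t - g t) \<le> 0"
    by (intro LIMSEQ_le_const[of _ 0]) (use bound in auto)
  then have "L2_norm M (\<lambda>t. A z t - g t) = 0"
    using \<rho> L2_norm_nonneg[of M "\<lambda>t. A z t - g t"] by (simp add: mult_le_0_iff)
  then have "AE t in M. A z t = g t"
    using L2_norm_eq_0_iff[OF L2_diff[OF A[OF z(1)] g]] by simp
  with z show ?thesis by blast
qed

section \<open>Absorbing the cross term\<close>

text \<open>To be read with \<open>E\<close> the far energy of \<open>u\<close>, \<open>b\<close> and \<open>\<beta>\<close> the trace norms of \<open>u\<close> and of its far part with the signs
  inserted, \<open>\<kappa>\<close> the modulus and \<open>a\<close> the real part of the transformed kernel, and \<open>R\<close> the real part of the form at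
  \<open>(u, Tu)\<close>. Young's inequality charges half of the cross term to \<open>E\<close>; the rest is at most half of the damping
  term, by the choice of \<open>N\<close>.\<close>

lemma damped_form_lower_bound:
  fixes E b \<beta> s a \<kappa> N K l R :: real
  assumes b\<beta>: "0 \<le> b" "0 \<le> \<beta>" "\<beta>\<^sup>2 \<le> K * l * E" and a: "0 < a" "a \<le> \<kappa>" and s: "1 \<le> s" and K: "0 < K" "0 < l"
    and N: "N = 1 + K * s * l * \<kappa>\<^sup>2 / a"
    and R: "E - s * \<kappa> * (b * \<beta>) + N * s * a * b\<^sup>2 \<le> R"
  shows "E / 2 + N * s * a * b\<^sup>2 / 2 \<le> R"
proof -
  define t where "t = K * l"
  have t: "t > 0" using K by (simp add: t_def)
  have "0 \<le> (\<beta> - t * (s * \<kappa> * b))\<^sup>2" by simp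
  then have "2 * t * (s * \<kappa> * (b * \<beta>)) \<le> \<beta>\<^sup>2 + t\<^sup>2 * (s * \<kappa> * b)\<^sup>2"
    by (simp add: power2_eq_square algebra_simps)
  also have "\<dots> \<le> t * E + t\<^sup>2 * (s * \<kappa> * b)\<^sup>2" using b\<beta>(3) by (simp add: t_def)
  finally have "t * (2 * (s * \<kappa> * (b * \<beta>))) \<le> t * (E + t * (s * \<kappa> * b)\<^sup>2)"
    by (simp add: power2_eq_square algebra_simps)
  then have 1: "2 * (s * \<kappa> * (b * \<beta>)) \<le> E + t * (s * \<kappa> * b)\<^sup>2" using t by simp
  have "N * s * a * b\<^sup>2 = s * a * b\<^sup>2 + t * (s * \<kappa> * b)\<^sup>2"
    unfolding N t_def using a by (simp add: field_simps power2_eq_square)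
  moreover have "0 \<le> s * a * b\<^sup>2" using s a by simp
  ultimately show ?thesis using 1 R by linarith
qed

text \<open>Since \<open>N s a l = s l a + K (s l \<kappa>)\<^sup>2\<close> and \<open>a \<le> \<kappa>\<close>, a bound \<open>G\<close> on \<open>s l \<kappa>\<close> bounds
  \<open>N s a l\<close> as well, and the mass is dominated by the lower bound for \<open>R\<close>.\<close>

lemma damped_form_mass_bound:
  fixes E b s a \<kappa> N K l R Km G X :: real
  assumes E: "0 \<le> E" and a: "0 < a" "a \<le> \<kappa>" and s: "1 \<le> s" and K: "0 < K" "0 < l" "0 < Km"
    and N: "N = 1 + K * s * l * \<kappa>\<^sup>2 / a"
    and R: "E / 2 + N * s * a * b\<^sup>2 / 2 \<le> R"
    and G: "s * l * \<kappa> \<le> G" and X: "X \<le> Km * (b\<^sup>2 + l * E)"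
  shows "N * s * a * X \<le> 2 * Km * (1 + G + K * G\<^sup>2) * R"
proof -
  have slk: "0 \<le> s * l * \<kappa>" using s K a by simp
  have N1: "1 \<le> N" unfolding N using K s a by simp
  have nb: "0 \<le> N * s * a * b\<^sup>2" using N1 s a by simp
  have ER: "E \<le> 2 * R" "N * s * a * b\<^sup>2 \<le> 2 * R" using R E nb by auto
  have R0: "0 \<le> R" using ER E by simp
  have "N * s * a * l = s * l * a + K * (s * l * \<kappa>)\<^sup>2"
    unfolding N using a by (simp add: field_simps power2_eq_square)
  also have "\<dots> \<le> G + K * G\<^sup>2"
  proof (intro add_mono mult_left_mono power_mono)
    have "s * l * a \<le> s * l * \<kappa>" using s K a by (intro mult_left_mono) auto
    then show "s * l * a \<le> G" using G by simp
  qed (use G slk K in auto)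
  finally have nl: "N * s * a * l \<le> G + K * G\<^sup>2" .
  have G0: "0 \<le> G + K * G\<^sup>2" using G slk K by simp
  have "N * s * a * X \<le> N * s * a * (Km * (b\<^sup>2 + l * E))" using X N1 s a by (intro mult_left_mono) auto
  also have "\<dots> = Km * (N * s * a * b\<^sup>2 + (N * s * a * l) * E)" by (simp add: algebra_simps)
  also have "\<dots> \<le> Km * (2 * R + (G + K * G\<^sup>2) * (2 * R))"
    using K ER(2) mult_mono[OF nl ER(1) G0 E] by (intro mult_left_mono add_mono) auto
  finally show ?thesis by (simp add: algebra_simps)
qed

section \<open>Traces of Sobolev functions\<close>

locale damped_domain = bounded_open \<Omega> for \<Omega> :: "'a::euclidean_space set" +
  fixes \<Gamma> :: "('a \<Rightarrow> complex) \<Rightarrow> 'a \<Rightarrow> complex"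
    and w :: "nat \<Rightarrow> 'a \<Rightarrow> complex" and freq :: "nat \<Rightarrow> real"
  assumes trace: "trace_operator \<Omega> \<Gamma>" and eigenbasis: "neumann_eigenbasis \<Omega> w freq"
begin

abbreviation bdry where "bdry \<equiv> surface_measure \<Omega>"
abbreviation tr_inner where "tr_inner u v \<equiv> L2_inner bdry (\<Gamma> u) (\<Gamma> v)"
abbreviation tr_norm where "tr_norm u \<equiv> L2_norm bdry (\<Gamma> u)"

lemma trace_L2: "u \<in> H1 \<Omega> \<Longrightarrow> \<Gamma> u \<in> L2 bdry"
  using trace by (simp add: trace_operator_def)

lemma trace_add: "u \<in> H1 \<Omega> \<Longrightarrow> v \<in> H1 \<Omega> \<Longrightarrow> AE x in bdry. \<Gamma> (\<lambda>y. u y + v y) x = \<Gamma> u x + \<Gamma> v x"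
  using trace by (simp add: trace_operator_def)

lemma trace_scale: "u \<in> H1 \<Omega> \<Longrightarrow> AE x in bdry. \<Gamma> (\<lambda>y. c * u y) x = c * \<Gamma> u x"
  using trace by (simp add: trace_operator_def)

lemma trace_bound: "\<exists>K\<ge>0. \<forall>u\<in>H1 \<Omega>. tr_norm u \<le> K * H1_norm \<Omega> u"
proof -
  obtain K where K: "\<And>u. u \<in> H1 \<Omega> \<Longrightarrow> tr_norm u \<le> K * H1_norm \<Omega> u"
    using trace unfolding trace_operator_def by blast
  have "tr_norm u \<le> \<bar>K\<bar> * H1_norm \<Omega> u" if "u \<in> H1 \<Omega>" for u
    using K[OF that] mult_right_mono[OF abs_ge_self[of K] H1_norm_nonneg[of u]] by linarith
  then show ?thesis by (intro exI[of _ "\<bar>K\<bar>"]) auto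
qed

lemma tr_inner_add_left:
  assumes "u \<in> H1 \<Omega>" "v \<in> H1 \<Omega>" "\<eta> \<in> H1 \<Omega>"
  shows "tr_inner (\<lambda>x. u x + v x) \<eta> = tr_inner u \<eta> + tr_inner v \<eta>"
proof -
  have "tr_inner (\<lambda>x. u x + v x) \<eta> = L2_inner bdry (\<lambda>x. \<Gamma> u x + \<Gamma> v x) (\<Gamma> \<eta>)"
    using trace_add[OF assms(1,2)] trace_L2[OF H1_add[OF assms(1,2)]] L2_add[OF trace_L2[OF assms(1)] trace_L2[OF assms(2)]]
      trace_L2[OF assms(3)]
    by (intro L2_inner_cong_AE L2_measurable) auto
  then show ?thesis by (simp add: L2_inner_add_left trace_L2 assms)
qed

lemma tr_inner_scale_left:
  assumes "u \<in> H1 \<Omega>" "\<eta> \<in> H1 \<Omega>"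
  shows "tr_inner (\<lambda>x. c * u x) \<eta> = c * tr_inner u \<eta>"
proof -
  have "tr_inner (\<lambda>x. c * u x) \<eta> = L2_inner bdry (\<lambda>x. c * \<Gamma> u x) (\<Gamma> \<eta>)"
    using trace_scale[OF assms(1), of c] trace_L2[OF H1_scale[OF assms(1)]] L2_scale[OF trace_L2[OF assms(1)]]
      trace_L2[OF assms(2)]
    by (intro L2_inner_cong_AE L2_measurable) auto
  then show ?thesis by (simp add: L2_inner_scale_left)
qed

lemma tr_norm_add: 
  assumes "u \<in> H1 \<Omega>" "v \<in> H1 \<Omega>"
  shows "tr_norm (\<lambda>x. u x + v x) \<le> tr_norm u + tr_norm v"
proof -
  have "tr_norm (\<lambda>x. u x + v x) = L2_norm bdry (\<lambda>x. \<Gamma> u x + \<Gamma> v x)"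
    using trace_add[OF assms] L2_measurable[OF trace_L2[OF H1_add[OF assms]]]
      L2_measurable[OF L2_add[OF trace_L2[OF assms(1)] trace_L2[OF assms(2)]]]
    by (intro L2_norm_cong_AE)
  also have "\<dots> \<le> tr_norm u + tr_norm v" by (intro L2_norm_triangle trace_L2 assms)
  finally show ?thesis .
qed

lemma tr_norm_scale:
  assumes "u \<in> H1 \<Omega>" shows "tr_norm (\<lambda>x. c * u x) = cmod c * tr_norm u"
  unfolding L2_norm_scale[symmetric]
  using trace_scale[OF assms, of c] L2_measurable[OF trace_L2[OF H1_scale[OF assms]]]
    L2_measurable[OF L2_scale[OF trace_L2[OF assms]]]
  by (intro L2_norm_cong_AE)

lemma tr_inner_bound: "u \<in> H1 \<Omega> \<Longrightarrow> v \<in> H1 \<Omega> \<Longrightarrow> cmod (tr_inner u v) \<le> tr_norm u * tr_norm v"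
  by (intro L2_Cauchy_Schwarz trace_L2)

section \<open>The damped form\<close>

definition form :: "real \<Rightarrow> complex \<Rightarrow> ('a \<Rightarrow> complex) \<Rightarrow> ('a \<Rightarrow> complex) \<Rightarrow> complex" where
  "form s \<kappa> u v = - complex_of_real (s\<^sup>2) * L2_inner M u v + grad_inner \<Omega> u v + \<i> * complex_of_real s * \<kappa> * tr_inner u v"

lemma form_add_left:
  "u \<in> H1 \<Omega> \<Longrightarrow> v \<in> H1 \<Omega> \<Longrightarrow> \<eta> \<in> H1 \<Omega> \<Longrightarrow> form s \<kappa> (\<lambda>x. u x + v x) \<eta> = form s \<kappa> u \<eta> + form s \<kappa> v \<eta>"
  unfolding form_def by (simp add: L2_inner_add_left grad_inner_add_left tr_inner_add_left H1_L2 algebra_simps)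

lemma form_scale_left:
  "u \<in> H1 \<Omega> \<Longrightarrow> \<eta> \<in> H1 \<Omega> \<Longrightarrow> form s \<kappa> (\<lambda>x. c * u x) \<eta> = c * form s \<kappa> u \<eta>"
  unfolding form_def by (simp add: L2_inner_scale_left grad_inner_scale_left tr_inner_scale_left algebra_simps)

lemma form_diff_left:
  "u \<in> H1 \<Omega> \<Longrightarrow> v \<in> H1 \<Omega> \<Longrightarrow> \<eta> \<in> H1 \<Omega> \<Longrightarrow> form s \<kappa> (\<lambda>x. u x - v x) \<eta> = form s \<kappa> u \<eta> - form s \<kappa> v \<eta>"
  using form_add_left[of u "\<lambda>x. (-1) * v x" \<eta> s \<kappa>] form_scale_left[of v \<eta> s \<kappa> "-1"] H1_scale[of v "-1"] by simp

lemma tr_inner_add_right: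
  assumes "u \<in> H1 \<Omega>" "v \<in> H1 \<Omega>" "\<eta> \<in> H1 \<Omega>"
  shows "tr_inner \<eta> (\<lambda>x. u x + v x) = tr_inner \<eta> u + tr_inner \<eta> v"
  by (subst (1 2 3) L2_inner_commute) (simp add: tr_inner_add_left assms)

lemma tr_inner_scale_right:
  assumes "u \<in> H1 \<Omega>" "\<eta> \<in> H1 \<Omega>"
  shows "tr_inner \<eta> (\<lambda>x. c * u x) = cnj c * tr_inner \<eta> u"
  by (subst (1 2) L2_inner_commute) (simp add: tr_inner_scale_left assms)

lemma form_add_right:
  "u \<in> H1 \<Omega> \<Longrightarrow> v \<in> H1 \<Omega> \<Longrightarrow> \<eta> \<in> H1 \<Omega> \<Longrightarrow> form s \<kappa> \<eta> (\<lambda>x. u x + v x) = form s \<kappa> \<eta> u + form s \<kappa> \<eta> v"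
  unfolding form_def by (simp add: L2_inner_add_right grad_inner_add_right tr_inner_add_right H1_L2 algebra_simps)

lemma form_scale_right:
  "u \<in> H1 \<Omega> \<Longrightarrow> \<eta> \<in> H1 \<Omega> \<Longrightarrow> form s \<kappa> \<eta> (\<lambda>x. c * u x) = cnj c * form s \<kappa> \<eta> u"
  unfolding form_def by (simp add: L2_inner_scale_right grad_inner_scale_right tr_inner_scale_right algebra_simps)

lemma form_bound: "\<exists>K\<ge>0. \<forall>u\<in>H1 \<Omega>. \<forall>v\<in>H1 \<Omega>. cmod (form s \<kappa> u v) \<le> K * (H1_norm \<Omega> u * H1_norm \<Omega> v)"
proof -
  obtain C where C: "C \<ge> 0" "\<And>u. u \<in> H1 \<Omega> \<Longrightarrow> tr_norm u \<le> C * H1_norm \<Omega> u" using trace_bound by blast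
  define K where "K = s\<^sup>2 + real DIM('a) + \<bar>s\<bar> * cmod \<kappa> * C\<^sup>2"
  have "cmod (form s \<kappa> u v) \<le> K * (H1_norm \<Omega> u * H1_norm \<Omega> v)" if u: "u \<in> H1 \<Omega>" and v: "v \<in> H1 \<Omega>" for u v
  proof -
    have 1: "cmod (- complex_of_real (s\<^sup>2) * L2_inner M u v) \<le> s\<^sup>2 * (H1_norm \<Omega> u * H1_norm \<Omega> v)"
    proof -
      have "cmod (L2_inner M u v) \<le> L2_norm M u * L2_norm M v" by (intro L2_Cauchy_Schwarz H1_L2 u v)
      also have "\<dots> \<le> H1_norm \<Omega> u * H1_norm \<Omega> v" by (intro mult_mono L2_norm_le_H1_norm) auto
      finally show ?thesis by (simp add: norm_mult mult_left_mono norm_power)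
    qed
    have 3: "cmod (\<i> * complex_of_real s * \<kappa> * tr_inner u v) \<le> \<bar>s\<bar> * cmod \<kappa> * C\<^sup>2 * (H1_norm \<Omega> u * H1_norm \<Omega> v)"
    proof -
      have "cmod (tr_inner u v) \<le> tr_norm u * tr_norm v" by (intro tr_inner_bound u v)
      also have "\<dots> \<le> (C * H1_norm \<Omega> u) * (C * H1_norm \<Omega> v)" using C u v by (intro mult_mono C(2)) auto
      finally have "\<bar>s\<bar> * cmod \<kappa> * cmod (tr_inner u v) \<le> \<bar>s\<bar> * cmod \<kappa> * ((C * H1_norm \<Omega> u) * (C * H1_norm \<Omega> v))"
        by (intro mult_left_mono) auto
      then show ?thesis by (simp add: norm_mult power2_eq_square mult_ac)
    qed
    have "cmod (form s \<kappa> u v) \<le> cmod (- complex_of_real (s\<^sup>2) * L2_inner M u v) + cmod (grad_inner \<Omega> u v)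
        + cmod (\<i> * complex_of_real s * \<kappa> * tr_inner u v)"
      unfolding form_def by (intro norm_triangle_le add_mono order_refl)
    also have "\<dots> \<le> K * (H1_norm \<Omega> u * H1_norm \<Omega> v)"
      using 1 grad_inner_bound[OF u v] 3 unfolding K_def distrib_right by linarith
    finally show ?thesis .
  qed
  moreover have "K \<ge> 0" using C by (simp add: K_def)
  ultimately show ?thesis by blast
qed

section \<open>Expansion in Neumann modes\<close>

lemma freq_nonneg: "0 \<le> freq j"
  using eigenbasis by (simp add: neumann_eigenbasis_def)

lemma w_H1: "w j \<in> H1 \<Omega>"
  using eigenbasis by (simp add: neumann_eigenbasis_def)

lemma w_orthonormal: "L2_inner M (w i) (w j) = (if i = j then 1 else 0)"
  using eigenbasis by (simp add: neumann_eigenbasis_def L2_orthonormal_basis_def)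

lemma w_complete:
  "f \<in> L2 M \<Longrightarrow> (\<lambda>n. L2_norm M (\<lambda>x. f x - (\<Sum>j<n. L2_inner M f (w j) * w j x))) \<longlonglongrightarrow> 0"
  using eigenbasis by (simp add: neumann_eigenbasis_def L2_orthonormal_basis_def)

lemma grad_w: "\<eta> \<in> H1 \<Omega> \<Longrightarrow> grad_inner \<Omega> \<eta> (w j) = complex_of_real ((freq j)\<^sup>2) * L2_inner M \<eta> (w j)"
  using eigenbasis by (subst grad_inner_commute, subst L2_inner_commute) (simp add: neumann_eigenbasis_def)

definition comb :: "nat set \<Rightarrow> (nat \<Rightarrow> complex) \<Rightarrow> 'a \<Rightarrow> complex" where
  "comb I c = (\<lambda>x. \<Sum>j\<in>I. c j * w j x)"

lemma comb_H1: "comb I c \<in> H1 \<Omega>"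
  unfolding comb_def by (intro H1_sum H1_scale w_H1)

lemma comb_insert: "finite I \<Longrightarrow> j \<notin> I \<Longrightarrow> comb (insert j I) c = (\<lambda>x. c j * w j x + comb I c x)"
  by (simp add: comb_def)

lemma comb_empty: "comb {} c = (\<lambda>_. 0)"
  by (simp add: comb_def)

text \<open>Serves for the form, for both inner products and for the functionals on the right-hand side alike.\<close>

lemma antilinear_comb:
  assumes F: "\<And>u v. u \<in> H1 \<Omega> \<Longrightarrow> v \<in> H1 \<Omega> \<Longrightarrow> F (\<lambda>x. u x + v x) = F u + F v"
    "\<And>u c. u \<in> H1 \<Omega> \<Longrightarrow> F (\<lambda>x. c * u x) = cnj c * F u"
    and I: "finite I"
  shows "F (comb I c) = (\<Sum>j\<in>I. cnj (c j) * F (w j))"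
  using I
proof (induction I rule: finite_induct)
  case empty
  show ?case using F(2)[OF w_H1, of 0 0] by (simp add: comb_empty)
next
  case (insert j I)
  then show ?case by (simp add: comb_insert F H1_scale w_H1 comb_H1)
qed

lemma L2_inner_comb_right:
  "u \<in> H1 \<Omega> \<Longrightarrow> finite I \<Longrightarrow> L2_inner M u (comb I c) = (\<Sum>j\<in>I. cnj (c j) * L2_inner M u (w j))"
  by (rule antilinear_comb) (simp_all add: L2_inner_add_right H1_L2 L2_inner_scale_right)

lemma grad_inner_comb_right:
  "u \<in> H1 \<Omega> \<Longrightarrow> finite I \<Longrightarrow>
   grad_inner \<Omega> u (comb I c) = (\<Sum>j\<in>I. cnj (c j) * (complex_of_real ((freq j)\<^sup>2) * L2_inner M u (w j)))"
  by (subst antilinear_comb) (simp_all add: grad_inner_add_right grad_inner_scale_right grad_w)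

lemma coeff_comb: "finite I \<Longrightarrow> L2_inner M (comb I c) (w k) = (if k \<in> I then c k else 0)"
proof -
  assume I: "finite I"
  have "L2_inner M (comb I c) (w k) = (\<Sum>j\<in>I. L2_inner M (\<lambda>x. c j * w j x) (w k))"
    unfolding comb_def by (intro L2_inner_sum_left L2_scale H1_L2 w_H1)
  also have "\<dots> = (\<Sum>j\<in>I. if j = k then c k else 0)"
    unfolding L2_inner_scale_left w_orthonormal by (intro sum.cong) auto
  finally show ?thesis using I by simp
qed

lemma L2_norm_comb: "finite I \<Longrightarrow> (L2_norm M (comb I c))\<^sup>2 = (\<Sum>j\<in>I. (cmod (c j))\<^sup>2)"
proof -
  assume I: "finite I"
  have "complex_of_real ((L2_norm M (comb I c))\<^sup>2) = (\<Sum>j\<in>I. cnj (c j) * c j)"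
    unfolding L2_inner_self[symmetric] L2_inner_comb_right[OF comb_H1 I] by (simp add: coeff_comb I)
  also have "\<dots> = complex_of_real (\<Sum>j\<in>I. (cmod (c j))\<^sup>2)"
    by (simp only: of_real_sum complex_norm_square mult.commute)
  finally show ?thesis by (simp only: of_real_eq_iff)
qed

definition h1_inner where "h1_inner u v = L2_inner M u v + grad_inner \<Omega> u v"

lemma h1_inner_self: "h1_inner u u = complex_of_real ((H1_norm \<Omega> u)\<^sup>2)"
  unfolding h1_inner_def L2_inner_self grad_inner_self by simp

lemma h1_inner_comb:
  "u \<in> H1 \<Omega> \<Longrightarrow> finite I \<Longrightarrow> h1_inner u (comb I c) = (\<Sum>j\<in>I. complex_of_real (1 + (freq j)\<^sup>2) * (cnj (c j) * L2_inner M u (w j)))"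
  unfolding h1_inner_def by (simp add: L2_inner_comb_right grad_inner_comb_right sum.distrib[symmetric] algebra_simps)

lemma H1_norm_comb: "finite I \<Longrightarrow> (H1_norm \<Omega> (comb I c))\<^sup>2 = (\<Sum>j\<in>I. (1 + (freq j)\<^sup>2) * (cmod (c j))\<^sup>2)"
proof -
  assume I: "finite I"
  have "complex_of_real ((H1_norm \<Omega> (comb I c))\<^sup>2) = (\<Sum>j\<in>I. complex_of_real (1 + (freq j)\<^sup>2) * (c j * cnj (c j)))"
    unfolding h1_inner_self[symmetric] h1_inner_comb[OF comb_H1 I] by (simp add: coeff_comb I mult.commute)
  also have "\<dots> = complex_of_real (\<Sum>j\<in>I. (1 + (freq j)\<^sup>2) * (cmod (c j))\<^sup>2)"
    by (simp only: of_real_sum of_real_mult complex_norm_square)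
  finally show ?thesis by (simp only: of_real_eq_iff)
qed

lemma H1_norm_diff_sq:
  assumes u: "u \<in> H1 \<Omega>" and v: "v \<in> H1 \<Omega>"
  shows "(H1_norm \<Omega> (\<lambda>x. u x + (-1) * v x))\<^sup>2 = (H1_norm \<Omega> u)\<^sup>2 - 2 * Re (h1_inner u v) + (H1_norm \<Omega> v)\<^sup>2"
proof -
  have v': "(\<lambda>x. (-1) * v x) \<in> H1 \<Omega>" by (rule H1_scale[OF v])
  have c: "h1_inner v u = cnj (h1_inner u v)"
    unfolding h1_inner_def by (subst L2_inner_commute, subst grad_inner_commute) simp
  have "h1_inner (\<lambda>x. u x + (-1) * v x) (\<lambda>x. u x + (-1) * v x) = h1_inner u u - h1_inner u v - h1_inner v u + h1_inner v v"
    unfolding h1_inner_def L2_inner_add_left[OF H1_L2[OF u] H1_L2[OF v'] H1_L2[OF H1_add[OF u v']]]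
      L2_inner_add_right[OF H1_L2[OF u] H1_L2[OF v'] H1_L2[OF u]] L2_inner_add_right[OF H1_L2[OF u] H1_L2[OF v'] H1_L2[OF v]]
      L2_inner_scale_left L2_inner_scale_right
      grad_inner_add_left[OF u v' H1_add[OF u v']] grad_inner_add_right[OF u v' u] grad_inner_add_right[OF u v' v']
      grad_inner_scale_left[OF v u] grad_inner_scale_left[OF v v'] grad_inner_scale_right[OF v u] grad_inner_scale_right[OF v v]
    by (simp add: algebra_simps)
  then have "complex_of_real ((H1_norm \<Omega> (\<lambda>x. u x + (-1) * v x))\<^sup>2)
     = complex_of_real ((H1_norm \<Omega> u)\<^sup>2) - (h1_inner u v + cnj (h1_inner u v)) + complex_of_real ((H1_norm \<Omega> v)\<^sup>2)"
    unfolding h1_inner_self c by simp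
  also have "\<dots> = complex_of_real ((H1_norm \<Omega> u)\<^sup>2 - 2 * Re (h1_inner u v) + (H1_norm \<Omega> v)\<^sup>2)"
    unfolding complex_add_cnj by simp
  finally show ?thesis by (simp only: of_real_eq_iff)
qed

lemma comb_diff: "n \<le> m \<Longrightarrow> (\<lambda>x. comb {..<m} c x - comb {..<n} c x) = comb {n..<m} c"
proof -
  assume "n \<le> m"
  then have eq: "{..<m} = {..<n} \<union> {n..<m}" by auto
  have "comb {..<m} c x = comb {..<n} c x + comb {n..<m} c x" for x
    unfolding comb_def eq by (rule sum.union_disjoint) auto
  then show ?thesis by auto
qed

lemma H1_norm_minus: "u \<in> H1 \<Omega> \<Longrightarrow> v \<in> H1 \<Omega> \<Longrightarrow> H1_norm \<Omega> (\<lambda>x. v x - u x) = H1_norm \<Omega> (\<lambda>x. u x - v x)"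
proof -
  assume u: "u \<in> H1 \<Omega>" and v: "v \<in> H1 \<Omega>"
  have "(H1_norm \<Omega> (\<lambda>x. v x - u x))\<^sup>2 = (H1_norm \<Omega> (\<lambda>x. u x - v x))\<^sup>2"
    using H1_norm_diff_sq[OF u v] H1_norm_diff_sq[OF v u]
    unfolding h1_inner_def by (subst (asm) (2) L2_inner_commute, subst (asm) (2) grad_inner_commute) simp
  then show ?thesis by simp
qed

lemma coeff_tendsto:
  assumes u: "\<And>n. u n \<in> H1 \<Omega>" and v: "v \<in> H1 \<Omega>" and lim: "(\<lambda>n. H1_norm \<Omega> (\<lambda>x. u n x - v x)) \<longlonglongrightarrow> 0"
  shows "(\<lambda>n. L2_inner M (u n) (w j)) \<longlonglongrightarrow> L2_inner M v (w j)"
proof (intro L2_inner_tendsto H1_L2 u v w_H1)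
  show "(\<lambda>n. L2_norm M (\<lambda>x. u n x - v x)) \<longlonglongrightarrow> 0"
    by (rule Lim_null_comparison[OF _ lim]) (auto intro!: always_eventually L2_norm_le_H1_norm)
qed

text \<open>By orthogonality of the modes in \<open>H1\<close> the partial sums are Cauchy there, and \<open>H1\<close> is complete.\<close>

lemma synthesis:
  assumes c: "summable (\<lambda>j. (1 + (freq j)\<^sup>2) * (cmod (c j))\<^sup>2)"
  shows "\<exists>u\<in>H1 \<Omega>. (\<forall>j. L2_inner M u (w j) = c j) \<and> (\<lambda>n. H1_norm \<Omega> (\<lambda>x. comb {..<n} c x - u x)) \<longlonglongrightarrow> 0"
proof -
  let ?a = "\<lambda>j. (1 + (freq j)\<^sup>2) * (cmod (c j))\<^sup>2"
  have a0: "0 \<le> ?a j" for j by simp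
  have cauchy: "\<exists>N. \<forall>m\<ge>N. \<forall>n\<ge>N. H1_norm \<Omega> (\<lambda>x. comb {..<m} c x - comb {..<n} c x) \<le> e" if e: "e > 0" for e
  proof -
    obtain N where N: "\<And>m n. m \<ge> N \<Longrightarrow> norm (sum ?a {m..<n}) < e\<^sup>2"
      using c e unfolding summable_Cauchy by (metis zero_less_power)
    have le: "H1_norm \<Omega> (\<lambda>x. comb {..<m} c x - comb {..<n} c x) \<le> e" if "N \<le> n" "n \<le> m" for m n
    proof -
      have "(H1_norm \<Omega> (comb {n..<m} c))\<^sup>2 \<le> e\<^sup>2" using N[OF that(1), of m] by (simp add: H1_norm_comb)
      then have "H1_norm \<Omega> (comb {n..<m} c) \<le> e" by (rule power2_le_imp_le) (use e in simp)
      then show ?thesis using comb_diff[OF that(2)] by simp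
    qed
    have "H1_norm \<Omega> (\<lambda>x. comb {..<m} c x - comb {..<n} c x) \<le> e" if "N \<le> m" "N \<le> n" for m n
      using le[OF that(2), of m] le[OF that(1), of n] H1_norm_minus[OF comb_H1 comb_H1, of "{..<m}" c "{..<n}" c]
      by (cases "n \<le> m") auto
    then show ?thesis by blast
  qed
  obtain u where u: "u \<in> H1 \<Omega>" "(\<lambda>n. H1_norm \<Omega> (\<lambda>x. comb {..<n} c x - u x)) \<longlonglongrightarrow> 0"
    by (rule H1_limit[of "\<lambda>n. comb {..<n} c", OF comb_H1 cauchy]) blast
  have "L2_inner M u (w j) = c j" for j
  proof -
    have "(\<lambda>n. L2_inner M (comb {..<n} c) (w j)) \<longlonglongrightarrow> L2_inner M u (w j)"
      by (rule coeff_tendsto[OF comb_H1 u])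
    moreover have "(\<lambda>n. L2_inner M (comb {..<n} c) (w j)) \<longlonglongrightarrow> c j"
      by (rule tendsto_eventually) (auto simp: coeff_comb eventually_sequentially intro!: exI[of _ "Suc j"])
    ultimately show ?thesis by (rule LIMSEQ_unique)
  qed
  with u show ?thesis by blast
qed

definition mode_coeff where "mode_coeff u j = L2_inner M u (w j)"

text \<open>For the partial sum \<open>p\<close> the weak eigenvalue equation makes \<open>(u,p)\<close> equal to \<open>\<parallel>p\<parallel>\<^sup>2\<close>.\<close>

lemma H1_distance_partial_sum:
  assumes u: "u \<in> H1 \<Omega>"
  shows "(H1_norm \<Omega> (\<lambda>x. u x + (-1) * comb {..<n} (mode_coeff u) x))\<^sup>2
    = (H1_norm \<Omega> u)\<^sup>2 - (\<Sum>j<n. (1 + (freq j)\<^sup>2) * (cmod (mode_coeff u j))\<^sup>2)"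
proof -
  let ?p = "comb {..<n} (mode_coeff u)"
  have "h1_inner u ?p = (\<Sum>j<n. complex_of_real (1 + (freq j)\<^sup>2) * (mode_coeff u j * cnj (mode_coeff u j)))"
    unfolding h1_inner_comb[OF u finite_lessThan] mode_coeff_def by (simp add: mult.commute)
  also have "\<dots> = complex_of_real (\<Sum>j<n. (1 + (freq j)\<^sup>2) * (cmod (mode_coeff u j))\<^sup>2)"
    by (simp only: of_real_sum of_real_mult complex_norm_square)
  finally have "Re (h1_inner u ?p) = (\<Sum>j<n. (1 + (freq j)\<^sup>2) * (cmod (mode_coeff u j))\<^sup>2)"
    by (simp only: Re_complex_of_real)
  then show ?thesis unfolding H1_norm_diff_sq[OF u comb_H1] by (simp add: H1_norm_comb)
qed

lemma Bessel: "u \<in> H1 \<Omega> \<Longrightarrow> (\<Sum>j<n. (1 + (freq j)\<^sup>2) * (cmod (mode_coeff u j))\<^sup>2) \<le> (H1_norm \<Omega> u)\<^sup>2"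
  using H1_distance_partial_sum[of u n] zero_le_power2[of "H1_norm \<Omega> (\<lambda>x. u x + (-1) * comb {..<n} (mode_coeff u) x)"]
  by linarith

lemma coeff_summable: "u \<in> H1 \<Omega> \<Longrightarrow> summable (\<lambda>j. (1 + (freq j)\<^sup>2) * (cmod (mode_coeff u j))\<^sup>2)"
  by (rule summableI_nonneg_bounded[OF _ Bessel]) auto

lemma zero_coeff_AE:
  assumes u: "u \<in> L2 M" and "\<And>j. mode_coeff u j = 0" shows "AE x in M. u x = 0"
proof -
  have "(\<lambda>n::nat. L2_norm M u) \<longlonglongrightarrow> 0" using w_complete[OF u] assms(2) by (simp add: mode_coeff_def)
  then have "L2_norm M u = 0" by (simp add: LIMSEQ_const_iff)
  then show ?thesis using L2_norm_eq_0_iff[OF u] by simp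
qed

text \<open>The synthesis of the coefficients of \<open>u\<close> has the same coefficients as \<open>u\<close>, hence agrees with \<open>u\<close> almost
  everywhere by completeness of the modes in \<open>L2\<close>.\<close>

lemma expansion:
  assumes u: "u \<in> H1 \<Omega>"
  shows "(\<lambda>n. H1_norm \<Omega> (\<lambda>x. comb {..<n} (mode_coeff u) x - u x)) \<longlonglongrightarrow> 0"
proof -
  obtain v where v: "v \<in> H1 \<Omega>" "\<And>j. L2_inner M v (w j) = mode_coeff u j"
    "(\<lambda>n. H1_norm \<Omega> (\<lambda>x. comb {..<n} (mode_coeff u) x - v x)) \<longlonglongrightarrow> 0"
    using synthesis[OF coeff_summable[OF u]] by blast
  have "AE x in M. v x - u x = 0"
  proof (rule zero_coeff_AE)
    show "(\<lambda>x. v x - u x) \<in> L2 M" by (intro L2_diff H1_L2 u v(1))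
    show "mode_coeff (\<lambda>x. v x - u x) j = 0" for j
      using v(2)[of j] by (simp add: mode_coeff_def L2_inner_diff_left H1_L2 u v(1) w_H1)
  qed
  then have eq: "AE x in M. v x = u x" by eventually_elim simp
  have "H1_norm \<Omega> (\<lambda>x. comb {..<n} (mode_coeff u) x - v x) = H1_norm \<Omega> (\<lambda>x. comb {..<n} (mode_coeff u) x - u x)" for n
    by (intro H1_norm_cong_AE H1_diff comb_H1 u v(1)) (use eq in eventually_elim, simp)
  then show ?thesis using v(3) by simp
qed

lemma Parseval: 
  assumes u: "u \<in> H1 \<Omega>"
  shows "(\<lambda>j. (1 + (freq j)\<^sup>2) * (cmod (mode_coeff u j))\<^sup>2) sums (H1_norm \<Omega> u)\<^sup>2"
proof -
  have "(H1_norm \<Omega> (\<lambda>x. comb {..<n} (mode_coeff u) x - u x))\<^sup>2 = (H1_norm \<Omega> u)\<^sup>2 - (\<Sum>j<n. (1 + (freq j)\<^sup>2) * (cmod (mode_coeff u j))\<^sup>2)" for n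
    using H1_distance_partial_sum[OF u, of n] H1_norm_minus[OF u comb_H1, of "{..<n}" "mode_coeff u"] by simp
  then have "(\<lambda>n. (H1_norm \<Omega> u)\<^sup>2 - (\<Sum>j<n. (1 + (freq j)\<^sup>2) * (cmod (mode_coeff u j))\<^sup>2)) \<longlonglongrightarrow> 0\<^sup>2"
    using tendsto_power[OF expansion[OF u], of 2] by simp
  then have "(\<lambda>n. (H1_norm \<Omega> u)\<^sup>2 - ((H1_norm \<Omega> u)\<^sup>2 - (\<Sum>j<n. (1 + (freq j)\<^sup>2) * (cmod (mode_coeff u j))\<^sup>2))) \<longlonglongrightarrow> (H1_norm \<Omega> u)\<^sup>2 - 0\<^sup>2"
    by (intro tendsto_diff tendsto_const)
  then show ?thesis unfolding sums_def by simp
qed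

end

section \<open>Coercivity against a diagonal multiplier\<close>

locale clustered_domain = damped_domain \<Omega> \<Gamma> w freq
  for \<Omega> :: "'a::euclidean_space set" and \<Gamma> w freq +
  fixes \<alpha> \<delta> c C :: real
  assumes \<alpha>: "0 \<le> \<alpha>" "\<alpha> < 1" and \<delta>: "0 < \<delta>" "\<delta> \<le> 1" and c: "0 < c" and C: "0 < C"
    and cluster: "\<And>p. spectral_cluster \<Omega> w freq \<delta> p \<Longrightarrow> c * (L2_norm M p)\<^sup>2 \<le> (tr_norm p)\<^sup>2"
      "\<And>p. spectral_cluster \<Omega> w freq \<delta> p \<Longrightarrow>
        (tr_norm p)\<^sup>2 \<le> C * (1 + mean_frequency \<Omega> w freq p) powr \<alpha> * (L2_norm M p)\<^sup>2"
begin

lemma tr_norm_zero: "tr_norm (\<lambda>_. 0) = 0"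
  using tr_norm_scale[OF w_H1, of 0 0] by simp

lemma mean_frequency_comb_le:
  assumes J: "finite J" and a: "0 \<le> a" "freq ` J \<subseteq> {a..a+\<delta>}" and nz: "L2_norm M (comb J d) \<noteq> 0"
  shows "mean_frequency \<Omega> w freq (comb J d) \<le> a + \<delta>"
proof -
  have "(\<Sum>j. (cmod (L2_inner M (comb J d) (w j)))\<^sup>2 * (freq j)\<^sup>2) = (\<Sum>j\<in>J. (cmod (d j))\<^sup>2 * (freq j)\<^sup>2)"
    by (subst suminf_finite[OF J]) (simp_all add: coeff_comb J)
  also have "\<dots> \<le> (\<Sum>j\<in>J. (cmod (d j))\<^sup>2 * (a + \<delta>)\<^sup>2)"
    using a freq_nonneg by (intro sum_mono mult_left_mono power_mono) auto
  also have "\<dots> = (a + \<delta>)\<^sup>2 * (L2_norm M (comb J d))\<^sup>2"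
    unfolding L2_norm_comb[OF J] by (simp add: sum_distrib_left mult.commute)
  finally have "(\<Sum>j. (cmod (L2_inner M (comb J d) (w j)))\<^sup>2 * (freq j)\<^sup>2) / (L2_norm M (comb J d))\<^sup>2 \<le> (a + \<delta>)\<^sup>2"
    using nz by (simp add: divide_le_eq)
  then show ?thesis unfolding mean_frequency_def using a \<delta> by (intro real_le_lsqrt) auto
qed

text \<open>A combination that vanishes identically is not a cluster; there both sides are zero.\<close>

lemma cluster_comb:
  assumes J: "finite J" and a: "0 \<le> a" "freq ` J \<subseteq> {a..a+\<delta>}"
  shows "c * (\<Sum>j\<in>J. (cmod (d j))\<^sup>2) \<le> (tr_norm (comb J d))\<^sup>2"
    and "(tr_norm (comb J d))\<^sup>2 \<le> C * (1 + (a + \<delta>)) powr \<alpha> * (\<Sum>j\<in>J. (cmod (d j))\<^sup>2)"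
proof -
  have "c * (\<Sum>j\<in>J. (cmod (d j))\<^sup>2) \<le> (tr_norm (comb J d))\<^sup>2 \<and>
      (tr_norm (comb J d))\<^sup>2 \<le> C * (1 + (a + \<delta>)) powr \<alpha> * (\<Sum>j\<in>J. (cmod (d j))\<^sup>2)"
  proof (cases "L2_norm M (comb J d) = 0")
    case True
    then have z: "(\<Sum>j\<in>J. (cmod (d j))\<^sup>2) = 0" using L2_norm_comb[OF J, of d] by simp
    then have "\<forall>j\<in>J. d j = 0" using J by (simp add: sum_nonneg_eq_0_iff)
    then have "comb J d = (\<lambda>_. 0)" by (simp add: comb_def)
    then show ?thesis using z by (simp add: tr_norm_zero)
  next
    case False
    have "spectral_cluster \<Omega> w freq \<delta> (comb J d)"
      unfolding spectral_cluster_def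
    proof (intro conjI allI impI)
      show "comb J d \<in> L2 M" by (rule H1_L2[OF comb_H1])
      then show "\<not> (AE x in M. comb J d x = 0)" using False L2_norm_eq_0_iff by blast
      fix i j assume "L2_inner M (comb J d) (w i) \<noteq> 0" "L2_inner M (comb J d) (w j) \<noteq> 0"
      then have "i \<in> J" "j \<in> J" by (auto simp: coeff_comb J split: if_splits)
      then have "freq i \<in> {a..a+\<delta>}" "freq j \<in> {a..a+\<delta>}" using a(2) by auto
      then show "\<bar>freq j - freq i\<bar> \<le> \<delta>" by (auto simp: abs_le_iff)
    qed
    note cl = cluster[OF this]
    have mf0: "0 \<le> mean_frequency \<Omega> w freq (comb J d)"
      unfolding mean_frequency_def
      by (subst suminf_finite[OF J]) (auto simp: coeff_comb J intro!: divide_nonneg_nonneg sum_nonneg)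
    have "C * (1 + mean_frequency \<Omega> w freq (comb J d)) powr \<alpha> \<le> C * (1 + (a + \<delta>)) powr \<alpha>"
      using C \<alpha> mf0 mean_frequency_comb_le[OF J a False] by (intro mult_left_mono powr_mono2) auto
    then have "(tr_norm (comb J d))\<^sup>2 \<le> C * (1 + (a + \<delta>)) powr \<alpha> * (L2_norm M (comb J d))\<^sup>2"
      using cl(2) by (meson mult_right_mono order_trans zero_le_power2)
    then show ?thesis using cl(1) unfolding L2_norm_comb[OF J] by simp
  qed
  then show "c * (\<Sum>j\<in>J. (cmod (d j))\<^sup>2) \<le> (tr_norm (comb J d))\<^sup>2"
    and "(tr_norm (comb J d))\<^sup>2 \<le> C * (1 + (a + \<delta>)) powr \<alpha> * (\<Sum>j\<in>J. (cmod (d j))\<^sup>2)" by auto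
qed

lemma trace_cluster_seminorm:
  assumes I: "finite I"
  shows "cluster_seminorm freq \<alpha> \<delta> c C (\<lambda>J. tr_norm (comb J d)) (\<lambda>j. (cmod (d j))\<^sup>2) I"
proof
  show "tr_norm (comb {} d) = 0" by (simp add: comb_empty tr_norm_zero)
  fix J J' assume J: "J \<subseteq> I" "J' \<subseteq> I" "J \<inter> J' = {}"
  have fin: "finite J" "finite J'" using J I by (auto intro: finite_subset)
  have eq: "comb (J \<union> J') d = (\<lambda>x. comb J d x + comb J' d x)"
    unfolding comb_def using fin J(3) by (auto intro!: sum.union_disjoint)
  show "tr_norm (comb (J \<union> J') d) \<le> tr_norm (comb J d) + tr_norm (comb J' d)"
    unfolding eq by (intro tr_norm_add comb_H1)
  have "comb J d = (\<lambda>x. comb (J \<union> J') d x + (-1) * comb J' d x)" unfolding eq by simp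
  then have "tr_norm (comb J d) \<le> tr_norm (comb (J \<union> J') d) + tr_norm (\<lambda>x. (-1) * comb J' d x)"
    using tr_norm_add[OF comb_H1 H1_scale[OF comb_H1], of "J \<union> J'" d "-1" J' d] by metis
  then show "tr_norm (comb J d) \<le> tr_norm (comb (J \<union> J') d) + tr_norm (comb J' d)"
    unfolding tr_norm_scale[OF comb_H1] by simp
next
  fix J a assume J: "J \<subseteq> I" "0 \<le> a" "freq ` J \<subseteq> {a..a+\<delta>}"
  have fin: "finite J" using J I by (auto intro: finite_subset)
  show "c * (\<Sum>j\<in>J. (cmod (d j))\<^sup>2) \<le> (tr_norm (comb J d))\<^sup>2"
    and "(tr_norm (comb J d))\<^sup>2 \<le> C * (1 + (a + \<delta>)) powr \<alpha> * (\<Sum>j\<in>J. (cmod (d j))\<^sup>2)"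
    using cluster_comb[OF fin J(2,3)] by auto
qed (use \<alpha> \<delta> c C I freq_nonneg in auto)

abbreviation Kf where "Kf \<equiv> cluster_seminorm.K_far \<alpha> \<delta> C"
abbreviation Km where "Km \<equiv> cluster_seminorm.K_mass \<alpha> \<delta> c C"

lemma Kf_pos: "0 < Kf"
  by (rule cluster_seminorm.K_far_pos[OF trace_cluster_seminorm[of "{}"]]) simp

lemma Km_pos: "0 < Km"
proof -
  interpret cluster_seminorm freq \<alpha> \<delta> c C "\<lambda>J. tr_norm (comb J d)" "\<lambda>j. (cmod (d j))\<^sup>2" "{}" for d
    by (rule trace_cluster_seminorm) simp
  show ?thesis unfolding K_mass_def using K_far_pos c \<delta> by (intro add_pos_pos mult_pos_pos divide_pos_pos) auto
qed

text \<open>The sign that turns \<open>freq\<^sup>2 - s\<^sup>2\<close> into its modulus. It is zero on the near modes, where only the damping helps.\<close>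

definition flip :: "real \<Rightarrow> nat \<Rightarrow> real" where
  "flip s j = (if \<bar>freq j - s\<bar> > \<delta> / 2 then sgn ((freq j)\<^sup>2 - s\<^sup>2) else 0)"

text \<open>This is \<open>L(s) / s\<close>.\<close>

definition weight :: "real \<Rightarrow> real" where
  "weight s = s powr (\<alpha> - 1) * (1 + ln s)"

text \<open>The size \<open>N\<close> of the imaginary part of the multiplier, as required by \<open>damped_form_lower_bound\<close>.\<close>

definition boost :: "real \<Rightarrow> complex \<Rightarrow> real" where
  "boost s \<kappa> = 1 + Kf * s * weight s * (cmod \<kappa>)\<^sup>2 / Re \<kappa>"

definition multiplier :: "real \<Rightarrow> complex \<Rightarrow> nat \<Rightarrow> complex" where
  "multiplier s \<kappa> j = complex_of_real (flip s j) + \<i> * complex_of_real (boost s \<kappa>)"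

lemma weight_pos: "s \<ge> 1 \<Longrightarrow> 0 < weight s"
proof -
  assume "s \<ge> 1"
  then have "0 \<le> ln s" by simp
  then have "0 < 1 + ln s" by linarith
  then show ?thesis unfolding weight_def using \<open>s \<ge> 1\<close> by (intro mult_pos_pos) auto
qed

lemma boost_ge_1: "s \<ge> 1 \<Longrightarrow> 0 < Re \<kappa> \<Longrightarrow> 1 \<le> boost s \<kappa>"
  unfolding boost_def using weight_pos[of s] Kf_pos by simp

lemma norm_multiplier_le: "s \<ge> 1 \<Longrightarrow> 0 < Re \<kappa> \<Longrightarrow> cmod (multiplier s \<kappa> j) \<le> 1 + boost s \<kappa>"
proof -
  assume "s \<ge> 1" "0 < Re \<kappa>"
  then have b: "1 \<le> boost s \<kappa>" by (rule boost_ge_1)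
  have "cmod (multiplier s \<kappa> j) \<le> \<bar>flip s j\<bar> + \<bar>boost s \<kappa>\<bar>"
    unfolding multiplier_def by (rule norm_triangle_le) (simp add: norm_mult)
  also have "\<bar>flip s j\<bar> \<le> 1" by (simp add: flip_def sgn_real_def)
  finally show ?thesis using b by simp
qed

lemma multiplier_nonzero: "s \<ge> 1 \<Longrightarrow> 0 < Re \<kappa> \<Longrightarrow> multiplier s \<kappa> j \<noteq> 0"
proof -
  assume "s \<ge> 1" "0 < Re \<kappa>"
  then have "Im (multiplier s \<kappa> j) \<noteq> 0" using boost_ge_1[of s \<kappa>] by (simp add: multiplier_def)
  then show ?thesis by auto
qed

abbreviation T where "T s \<kappa> I d \<equiv> comb I (\<lambda>j. multiplier s \<kappa> j * d j)"

text \<open>The interior part of the form sees only the signs and yields the energy; the boundary part splits into the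
  cross term and, from the imaginary part of the multiplier, the damping term. The trace of the far part
  with the signs inserted is estimated by applying the cluster estimates to the flipped coefficients, which
  have the same energy.\<close>

lemma form_test_lower:
  fixes d :: "nat \<Rightarrow> complex"
  assumes I: "finite I" and s: "s \<ge> 1" and \<kappa>: "0 < Re \<kappa>"
  defines "E \<equiv> cluster_seminorm.energy freq \<delta> (\<lambda>j. (cmod (d j))\<^sup>2) I s"
  shows "E / 2 + boost s \<kappa> * s * Re \<kappa> * (tr_norm (comb I d))\<^sup>2 / 2 \<le> Re (form s \<kappa> (comb I d) (T s \<kappa> I d))"
proof -
  let ?u = "comb I d" and ?J = "comb I (\<lambda>j. complex_of_real (flip s j) * d j)" and ?N = "boost s \<kappa>"
  interpret cs: cluster_seminorm freq \<alpha> \<delta> c C "\<lambda>J. tr_norm (comb J d)" "\<lambda>j. (cmod (d j))\<^sup>2" I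
    by (rule trace_cluster_seminorm[OF I])
  interpret fl: cluster_seminorm freq \<alpha> \<delta> c C "\<lambda>J. tr_norm (comb J (\<lambda>j. complex_of_real (flip s j) * d j))"
      "\<lambda>j. (cmod (complex_of_real (flip s j) * d j))\<^sup>2" I
    by (rule trace_cluster_seminorm[OF I])
  have T: "T s \<kappa> I d = (\<lambda>x. ?J x + (\<i> * complex_of_real ?N) * ?u x)"
    unfolding comb_def multiplier_def by (auto simp: sum_distrib_left sum.distrib[symmetric] algebra_simps intro!: sum.cong)
  have Tform: "form s \<kappa> ?u (T s \<kappa> I d) = form s \<kappa> ?u ?J + cnj (\<i> * complex_of_real ?N) * form s \<kappa> ?u ?u"
    unfolding T by (simp add: form_add_right form_scale_right comb_H1 H1_scale)
  have uu: "Re (cnj (\<i> * complex_of_real ?N) * form s \<kappa> ?u ?u) = ?N * s * Re \<kappa> * (tr_norm ?u)\<^sup>2"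
    unfolding form_def L2_inner_self grad_inner_self by (simp add: algebra_simps)
  have flip_far: "flip s j \<noteq> 0 \<and> \<bar>flip s j\<bar> = 1 \<and> flip s j * ((freq j)\<^sup>2 - s\<^sup>2) = \<bar>(freq j)\<^sup>2 - s\<^sup>2\<bar>"
    if "j \<in> cs.far s" for j
  proof -
    have "(freq j)\<^sup>2 - s\<^sup>2 \<noteq> 0" using cs.far_gap[OF s that] \<delta> s by (auto simp: mult_le_0_iff)
    then show ?thesis using that by (auto simp: flip_def cs.far_def sgn_real_def)
  qed
  have flip_near: "flip s j = 0" if "j \<in> cs.near s" for j
    using that by (auto simp: flip_def cs.near_def)
  have en: "(\<Sum>j\<in>I. flip s j * ((freq j)\<^sup>2 - s\<^sup>2) * (cmod (d j))\<^sup>2) = E"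
    unfolding E_def cs.energy_def cs.sum_parts[of _ s] using flip_near flip_far by simp
  have "- complex_of_real (s\<^sup>2) * L2_inner M ?u ?J + grad_inner \<Omega> ?u ?J
      = (\<Sum>j\<in>I. complex_of_real (flip s j * ((freq j)\<^sup>2 - s\<^sup>2)) * (d j * cnj (d j)))"
    unfolding L2_inner_comb_right[OF comb_H1 I] grad_inner_comb_right[OF comb_H1 I]
    by (simp add: coeff_comb I sum_distrib_left sum_negf[symmetric] sum.distrib[symmetric] algebra_simps)
  also have "\<dots> = complex_of_real (\<Sum>j\<in>I. flip s j * ((freq j)\<^sup>2 - s\<^sup>2) * (cmod (d j))\<^sup>2)"
    by (simp only: of_real_sum of_real_mult complex_norm_square)
  finally have uJ: "form s \<kappa> ?u ?J = complex_of_real E + \<i> * complex_of_real s * \<kappa> * tr_inner ?u ?J"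
    unfolding form_def en by simp
  have "cmod (\<i> * complex_of_real s * \<kappa> * tr_inner ?u ?J) \<le> s * cmod \<kappa> * (tr_norm ?u * tr_norm ?J)"
    using s tr_inner_bound[OF comb_H1 comb_H1, of I d I "\<lambda>j. complex_of_real (flip s j) * d j"]
    by (simp add: norm_mult mult_left_mono)
  then have "- (s * cmod \<kappa> * (tr_norm ?u * tr_norm ?J)) \<le> Re (\<i> * complex_of_real s * \<kappa> * tr_inner ?u ?J)"
    using abs_Re_le_cmod[of "\<i> * complex_of_real s * \<kappa> * tr_inner ?u ?J"] by linarith
  then have R: "E - s * cmod \<kappa> * (tr_norm ?u * tr_norm ?J) + ?N * s * Re \<kappa> * (tr_norm ?u)\<^sup>2
      \<le> Re (form s \<kappa> ?u (T s \<kappa> I d))"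
    unfolding Tform plus_complex.sel uu uJ Re_complex_of_real by linarith
  have farJ: "?J = comb (cs.far s) (\<lambda>j. complex_of_real (flip s j) * d j)"
    unfolding comb_def cs.sum_parts[of _ s] using flip_near by simp
  have "fl.energy s = E"
    unfolding E_def cs.energy_def fl.energy_def using flip_far by (intro sum.cong) (auto simp: norm_mult)
  then have \<beta>: "(tr_norm ?J)\<^sup>2 \<le> Kf * weight s * E"
    using fl.far_seminorm_bound[OF s] farJ by (simp add: weight_def)
  show ?thesis
    by (rule damped_form_lower_bound[OF _ _ \<beta> \<kappa> complex_Re_le_cmod s Kf_pos weight_pos[OF s] boost_def R]) auto
qed

text \<open>The estimate that carries the theorem: the constant depends on \<open>s\<close> and \<open>\<kappa>\<close> only through the bound \<open>G\<close>.\<close>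

lemma form_test_L2:
  assumes I: "finite I" and s: "s \<ge> 1" and \<kappa>: "0 < Re \<kappa>" and G: "s * weight s * cmod \<kappa> \<le> G"
  shows "boost s \<kappa> * s * Re \<kappa> * (L2_norm M (comb I d))\<^sup>2
    \<le> 2 * Km * (1 + G + Kf * G\<^sup>2) * Re (form s \<kappa> (comb I d) (T s \<kappa> I d))"
proof -
  interpret cs: cluster_seminorm freq \<alpha> \<delta> c C "\<lambda>J. tr_norm (comb J d)" "\<lambda>j. (cmod (d j))\<^sup>2" I
    by (rule trace_cluster_seminorm[OF I])
  show ?thesis
  proof (rule damped_form_mass_bound[OF cs.energy_nonneg \<kappa> complex_Re_le_cmod s Kf_pos weight_pos[OF s] Km_pos boost_def
        form_test_lower[OF I s \<kappa>] G])
    show "(L2_norm M (comb I d))\<^sup>2 \<le> Km * ((tr_norm (comb I d))\<^sup>2 + weight s * cs.energy s)"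
      using cs.mass_bound[OF s] unfolding L2_norm_comb[OF I] by (simp add: weight_def)
  qed
qed

lemma form_test_H1:
  assumes s: "s \<ge> 1" and \<kappa>: "0 < Re \<kappa>"
  shows "\<exists>K>0. \<forall>I d. finite I \<longrightarrow> (H1_norm \<Omega> (comb I d))\<^sup>2 \<le> K * Re (form s \<kappa> (comb I d) (T s \<kappa> I d))"
proof -
  define G where "G = s * weight s * cmod \<kappa>"
  have G0: "0 \<le> G" unfolding G_def using s weight_pos[OF s] by simp
  define K1 where "K1 = 2 * Km * (1 + G + Kf * G\<^sup>2) / (boost s \<kappa> * s * Re \<kappa>)"
  have bs: "0 < boost s \<kappa> * s * Re \<kappa>" using boost_ge_1[OF s \<kappa>] s \<kappa> by simp
  have K1: "0 \<le> K1" unfolding K1_def using Km_pos Kf_pos G0 bs by simp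
  define K where "K = (1 + (s + 1)\<^sup>2) * K1 + ((1 + s\<^sup>2) * (2 / \<delta>) + 1) * 2"
  have cst: "0 \<le> 1 + (s + 1)\<^sup>2" "0 < (1 + s\<^sup>2) * (2 / \<delta>) + 1" using \<delta> by (auto intro!: add_nonneg_pos)
  have K: "K > 0" unfolding K_def
    by (rule add_nonneg_pos[OF mult_nonneg_nonneg[OF cst(1) K1] mult_pos_pos[OF cst(2)]]) simp
  have "(H1_norm \<Omega> (comb I d))\<^sup>2 \<le> K * Re (form s \<kappa> (comb I d) (T s \<kappa> I d))" if I: "finite I" for I d
  proof -
    let ?R = "Re (form s \<kappa> (comb I d) (T s \<kappa> I d))"
    interpret cs: cluster_seminorm freq \<alpha> \<delta> c C "\<lambda>J. tr_norm (comb J d)" "\<lambda>j. (cmod (d j))\<^sup>2" I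
      by (rule trace_cluster_seminorm[OF I])
    have "0 \<le> boost s \<kappa> * s * Re \<kappa> * (tr_norm (comb I d))\<^sup>2" using bs by simp
    then have E: "cs.energy s \<le> 2 * ?R" using form_test_lower[OF I s \<kappa>, of d] by simp
    have X: "(L2_norm M (comb I d))\<^sup>2 \<le> K1 * ?R"
      using form_test_L2[OF I s \<kappa>, of G d] bs unfolding K1_def by (simp add: G_def pos_le_divide_eq mult.commute)
    have "(H1_norm \<Omega> (comb I d))\<^sup>2 \<le> (1 + (s + 1)\<^sup>2) * (L2_norm M (comb I d))\<^sup>2 + ((1 + s\<^sup>2) * (2 / \<delta>) + 1) * cs.energy s"
      unfolding H1_norm_comb[OF I] L2_norm_comb[OF I] by (rule cs.weighted_mass_bound[OF s])
    also have "\<dots> \<le> (1 + (s + 1)\<^sup>2) * (K1 * ?R) + ((1 + s\<^sup>2) * (2 / \<delta>) + 1) * (2 * ?R)"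
      using cst by (intro add_mono mult_left_mono X E) auto
    also have "\<dots> = K * ?R" by (simp add: K_def algebra_simps)
    finally show ?thesis .
  qed
  with K show ?thesis by blast
qed

lemma H1_norm_T_le:
  assumes I: "finite I" and s: "s \<ge> 1" and \<kappa>: "0 < Re \<kappa>"
  shows "H1_norm \<Omega> (T s \<kappa> I d) \<le> (1 + boost s \<kappa>) * H1_norm \<Omega> (comb I d)"
    and "L2_norm M (T s \<kappa> I d) \<le> (1 + boost s \<kappa>) * L2_norm M (comb I d)"
proof -
  have b: "0 \<le> 1 + boost s \<kappa>" using boost_ge_1[OF s \<kappa>] by simp
  have m: "(cmod (multiplier s \<kappa> j * d j))\<^sup>2 \<le> (1 + boost s \<kappa>)\<^sup>2 * (cmod (d j))\<^sup>2" for j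
    unfolding norm_mult power_mult_distrib using norm_multiplier_le[OF s \<kappa>] by (intro mult_right_mono power_mono) auto
  have "(H1_norm \<Omega> (T s \<kappa> I d))\<^sup>2 \<le> ((1 + boost s \<kappa>) * H1_norm \<Omega> (comb I d))\<^sup>2"
    unfolding power_mult_distrib H1_norm_comb[OF I] sum_distrib_left mult.left_commute[of "(1 + boost s \<kappa>)\<^sup>2"]
    using m by (intro sum_mono mult_left_mono) auto
  then show "H1_norm \<Omega> (T s \<kappa> I d) \<le> (1 + boost s \<kappa>) * H1_norm \<Omega> (comb I d)"
    by (rule power2_le_imp_le) (use b in simp)
  have "(L2_norm M (T s \<kappa> I d))\<^sup>2 \<le> ((1 + boost s \<kappa>) * L2_norm M (comb I d))\<^sup>2"
    unfolding power_mult_distrib L2_norm_comb[OF I] sum_distrib_left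
    using m by (intro sum_mono) auto
  then show "L2_norm M (T s \<kappa> I d) \<le> (1 + boost s \<kappa>) * L2_norm M (comb I d)"
    by (rule power2_le_imp_le) (use b in simp)
qed

lemma H1_norm_partial_sum_le: "u \<in> H1 \<Omega> \<Longrightarrow> H1_norm \<Omega> (comb {..<n} (mode_coeff u)) \<le> H1_norm \<Omega> u"
  by (rule power2_le_imp_le) (simp_all add: H1_norm_comb Bessel)

lemma L2_norm_partial_sum_le: 
  assumes "u \<in> H1 \<Omega>" shows "L2_norm M (comb {..<n} (mode_coeff u)) \<le> L2_norm M u"
proof -
  let ?p = "comb {..<n} (mode_coeff u)"
  have "L2_inner M u ?p = (\<Sum>j<n. mode_coeff u j * cnj (mode_coeff u j))"
    unfolding L2_inner_comb_right[OF assms finite_lessThan] mode_coeff_def by (simp add: mult.commute)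
  also have "\<dots> = complex_of_real ((L2_norm M ?p)\<^sup>2)"
    unfolding L2_norm_comb[OF finite_lessThan] by (simp only: of_real_sum complex_norm_square)
  finally have "(L2_norm M ?p)\<^sup>2 \<le> L2_norm M u * L2_norm M ?p"
    using L2_Cauchy_Schwarz[OF H1_L2[OF assms] H1_L2[OF comb_H1], of "{..<n}" "mode_coeff u"]
    by (simp add: norm_power)
  then show ?thesis
    using L2_norm_nonneg[of M ?p] by (cases "L2_norm M ?p = 0") (auto simp: power2_eq_square)
qed

text \<open>The test function stays on the \<open>n\<close>-th partial sum, where \<open>T\<close> is defined; only the first argument passes to the
  limit.\<close>

lemma form_test_error:
  assumes u: "u \<in> H1 \<Omega>" and s: "s \<ge> 1" and \<kappa>: "0 < Re \<kappa>"
  shows "(\<lambda>n. form s \<kappa> (comb {..<n} (mode_coeff u)) (T s \<kappa> {..<n} (mode_coeff u)) - form s \<kappa> u (T s \<kappa> {..<n} (mode_coeff u))) \<longlonglongrightarrow> 0"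
proof -
  obtain K where K: "K \<ge> 0" "\<And>u v. u \<in> H1 \<Omega> \<Longrightarrow> v \<in> H1 \<Omega> \<Longrightarrow> cmod (form s \<kappa> u v) \<le> K * (H1_norm \<Omega> u * H1_norm \<Omega> v)"
    using form_bound[of s \<kappa>] by blast
  let ?e = "\<lambda>n. H1_norm \<Omega> (\<lambda>x. comb {..<n} (mode_coeff u) x - u x)"
  have b: "0 \<le> 1 + boost s \<kappa>" using boost_ge_1[OF s \<kappa>] by simp
  have le: "cmod (form s \<kappa> (comb {..<n} (mode_coeff u)) (T s \<kappa> {..<n} (mode_coeff u)) - form s \<kappa> u (T s \<kappa> {..<n} (mode_coeff u)))
     \<le> K * (?e n * ((1 + boost s \<kappa>) * H1_norm \<Omega> u))" for n
  proof -
    have "H1_norm \<Omega> (T s \<kappa> {..<n} (mode_coeff u)) \<le> (1 + boost s \<kappa>) * H1_norm \<Omega> (comb {..<n} (mode_coeff u))"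
      by (rule H1_norm_T_le[OF finite_lessThan s \<kappa>])
    also have "\<dots> \<le> (1 + boost s \<kappa>) * H1_norm \<Omega> u" by (intro mult_left_mono H1_norm_partial_sum_le u b)
    finally have t: "H1_norm \<Omega> (T s \<kappa> {..<n} (mode_coeff u)) \<le> (1 + boost s \<kappa>) * H1_norm \<Omega> u" .
    have "cmod (form s \<kappa> (\<lambda>x. comb {..<n} (mode_coeff u) x - u x) (T s \<kappa> {..<n} (mode_coeff u)))
        \<le> K * (?e n * H1_norm \<Omega> (T s \<kappa> {..<n} (mode_coeff u)))"
      by (intro K(2) H1_diff comb_H1 u)
    also have "\<dots> \<le> K * (?e n * ((1 + boost s \<kappa>) * H1_norm \<Omega> u))"
      using t K(1) by (intro mult_left_mono) auto
    finally show ?thesis by (simp add: form_diff_left comb_H1 u)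
  qed
  have "(\<lambda>n. K * (?e n * ((1 + boost s \<kappa>) * H1_norm \<Omega> u))) \<longlonglongrightarrow> K * (0 * ((1 + boost s \<kappa>) * H1_norm \<Omega> u))"
    by (intro tendsto_intros expansion u)
  then have lim: "(\<lambda>n. K * (?e n * ((1 + boost s \<kappa>) * H1_norm \<Omega> u))) \<longlonglongrightarrow> 0" by simp
  show ?thesis by (rule Lim_null_comparison[OF always_eventually[OF allI[OF le]] lim])
qed

lemma partial_sum_norm_tendsto:
  assumes u: "u \<in> H1 \<Omega>"
  shows "(\<lambda>n. (L2_norm M (comb {..<n} (mode_coeff u)))\<^sup>2) \<longlonglongrightarrow> (L2_norm M u)\<^sup>2"
    and "(\<lambda>n. (H1_norm \<Omega> (comb {..<n} (mode_coeff u)))\<^sup>2) \<longlonglongrightarrow> (H1_norm \<Omega> u)\<^sup>2"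
proof -
  have "(\<lambda>n. L2_norm M (comb {..<n} (mode_coeff u)) - L2_norm M u) \<longlonglongrightarrow> 0"
  proof (rule Lim_null_comparison[OF _ expansion[OF u]], intro always_eventually allI)
    fix n
    have "\<bar>L2_norm M (comb {..<n} (mode_coeff u)) - L2_norm M u\<bar> \<le> L2_norm M (\<lambda>x. comb {..<n} (mode_coeff u) x - u x)"
      by (intro L2_norm_diff_le H1_L2 comb_H1 u)
    also have "\<dots> \<le> H1_norm \<Omega> (\<lambda>x. comb {..<n} (mode_coeff u) x - u x)" by (rule L2_norm_le_H1_norm)
    finally show "norm (L2_norm M (comb {..<n} (mode_coeff u)) - L2_norm M u) \<le> H1_norm \<Omega> (\<lambda>x. comb {..<n} (mode_coeff u) x - u x)"
      by simp
  qed
  then show "(\<lambda>n. (L2_norm M (comb {..<n} (mode_coeff u)))\<^sup>2) \<longlonglongrightarrow> (L2_norm M u)\<^sup>2"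
    by (intro tendsto_power) (simp add: LIM_zero_iff)
  show "(\<lambda>n. (H1_norm \<Omega> (comb {..<n} (mode_coeff u)))\<^sup>2) \<longlonglongrightarrow> (H1_norm \<Omega> u)\<^sup>2"
    using Parseval[OF u] unfolding sums_def H1_norm_comb[OF finite_lessThan] .
qed

text \<open>Transfers an estimate for partial sums to \<open>u\<close> itself. The sequence \<open>B\<close> is a constant in the a priori bound and
  the convergent sequence of the values of the form in the monotonicity argument.\<close>

lemma coercive_limit:
  assumes u: "u \<in> H1 \<Omega>" and s: "s \<ge> 1" and \<kappa>: "0 < Re \<kappa>"
    and q: "\<And>n. A * q n \<le> K * Re (form s \<kappa> (comb {..<n} (mode_coeff u)) (T s \<kappa> {..<n} (mode_coeff u)))" "q \<longlonglongrightarrow> Q"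
    and K: "0 \<le> K" and B: "\<And>n. Re (form s \<kappa> u (T s \<kappa> {..<n} (mode_coeff u))) \<le> B n" "B \<longlonglongrightarrow> L"
  shows "A * Q \<le> K * L"
proof -
  let ?f = "\<lambda>n. form s \<kappa> (comb {..<n} (mode_coeff u)) (T s \<kappa> {..<n} (mode_coeff u))"
  let ?g = "\<lambda>n. form s \<kappa> u (T s \<kappa> {..<n} (mode_coeff u))"
  have "(\<lambda>n. K * (B n + Re (?f n - ?g n))) \<longlonglongrightarrow> K * (L + Re 0)"
    by (intro tendsto_intros B form_test_error u s \<kappa>)
  moreover have "(\<lambda>n. A * q n) \<longlonglongrightarrow> A * Q" by (intro tendsto_intros q)
  moreover have "A * q n \<le> K * (B n + Re (?f n - ?g n))" for n
  proof -
    have "Re (?f n) \<le> B n + Re (?f n - ?g n)" using B(1)[of n] by simp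
    then show ?thesis using q(1)[of n] mult_left_mono[OF _ K, of "Re (?f n)"] by (meson order_trans)
  qed
  ultimately show ?thesis by (simp add: LIMSEQ_le)
qed

text \<open>The left-hand side of the coercivity estimate gains the factor \<open>N\<close>, and \<open>\<bar>T\<bar> \<le> 1 + N \<le> 2N\<close> loses it again.\<close>

lemma resolvent_bound:
  assumes u: "u \<in> H1 \<Omega>" and f: "f \<in> L2 M" and eq: "\<And>\<eta>. \<eta> \<in> H1 \<Omega> \<Longrightarrow> form s \<kappa> u \<eta> = L2_inner M f \<eta>"
    and s: "s \<ge> 1" and \<kappa>: "0 < Re \<kappa>" and G: "s * weight s * cmod \<kappa> \<le> G" "0 \<le> G"
  shows "L2_norm M u \<le> 4 * Km * (1 + G + Kf * G\<^sup>2) / (s * Re \<kappa>) * L2_norm M f"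
proof -
  define N where "N = boost s \<kappa>"
  define K where "K = 2 * Km * (1 + G + Kf * G\<^sup>2)"
  have K: "0 \<le> K" unfolding K_def using Km_pos Kf_pos G(2) by simp
  have N: "1 \<le> N" unfolding N_def by (rule boost_ge_1[OF s \<kappa>])
  have "N * s * Re \<kappa> * (L2_norm M u)\<^sup>2 \<le> K * (L2_norm M f * ((1 + N) * L2_norm M u))"
  proof (rule coercive_limit[OF u s \<kappa> _ partial_sum_norm_tendsto(1)[OF u] K])
    show "N * s * Re \<kappa> * (L2_norm M (comb {..<n} (mode_coeff u)))\<^sup>2
        \<le> K * Re (form s \<kappa> (comb {..<n} (mode_coeff u)) (T s \<kappa> {..<n} (mode_coeff u)))" for n
      unfolding N_def K_def by (rule form_test_L2[OF finite_lessThan s \<kappa> G(1)])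
    show "(\<lambda>n. L2_norm M f * ((1 + N) * L2_norm M u)) \<longlonglongrightarrow> L2_norm M f * ((1 + N) * L2_norm M u)" by simp
    fix n
    have "Re (form s \<kappa> u (T s \<kappa> {..<n} (mode_coeff u))) \<le> L2_norm M f * L2_norm M (T s \<kappa> {..<n} (mode_coeff u))"
      unfolding eq[OF comb_H1]
      using complex_Re_le_cmod L2_Cauchy_Schwarz[OF f H1_L2[OF comb_H1]] by (rule order_trans)
    also have "\<dots> \<le> L2_norm M f * ((1 + N) * L2_norm M (comb {..<n} (mode_coeff u)))"
      unfolding N_def by (intro mult_left_mono H1_norm_T_le(2)[OF finite_lessThan s \<kappa>]) auto
    also have "\<dots> \<le> L2_norm M f * ((1 + N) * L2_norm M u)"
      using N by (intro mult_left_mono L2_norm_partial_sum_le u) auto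
    finally show "Re (form s \<kappa> u (T s \<kappa> {..<n} (mode_coeff u))) \<le> L2_norm M f * ((1 + N) * L2_norm M u)" .
  qed
  also have "\<dots> \<le> K * (L2_norm M f * ((2 * N) * L2_norm M u))"
    using N K by (intro mult_left_mono mult_right_mono) auto
  finally have key: "N * L2_norm M u * (s * Re \<kappa> * L2_norm M u) \<le> N * L2_norm M u * (2 * K * L2_norm M f)"
    by (simp add: power2_eq_square mult_ac)
  have "0 \<le> 2 * K * L2_norm M f / (s * Re \<kappa>)" using K s \<kappa> by simp
  then have "L2_norm M u \<le> 2 * K * L2_norm M f / (s * Re \<kappa>)"
  proof (cases "L2_norm M u = 0")
    case False
    then have "0 < L2_norm M u" using L2_norm_nonneg[of M u] by linarith
    then have "0 < N * L2_norm M u" using N by simp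
    then have "s * Re \<kappa> * L2_norm M u \<le> 2 * K * L2_norm M f"
      using key by (simp only: mult_le_cancel_left_pos)
    then show ?thesis using s \<kappa> by (simp add: pos_le_divide_eq mult.commute)
  qed simp
  then show ?thesis by (simp add: K_def mult_ac)
qed

end

section \<open>Existence and the resolvent estimate\<close>

context clustered_domain
begin

abbreviation seqs where "seqs \<equiv> count_space (UNIV :: nat set)"

text \<open>The \<open>H1\<close> norm of the \<open>j\<close>-th mode, as the modes are normalised in \<open>L2\<close>.\<close>

definition h1w :: "nat \<Rightarrow> real" where "h1w j = sqrt (1 + (freq j)\<^sup>2)"

lemma h1w: "0 < h1w j" "(h1w j)\<^sup>2 = 1 + (freq j)\<^sup>2" "1 + (freq j)\<^sup>2 \<noteq> 0"
  using add_pos_nonneg[of 1 "(freq j)\<^sup>2"] by (auto simp: h1w_def)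

text \<open>The coefficients of a bounded antilinear functional, relative to the \<open>H1\<close>-normalised modes and composed with
  a bounded multiplier, are square summable: evaluate the functional at the sum formed with these very
  coefficients.\<close>

lemma functional_coeffs:
  assumes add: "\<And>u v. u \<in> H1 \<Omega> \<Longrightarrow> v \<in> H1 \<Omega> \<Longrightarrow> F (\<lambda>x. u x + v x) = F u + F v"
    and scale: "\<And>u c. u \<in> H1 \<Omega> \<Longrightarrow> F (\<lambda>x. c * u x) = cnj c * F u"
    and bound: "\<And>u. u \<in> H1 \<Omega> \<Longrightarrow> cmod (F u) \<le> K * H1_norm \<Omega> u" and K: "0 \<le> K"
    and t: "\<And>j. cmod (t j) \<le> \<tau>"
  shows "(\<lambda>j. cnj (t j) * F (w j) / complex_of_real (h1w j)) \<in> L2 seqs"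
    and "L2_norm seqs (\<lambda>j. cnj (t j) * F (w j) / complex_of_real (h1w j)) \<le> K * \<tau>"
proof -
  define g where "g j = cnj (t j) * F (w j) / complex_of_real (h1w j)" for j
  have \<tau>: "0 \<le> \<tau>" using t[of 0] norm_ge_zero order_trans by blast
  have sum: "(\<Sum>j<n. (cmod (g j))\<^sup>2) \<le> (K * \<tau>)\<^sup>2" for n
  proof -
    \<comment> \<open>The functional takes the value \<open>S\<close> here, while the \<open>H1\<close> norm is at most \<open>\<tau> \<surd>S\<close>.\<close>
    define e where "e j = t j * g j / complex_of_real (h1w j)" for j
    define S where "S = (\<Sum>j<n. (cmod (g j))\<^sup>2)"
    have S0: "0 \<le> S" unfolding S_def by (intro sum_nonneg) auto
    have "F (comb {..<n} e) = (\<Sum>j<n. cnj (e j) * F (w j))" by (rule antilinear_comb[OF add scale finite_lessThan])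
    also have "\<dots> = (\<Sum>j<n. g j * cnj (g j))" by (intro sum.cong) (auto simp: e_def g_def)
    also have "\<dots> = complex_of_real S" unfolding S_def by (simp only: of_real_sum complex_norm_square)
    finally have "S = cmod (F (comb {..<n} e))" using S0 by simp
    also have "\<dots> \<le> K * H1_norm \<Omega> (comb {..<n} e)" by (rule bound[OF comb_H1])
    also have "H1_norm \<Omega> (comb {..<n} e) \<le> \<tau> * sqrt S"
    proof (rule power2_le_imp_le)
      have "(H1_norm \<Omega> (comb {..<n} e))\<^sup>2 = (\<Sum>j<n. (cmod (t j))\<^sup>2 * (cmod (g j))\<^sup>2)"
        unfolding H1_norm_comb[OF finite_lessThan] h1w(2)[symmetric] e_def using h1w(1)
        by (intro sum.cong) (auto simp: norm_divide norm_mult power_divide power_mult_distrib less_imp_neq[symmetric])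
      also have "\<dots> \<le> (\<Sum>j<n. \<tau>\<^sup>2 * (cmod (g j))\<^sup>2)"
        using t by (intro sum_mono mult_right_mono power_mono) auto
      also have "\<dots> = (\<tau> * sqrt S)\<^sup>2" using S0 by (simp add: power_mult_distrib S_def sum_distrib_left)
      finally show "(H1_norm \<Omega> (comb {..<n} e))\<^sup>2 \<le> (\<tau> * sqrt S)\<^sup>2" .
    qed (use \<tau> S0 in simp)
    finally have *: "S \<le> K * (\<tau> * sqrt S)" using K by (simp add: mult_left_mono)
    have "sqrt S \<le> K * \<tau>"
    proof (cases "S = 0")
      case False
      then have "0 < sqrt S" using S0 by simp
      moreover have "sqrt S * sqrt S \<le> K * \<tau> * sqrt S" using * S0 by (simp add: mult.assoc)
      ultimately show ?thesis by (simp only: mult_le_cancel_right_pos)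
    qed (use K \<tau> in simp)
    then have "(sqrt S)\<^sup>2 \<le> (K * \<tau>)\<^sup>2" using S0 by (intro power_mono) auto
    then show ?thesis using S0 by (simp add: S_def)
  qed
  then have sm: "summable (\<lambda>j. (cmod (g j))\<^sup>2)" by (intro summableI_nonneg_bounded[OF _ sum]) auto
  then have g: "g \<in> L2 seqs" by (simp add: L2_count_space_iff)
  then show "(\<lambda>j. cnj (t j) * F (w j) / complex_of_real (h1w j)) \<in> L2 seqs" by (simp add: g_def[abs_def])
  have "(L2_norm seqs g)\<^sup>2 \<le> (K * \<tau>)\<^sup>2"
    unfolding L2_norm_count_space[OF g] by (rule suminf_le_const[OF sm sum])
  then have "L2_norm seqs g \<le> K * \<tau>" by (rule power2_le_imp_le) (use K \<tau> in simp)
  then show "L2_norm seqs (\<lambda>j. cnj (t j) * F (w j) / complex_of_real (h1w j)) \<le> K * \<tau>" by (simp add: g_def[abs_def])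
qed

definition H1_of_seq :: "(nat \<Rightarrow> complex) \<Rightarrow> 'a \<Rightarrow> complex" where
  "H1_of_seq y = (SOME u. u \<in> H1 \<Omega> \<and> (\<forall>j. mode_coeff u j = y j / complex_of_real (h1w j)))"

lemma H1_of_seq:
  assumes "y \<in> L2 seqs"
  shows "H1_of_seq y \<in> H1 \<Omega>" "mode_coeff (H1_of_seq y) j = y j / complex_of_real (h1w j)"
proof -
  have "(1 + (freq j)\<^sup>2) * (cmod (y j / complex_of_real (h1w j)))\<^sup>2 = (cmod (y j))\<^sup>2" for j
    using h1w[of j] by (simp add: norm_divide power_divide)
  then have "summable (\<lambda>j. (1 + (freq j)\<^sup>2) * (cmod (y j / complex_of_real (h1w j)))\<^sup>2)"
    using assms by (simp add: L2_count_space_iff)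
  then have "\<exists>u. u \<in> H1 \<Omega> \<and> (\<forall>j. mode_coeff u j = y j / complex_of_real (h1w j))"
    using synthesis[of "\<lambda>j. y j / complex_of_real (h1w j)"] unfolding mode_coeff_def by blast
  from someI_ex[OF this] show "H1_of_seq y \<in> H1 \<Omega>" "mode_coeff (H1_of_seq y) j = y j / complex_of_real (h1w j)"
    by (auto simp: H1_of_seq_def)
qed

lemma H1_of_seq_diff:
  assumes y: "y \<in> L2 seqs" "z \<in> L2 seqs"
  defines "v \<equiv> \<lambda>x. H1_of_seq y x - H1_of_seq z x"
  shows "v \<in> H1 \<Omega>" "mode_coeff v j = (y j - z j) / complex_of_real (h1w j)"
    "H1_norm \<Omega> v = L2_norm seqs (\<lambda>j. y j - z j)"
proof -
  show v: "v \<in> H1 \<Omega>" unfolding v_def by (intro H1_diff H1_of_seq y)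
  show m: "mode_coeff v j = (y j - z j) / complex_of_real (h1w j)" for j
    using H1_of_seq(2)[OF y(1), of j] H1_of_seq(2)[OF y(2), of j] H1_of_seq(1)[OF y(1)] H1_of_seq(1)[OF y(2)]
    unfolding v_def mode_coeff_def by (simp add: L2_inner_diff_left H1_L2 w_H1 diff_divide_distrib)
  have d: "(\<lambda>j. y j - z j) \<in> L2 seqs" by (intro L2_diff y)
  have "(1 + (freq j)\<^sup>2) * (cmod (mode_coeff v j))\<^sup>2 = (cmod (y j - z j))\<^sup>2" for j
    unfolding m using h1w[of j] by (simp add: norm_divide power_divide)
  then have "(\<lambda>j. (cmod (y j - z j))\<^sup>2) sums (H1_norm \<Omega> v)\<^sup>2" using Parseval[OF v] by simp
  then have "(H1_norm \<Omega> v)\<^sup>2 = (L2_norm seqs (\<lambda>j. y j - z j))\<^sup>2"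
    unfolding L2_norm_count_space[OF d] by (rule sums_unique)
  then show "H1_norm \<Omega> v = L2_norm seqs (\<lambda>j. y j - z j)" by simp
qed

text \<open>By density of the finite sums of modes in \<open>H1\<close>.\<close>

lemma eq_if_eq_on_modes:
  assumes F: "\<And>u v. u \<in> H1 \<Omega> \<Longrightarrow> v \<in> H1 \<Omega> \<Longrightarrow> F (\<lambda>x. u x + v x) = F u + F v"
    "\<And>u c. u \<in> H1 \<Omega> \<Longrightarrow> F (\<lambda>x. c * u x) = cnj c * F u"
    "\<And>u. u \<in> H1 \<Omega> \<Longrightarrow> cmod (F u) \<le> K * H1_norm \<Omega> u"
    and w: "\<And>j. F (w j) = 0" and \<eta>: "\<eta> \<in> H1 \<Omega>"
  shows "F \<eta> = 0"
proof -
  let ?p = "\<lambda>n. comb {..<n} (mode_coeff \<eta>)"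
  have "F (\<lambda>x. ?p n x - \<eta> x) = - F \<eta>" for n
  proof -
    have "F (\<lambda>x. ?p n x + (-1) * \<eta> x) = F (?p n) + cnj (-1) * F \<eta>"
      using F(1)[OF comb_H1 H1_scale[OF \<eta>], of "{..<n}" "mode_coeff \<eta>" "-1"] F(2)[OF \<eta>, of "-1"] by simp
    also have "F (?p n) = (\<Sum>j<n. cnj (mode_coeff \<eta> j) * F (w j))" by (rule antilinear_comb[OF F(1,2) finite_lessThan])
    also have "\<dots> = 0" by (simp add: w)
    finally show ?thesis by simp
  qed
  then have "cmod (F \<eta>) \<le> K * H1_norm \<Omega> (\<lambda>x. ?p n x - \<eta> x)" for n
    using F(3)[OF H1_diff[OF comb_H1 \<eta>], of "{..<n}" "mode_coeff \<eta>"] by simp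
  moreover have "(\<lambda>n. K * H1_norm \<Omega> (\<lambda>x. ?p n x - \<eta> x)) \<longlonglongrightarrow> K * 0"
    by (intro tendsto_intros expansion \<eta>)
  ultimately have "cmod (F \<eta>) \<le> K * 0" by (intro LIMSEQ_le_const[where X = "\<lambda>n. K * H1_norm \<Omega> (\<lambda>x. ?p n x - \<eta> x)"]) auto
  then show ?thesis by simp
qed

text \<open>Let \<open>A y\<close> consist of the values of the form at \<open>(u, T w\<^sub>j)\<close>, normalised in \<open>H1\<close>, where \<open>u\<close> has the coordinates
  \<open>y\<close>. Boundedness of the form makes \<open>A\<close> Lipschitz, and \<open>(A y, y)\<close> is the limit of the form at \<open>(u, Tu\<^sub>n)\<close> for the
  partial sums \<open>u\<^sub>n\<close>, so coercivity makes \<open>A\<close> strongly monotone. A solution of \<open>A y = g\<close> solves the original equation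
  on every mode because the multiplier has no zeros.\<close>

lemma form_solvable:
  assumes s: "s \<ge> 1" and \<kappa>: "0 < Re \<kappa>" and F: "F \<in> H1_antidual \<Omega>"
  shows "\<exists>u\<in>H1 \<Omega>. \<forall>\<eta>\<in>H1 \<Omega>. form s \<kappa> u \<eta> = F \<eta>"
proof -
  let ?t = "multiplier s \<kappa>"
  define \<tau> where "\<tau> = 1 + boost s \<kappa>"
  have \<tau>: "1 \<le> \<tau>" using boost_ge_1[OF s \<kappa>] by (simp add: \<tau>_def)
  have t: "cmod (?t j) \<le> \<tau>" for j unfolding \<tau>_def by (rule norm_multiplier_le[OF s \<kappa>])
  obtain K0 where K0: "K0 \<ge> 0" "\<And>u v. u \<in> H1 \<Omega> \<Longrightarrow> v \<in> H1 \<Omega> \<Longrightarrow> cmod (form s \<kappa> u v) \<le> K0 * (H1_norm \<Omega> u * H1_norm \<Omega> v)"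
    using form_bound[of s \<kappa>] by blast
  obtain K1 where K1: "K1 > 0" "\<And>I d. finite I \<Longrightarrow> (H1_norm \<Omega> (comb I d))\<^sup>2 \<le> K1 * Re (form s \<kappa> (comb I d) (T s \<kappa> I d))"
    using form_test_H1[OF s \<kappa>] by blast
  have Fadd: "\<And>u v. u \<in> H1 \<Omega> \<Longrightarrow> v \<in> H1 \<Omega> \<Longrightarrow> F (\<lambda>x. u x + v x) = F u + F v"
    and Fscale: "\<And>u c. u \<in> H1 \<Omega> \<Longrightarrow> F (\<lambda>x. c * u x) = cnj c * F u"
    using F by (auto simp: H1_antidual_def)
  obtain KF where KF: "KF \<ge> 0" "\<And>u. u \<in> H1 \<Omega> \<Longrightarrow> cmod (F u) \<le> KF * H1_norm \<Omega> u"
  proof -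
    obtain K where K: "\<And>u. u \<in> H1 \<Omega> \<Longrightarrow> cmod (F u) \<le> K * H1_norm \<Omega> u"
      using F unfolding H1_antidual_def by blast
    have "cmod (F u) \<le> \<bar>K\<bar> * H1_norm \<Omega> u" if "u \<in> H1 \<Omega>" for u
      using K[OF that] mult_right_mono[OF abs_ge_self[of K] H1_norm_nonneg[of u]] by linarith
    then show ?thesis by (intro that[of "\<bar>K\<bar>"]) auto
  qed
  define fc where "fc u j = cnj (?t j) * form s \<kappa> u (w j) / complex_of_real (h1w j)" for u j
  define A where "A y = fc (H1_of_seq y)" for y
  have fc: "fc u \<in> L2 seqs" "L2_norm seqs (fc u) \<le> K0 * H1_norm \<Omega> u * \<tau>" if u: "u \<in> H1 \<Omega>" for u
    unfolding fc_def using functional_coeffs[of "form s \<kappa> u" "K0 * H1_norm \<Omega> u" ?t \<tau>] K0 t u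
    by (simp_all add: form_add_right form_scale_right mult.assoc)
  have fc_diff: "fc (\<lambda>x. u x - v x) = (\<lambda>j. fc u j - fc v j)" if "u \<in> H1 \<Omega>" "v \<in> H1 \<Omega>" for u v
    unfolding fc_def using that by (simp add: form_diff_left w_H1 algebra_simps diff_divide_distrib)
  have "\<exists>y\<in>L2 seqs. AE j in seqs. A y j = cnj (?t j) * F (w j) / complex_of_real (h1w j)"
  proof (rule strongly_monotone_onto[where K = "max (1 / K1) (K0 * \<tau>)" and c = "1 / K1"])
    show "A y \<in> L2 seqs" if "y \<in> L2 seqs" for y
      unfolding A_def by (rule fc(1)[OF H1_of_seq(1)[OF that]])
    show "(\<lambda>j. cnj (?t j) * F (w j) / complex_of_real (h1w j)) \<in> L2 seqs"
      by (rule functional_coeffs(1)[of F KF ?t \<tau>]) (use Fadd Fscale KF t in auto)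
    fix y z assume yz: "y \<in> L2 seqs" "z \<in> L2 seqs"
    let ?v = "\<lambda>x. H1_of_seq y x - H1_of_seq z x"
    note v = H1_of_seq_diff[OF yz]
    have Av: "(\<lambda>j. A y j - A z j) = fc ?v"
      unfolding A_def by (rule fc_diff[OF H1_of_seq(1) H1_of_seq(1), OF yz, symmetric])
    have "L2_norm seqs (fc ?v) \<le> K0 * \<tau> * L2_norm seqs (\<lambda>j. y j - z j)"
      using fc(2)[OF v(1)] unfolding v(3) by (simp add: mult_ac)
    also have "\<dots> \<le> max (1 / K1) (K0 * \<tau>) * L2_norm seqs (\<lambda>j. y j - z j)"
      by (intro mult_right_mono) auto
    finally show "L2_norm seqs (\<lambda>j. A y j - A z j) \<le> max (1 / K1) (K0 * \<tau>) * L2_norm seqs (\<lambda>j. y j - z j)"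
      unfolding Av .
    have "(\<lambda>j. fc ?v j * cnj (y j - z j)) sums L2_inner seqs (fc ?v) (\<lambda>j. y j - z j)"
      by (intro L2_inner_count_space_sums fc v L2_diff yz)
    then have "(\<lambda>n. \<Sum>j<n. fc ?v j * cnj (y j - z j)) \<longlonglongrightarrow> L2_inner seqs (fc ?v) (\<lambda>j. y j - z j)"
      by (simp add: sums_def)
    moreover have "(\<Sum>j<n. fc ?v j * cnj (y j - z j)) = form s \<kappa> ?v (T s \<kappa> {..<n} (mode_coeff ?v))" for n
    proof -
      have "form s \<kappa> ?v (T s \<kappa> {..<n} (mode_coeff ?v)) = (\<Sum>j<n. cnj (?t j * mode_coeff ?v j) * form s \<kappa> ?v (w j))"
        by (rule antilinear_comb) (auto simp: form_add_right form_scale_right v)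
      also have "\<dots> = (\<Sum>j<n. fc ?v j * cnj (y j - z j))"
        unfolding v(2) fc_def by (intro sum.cong) auto
      finally show ?thesis ..
    qed
    ultimately have lim: "(\<lambda>n. form s \<kappa> ?v (T s \<kappa> {..<n} (mode_coeff ?v))) \<longlonglongrightarrow> L2_inner seqs (fc ?v) (\<lambda>j. y j - z j)"
      by simp
    have "1 * (H1_norm \<Omega> ?v)\<^sup>2 \<le> K1 * Re (L2_inner seqs (fc ?v) (\<lambda>j. y j - z j))"
    proof (rule coercive_limit[OF v(1) s \<kappa> _ partial_sum_norm_tendsto(2)[OF v(1)]])
      show "1 * (H1_norm \<Omega> (comb {..<n} (mode_coeff ?v)))\<^sup>2
          \<le> K1 * Re (form s \<kappa> (comb {..<n} (mode_coeff ?v)) (T s \<kappa> {..<n} (mode_coeff ?v)))" for n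
        using K1(2)[OF finite_lessThan] by simp
      show "(\<lambda>n. Re (form s \<kappa> ?v (T s \<kappa> {..<n} (mode_coeff ?v)))) \<longlonglongrightarrow> Re (L2_inner seqs (fc ?v) (\<lambda>j. y j - z j))"
        by (intro tendsto_intros lim)
    qed (use K1 in auto)
    then show "1 / K1 * (L2_norm seqs (\<lambda>j. y j - z j))\<^sup>2 \<le> Re (L2_inner seqs (\<lambda>j. A y j - A z j) (\<lambda>j. y j - z j))"
      unfolding Av v(3) using K1(1) by (simp add: field_simps)
  qed (use K1 in auto)
  then obtain y where y: "y \<in> L2 seqs" "\<And>j. A y j = cnj (?t j) * F (w j) / complex_of_real (h1w j)"
    by (auto simp: AE_count_space)
  let ?u = "H1_of_seq y"
  have u: "?u \<in> H1 \<Omega>" by (rule H1_of_seq(1)[OF y(1)])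
  have modes: "form s \<kappa> ?u (w j) = F (w j)" for j
    using y(2)[of j] multiplier_nonzero[OF s \<kappa>, of j] h1w(1)[of j] by (simp add: A_def fc_def)
  have "form s \<kappa> ?u \<eta> - F \<eta> = 0" if \<eta>: "\<eta> \<in> H1 \<Omega>" for \<eta>
  proof (rule eq_if_eq_on_modes[of "\<lambda>\<eta>. form s \<kappa> ?u \<eta> - F \<eta>" "K0 * H1_norm \<Omega> ?u + KF"])
    fix v assume v: "v \<in> H1 \<Omega>"
    have "cmod (form s \<kappa> ?u v - F v) \<le> cmod (form s \<kappa> ?u v) + cmod (F v)" by (rule norm_triangle_ineq4)
    also have "\<dots> \<le> (K0 * H1_norm \<Omega> ?u + KF) * H1_norm \<Omega> v"
      using K0(2)[OF u v] KF(2)[OF v] by (simp add: distrib_right mult.assoc)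
    finally show "cmod (form s \<kappa> ?u v - F v) \<le> (K0 * H1_norm \<Omega> ?u + KF) * H1_norm \<Omega> v" .
  qed (use modes \<eta> in \<open>auto simp: form_add_right form_scale_right u Fadd Fscale algebra_simps\<close>)
  then show ?thesis using u by auto
qed

lemma wave_form_eq_form: "wave_form \<Omega> \<Gamma> \<nu> (\<i> * complex_of_real s) = form s (khat \<nu> (\<i> * complex_of_real s))"
  by (intro ext) (simp add: wave_form_def form_def power_mult_distrib)

lemma form_solution_iff:
  "form_solution \<Omega> \<Gamma> \<nu> (\<i> * complex_of_real s) F u \<longleftrightarrow>
   u \<in> H1 \<Omega> \<and> (\<forall>\<eta>\<in>H1 \<Omega>. form s (khat \<nu> (\<i> * complex_of_real s)) u \<eta> = F \<eta>)"
  by (simp add: form_solution_def wave_form_eq_form)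

lemma L2_functional_antidual: "f \<in> L2 M \<Longrightarrow> L2_functional \<Omega> f \<in> H1_antidual \<Omega>"
proof -
  assume f: "f \<in> L2 M"
  have "cmod (L2_inner M f u) \<le> L2_norm M f * H1_norm \<Omega> u" if "u \<in> H1 \<Omega>" for u
    by (rule order_trans[OF L2_Cauchy_Schwarz[OF f H1_L2[OF that]]
          mult_left_mono[OF L2_norm_le_H1_norm L2_norm_nonneg]])
  then show ?thesis
    using f by (auto simp: H1_antidual_def L2_functional_def L2_inner_add_right L2_inner_scale_right H1_L2)
qed

theorem resolvent_estimate:
  assumes s: "s \<ge> 1" and \<kappa>: "0 < Re (khat \<nu> (\<i> * complex_of_real s))"
    and G: "s * weight s * cmod (khat \<nu> (\<i> * complex_of_real s)) \<le> G" "0 \<le> G"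
  shows "resolvent_exists \<Omega> \<Gamma> \<nu> (\<i> * complex_of_real s)"
    and "L2_opnorm M (\<lambda>f. resolvent \<Omega> \<Gamma> \<nu> (\<i> * complex_of_real s) (L2_functional \<Omega> f))
      \<le> ennreal (4 * Km * (1 + G + Kf * G\<^sup>2) / (s * Re (khat \<nu> (\<i> * complex_of_real s))))"
proof -
  let ?z = "\<i> * complex_of_real s" and ?\<kappa> = "khat \<nu> (\<i> * complex_of_real s)"
  let ?C = "4 * Km * (1 + G + Kf * G\<^sup>2) / (s * Re ?\<kappa>)"
  have C: "0 \<le> ?C" using Km_pos Kf_pos G(2) s \<kappa> by simp
  show ex: "resolvent_exists \<Omega> \<Gamma> \<nu> ?z"
    unfolding resolvent_exists_def
  proof
    fix F assume F: "F \<in> H1_antidual \<Omega>"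
    obtain u where u: "form_solution \<Omega> \<Gamma> \<nu> ?z F u"
      using form_solvable[OF s \<kappa> F] by (auto simp: form_solution_iff)
    have "AE x in M. v x = u x" if v: "form_solution \<Omega> \<Gamma> \<nu> ?z F v" for v
    proof -
      have uv: "u \<in> H1 \<Omega>" "v \<in> H1 \<Omega>" using u v by (auto simp: form_solution_iff)
      have "L2_norm M (\<lambda>x. v x - u x) \<le> ?C * L2_norm M (\<lambda>_. 0)"
      proof (rule resolvent_bound[OF H1_diff[OF uv(2,1)] L2_zero _ s \<kappa> G])
        fix \<eta> assume "\<eta> \<in> H1 \<Omega>"
        then show "form s ?\<kappa> (\<lambda>x. v x - u x) \<eta> = L2_inner M (\<lambda>_. 0) \<eta>"
          using u v by (simp add: form_diff_left form_solution_iff L2_inner_def)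
      qed
      then have "L2_norm M (\<lambda>x. v x - u x) \<le> 0" by (simp add: L2_norm_def)
      then have "L2_norm M (\<lambda>x. v x - u x) = 0" by (simp add: order_antisym)
      then show ?thesis using L2_norm_eq_0_iff[OF H1_L2[OF H1_diff[OF uv(2,1)]]] by simp
    qed
    then show "\<exists>u. form_solution \<Omega> \<Gamma> \<nu> ?z F u \<and> (\<forall>v. form_solution \<Omega> \<Gamma> \<nu> ?z F v \<longrightarrow> (AE x in M. v x = u x))"
      using u by blast
  qed
  show "L2_opnorm M (\<lambda>f. resolvent \<Omega> \<Gamma> \<nu> ?z (L2_functional \<Omega> f)) \<le> ennreal ?C"
    unfolding L2_opnorm_def
  proof (rule SUP_least)
    fix f assume "f \<in> {f \<in> L2 M. L2_norm M f \<le> 1}"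
    then have f: "f \<in> L2 M" "L2_norm M f \<le> 1" by auto
    have "\<exists>u. form_solution \<Omega> \<Gamma> \<nu> ?z (L2_functional \<Omega> f) u"
      using ex L2_functional_antidual[OF f(1)] by (auto simp: resolvent_exists_def)
    then have "form_solution \<Omega> \<Gamma> \<nu> ?z (L2_functional \<Omega> f) (resolvent \<Omega> \<Gamma> \<nu> ?z (L2_functional \<Omega> f))"
      unfolding resolvent_def by (rule someI_ex)
    then have "L2_norm M (resolvent \<Omega> \<Gamma> \<nu> ?z (L2_functional \<Omega> f)) \<le> ?C * L2_norm M f"
      by (intro resolvent_bound s \<kappa> G f(1)) (auto simp: form_solution_iff L2_functional_def)
    also have "\<dots> \<le> ?C * 1" by (rule mult_left_mono[OF f(2) C])
    finally show "ennreal (L2_norm M (resolvent \<Omega> \<Gamma> \<nu> ?z (L2_functional \<Omega> f))) \<le> ennreal ?C"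
      by (simp add: ennreal_leI)
  qed
qed

end

text \<open>For large \<open>s\<close> the quotient \<open>\<bar>\<kappa>\<bar>\<^sup>2 / (Re \<kappa>)\<^sup>2\<close> is at least 1 and can be dropped; below, \<open>L(s)\<close> and \<open>\<bar>\<kappa>\<bar>\<close> are both
  bounded.\<close>

lemma kernel_weight_bounded:
  assumes kernel: "integrable_cm_kernel k \<nu>" and \<alpha>: "0 \<le> \<alpha>"
    and small: "(\<lambda>s::real. cmod (khat \<nu> (\<i> * s)) * ((cmod (khat \<nu> (\<i> * s)))\<^sup>2 / (Re (khat \<nu> (\<i> * s)))\<^sup>2))
           \<in> o[at_top](\<lambda>s. 1 / (s powr \<alpha> * (1 + ln s)))"
  shows "\<exists>G\<ge>0. \<forall>s\<ge>1. s powr \<alpha> * (1 + ln s) * cmod (khat \<nu> (\<i> * complex_of_real s)) \<le> G"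
proof -
  let ?\<kappa> = "\<lambda>s. khat \<nu> (\<i> * complex_of_real s)"
  let ?L = "\<lambda>s::real. s powr \<alpha> * (1 + ln s)"
  have L0: "0 < ?L s" if "s \<ge> 1" for s
  proof -
    have "0 \<le> ln s" using that by simp
    then have "0 < 1 + ln s" by linarith
    then show ?thesis using that by simp
  qed
  have "\<forall>\<^sub>F s in at_top. norm (cmod (?\<kappa> s) * ((cmod (?\<kappa> s))\<^sup>2 / (Re (?\<kappa> s))\<^sup>2)) \<le> 1 * norm (1 / ?L s)"
    using landau_o.smallD[OF small, of 1] by simp
  then obtain s0 where s0: "\<And>s. s \<ge> s0 \<Longrightarrow>
      norm (cmod (?\<kappa> s) * ((cmod (?\<kappa> s))\<^sup>2 / (Re (?\<kappa> s))\<^sup>2)) \<le> 1 * norm (1 / ?L s)"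
    unfolding eventually_at_top_linorder by blast
  define b where "b = max 1 s0"
  define K where "K = (\<integral>\<tau>. 1 / \<tau> \<partial>\<nu>)"
  have K: "cmod (?\<kappa> s) \<le> K" for s unfolding K_def by (rule khat_bound[OF kernel])
  then have K0: "0 \<le> K" using norm_ge_zero order_trans by blast
  have Lb: "0 < ?L b" by (rule L0) (simp add: b_def)
  have "?L s * cmod (?\<kappa> s) \<le> 1 + ?L b * K" if s: "s \<ge> 1" for s
  proof (cases "s \<ge> s0")
    case True
    have a: "0 < Re (?\<kappa> s)" by (rule Re_khat_pos[OF kernel])
    have "(Re (?\<kappa> s))\<^sup>2 \<le> (cmod (?\<kappa> s))\<^sup>2" using a complex_Re_le_cmod[of "?\<kappa> s"] by (intro power_mono) auto
    then have "1 \<le> (cmod (?\<kappa> s))\<^sup>2 / (Re (?\<kappa> s))\<^sup>2" using a by simp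
    then have "cmod (?\<kappa> s) * 1 \<le> cmod (?\<kappa> s) * ((cmod (?\<kappa> s))\<^sup>2 / (Re (?\<kappa> s))\<^sup>2)"
      by (intro mult_left_mono) auto
    also have "\<dots> \<le> 1 / ?L s" using s0[OF True] L0[OF s] by simp
    finally have "?L s * cmod (?\<kappa> s) \<le> 1" using L0[OF s] by (simp add: pos_le_divide_eq mult.commute)
    moreover have "0 \<le> ?L b * K" using Lb K0 by simp
    ultimately show ?thesis by linarith
  next
    case False
    have "?L s \<le> ?L b" using s False \<alpha> by (intro mult_mono powr_mono2) (auto simp: b_def)
    then have "?L s * cmod (?\<kappa> s) \<le> ?L b * K" by (rule mult_mono[OF _ K less_imp_le[OF Lb] norm_ge_zero])
    then show ?thesis by simp
  qed
  moreover have "0 \<le> 1 + ?L b * K" using mult_nonneg_nonneg[OF less_imp_le[OF Lb] K0] by linarith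
  ultimately show ?thesis by blast
qed

theorem theorem9:
  fixes \<Omega> :: "'a::euclidean_space set"
    and \<Gamma> :: "('a \<Rightarrow> complex) \<Rightarrow> 'a \<Rightarrow> complex"
    and k :: "real \<Rightarrow> real" and \<nu> :: "real measure"
    and w :: "nat \<Rightarrow> 'a \<Rightarrow> complex" and freq :: "nat \<Rightarrow> real"
    and \<alpha> :: real
  assumes "bounded_lipschitz_domain \<Omega>"
    and "trace_operator \<Omega> \<Gamma>"
    and "integrable_cm_kernel k \<nu>"
    and "neumann_eigenbasis \<Omega> w freq"
    and "0 \<le> \<alpha>" "\<alpha> < 1"
    and "\<forall>\<^sub>F \<delta> in at_right (0::real). \<exists>c>0. \<exists>C>0. \<forall>p. spectral_cluster \<Omega> w freq \<delta> p \<longrightarrow>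
           c * (L2_norm (lebesgue_on \<Omega>) p)\<^sup>2 \<le> (\<integral>x. (cmod (\<Gamma> p x))\<^sup>2 \<partial>surface_measure \<Omega>) \<and>
           (\<integral>x. (cmod (\<Gamma> p x))\<^sup>2 \<partial>surface_measure \<Omega>)
             \<le> C * (1 + mean_frequency \<Omega> w freq p) powr \<alpha> * (L2_norm (lebesgue_on \<Omega>) p)\<^sup>2"
    and "(\<lambda>s::real. cmod (khat \<nu> (\<i> * s)) * ((cmod (khat \<nu> (\<i> * s)))\<^sup>2 / (Re (khat \<nu> (\<i> * s)))\<^sup>2))
           \<in> o[at_top](\<lambda>s. 1 / (s powr \<alpha> * (1 + ln s)))"
  shows "\<exists>C>0. \<forall>s\<ge>1. resolvent_exists \<Omega> \<Gamma> \<nu> (\<i> * complex_of_real s) \<and>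
           L2_opnorm (lebesgue_on \<Omega>)
             (\<lambda>f. resolvent \<Omega> \<Gamma> \<nu> (\<i> * complex_of_real s) (L2_functional \<Omega> f))
           \<le> ennreal (C / (s * Re (khat \<nu> (\<i> * complex_of_real s))))"
proof -
  have "\<forall>\<^sub>F \<delta> in at_right (0::real). 0 < \<delta> \<and> \<delta> \<le> 1"
    by (rule eventually_mono[OF eventually_at_right_real[of 0 1]]) auto
  from eventually_conj[OF assms(7) this] eventually_happens'[OF trivial_limit_at_right_real]
  obtain \<delta> where \<delta>: "0 < \<delta>" "\<delta> \<le> 1" and "\<exists>c>0. \<exists>C>0. \<forall>p. spectral_cluster \<Omega> w freq \<delta> p \<longrightarrow>
           c * (L2_norm (lebesgue_on \<Omega>) p)\<^sup>2 \<le> (\<integral>x. (cmod (\<Gamma> p x))\<^sup>2 \<partial>surface_measure \<Omega>) \<and>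
           (\<integral>x. (cmod (\<Gamma> p x))\<^sup>2 \<partial>surface_measure \<Omega>)
             \<le> C * (1 + mean_frequency \<Omega> w freq p) powr \<alpha> * (L2_norm (lebesgue_on \<Omega>) p)\<^sup>2"
    by blast
  then obtain c C where cC: "0 < c" "0 < C" "\<And>p. spectral_cluster \<Omega> w freq \<delta> p \<Longrightarrow>
           c * (L2_norm (lebesgue_on \<Omega>) p)\<^sup>2 \<le> (L2_norm (surface_measure \<Omega>) (\<Gamma> p))\<^sup>2 \<and>
           (L2_norm (surface_measure \<Omega>) (\<Gamma> p))\<^sup>2
             \<le> C * (1 + mean_frequency \<Omega> w freq p) powr \<alpha> * (L2_norm (lebesgue_on \<Omega>) p)\<^sup>2"
    unfolding L2_norm_sq[of "surface_measure \<Omega>"] by blast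
  interpret clustered_domain \<Omega> \<Gamma> w freq \<alpha> \<delta> c C
    using assms(1,2,4,5,6) \<delta> cC by unfold_locales (auto simp: bounded_lipschitz_domain_def)
  obtain G where G: "0 \<le> G" "\<And>s. s \<ge> 1 \<Longrightarrow> s powr \<alpha> * (1 + ln s) * cmod (khat \<nu> (\<i> * complex_of_real s)) \<le> G"
    using kernel_weight_bounded[OF assms(3,5,8)] by blast
  have G': "s * weight s * cmod (khat \<nu> (\<i> * complex_of_real s)) \<le> G" if "s \<ge> 1" for s
  proof -
    have "s * weight s = s powr \<alpha> * (1 + ln s)" using that by (simp add: weight_def powr_diff)
    then show ?thesis using G(2)[OF that] by simp
  qed
  have "0 < 4 * Km * (1 + G + Kf * G\<^sup>2)"
    using Km_pos Kf_pos G(1) by (intro mult_pos_pos add_pos_nonneg) auto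
  moreover note resolvent_estimate[OF _ Re_khat_pos[OF assms(3)] G' G(1)]
  ultimately show ?thesis by blast
qed

end
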